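(* There exists a constant $C>0$, depending only on the fixed parameters $\Lambda, K, \tilde a, a_1$ (in particular independent of $h$, $t$, $\ell_0$, $\ell_{0,h}$), such that the following holds. Let $\ell$ be the weak solution of the continuous problem (P) with initial data $\ell_0$, let $N\ge 1$, $h=\Lambda/N$, $\ell_{0,h}\in\mathcal V_h$, and let $\ell_h$ be the solution of the discrete problem (P$_h$) with initial data $\ell_{0,h}$ (both problems are defined in the context). Then for all $t\ge 0$, $$\Vert \partial_y(\ell_h-\ell)(t)\Vert \le C h\big(\Vert \partial_{yy}\ell_0\Vert+\Vert\partial_{yy}\ell(t)\Vert\big)+ C\Vert \partial_y(\ell_{0,h}-\ell_0)\Vert + C\sqrt h\left(\int_0^t \Vert \partial_{yt}\ell(s)\Vert^2\,ds\right)^{1/2}.$$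
   Context: Fix constants $\Lambda,K,\tilde a,a_1>0$, and $L>0$, $\omega>0$, $\tilde\varepsilon\in[0,1)$, and let $L_0(t)=L(1+\tilde\varepsilon\cos(\omega t))$, with $\dot L_0$ its time derivative. $\Vert\cdot\Vert$ denotes the norm of $L^2((0,\Lambda))$. Let $\mathcal V=\{u\in H^1((0,\Lambda)) : u(\Lambda)=0\}$ with scalar product $(u,v)_{\mathcal V}=\int_0^\Lambda \partial_y u\,\partial_y v\,dy$, and let $$\kappa(u,v)=\Lambda^2K\int_0^\Lambda \partial_y u\,\partial_y v\,dy+\frac{\Lambda K\tilde a}{2a_1}u(0)v(0),\qquad u,v\in\mathcal V.$$ Continuous problem (P): given $\ell_0\in L^2((0,\Lambda))$, $\ell=\ell(y,t)$ is the unique function which for every $T>0$ belongs to $L^\infty(0,T;L^2((0,\Lambda)))\cap L^2(0,T;\mathcal V)$ and satisfies $\ell(\cdot,0)=\ell_0$ and, for all $v\in\mathcal V$ and $t\in(0,T)$ (in the usual weak sense in time), $$\frac{d}{dt}\int_0^\Lambda \ell(y,t) v(y)\,dy+\kappa(\ell(\cdot,t),v)=-\frac{\Lambda}{2}\dot L_0(t)\,v(0).$$ This is the weak form of the heat equation $\partial_t\ell=\Lambda^2K\partial_{yy}\ell$ on $(0,\Lambda)$ with $\Lambda^2K\partial_y\ell(0,t)-\Lambda K\frac{\tilde a}{2a_1}\ell(0,t)=\frac\Lambda2\dot L_0(t)$ and $\ell(\Lambda,t)=0$. For $t\ge0$, $\ell(t)=\ell(\cdot,t)$ denotes the value at $t$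 of the representative of $\ell$ that is continuous in time with values in $L^2((0,\Lambda))$. Discretization: for an integer $N\ge1$, let $h=\Lambda/N$ and $y_j=(j-1)h$ for $1\le j\le N+1$. Let $\mathcal V_h\subset\mathcal V$ be the space of continuous functions on $[0,\Lambda]$ that are affine on each $[y_j,y_{j+1}]$ and vanish at $\Lambda$. For $u_h,v_h\in\mathcal V_h$ let $(u_h,v_h)_h=h\sum_{j=1}^N u_h(y_j)v_h(y_j)$. Discrete problem (P$_h$): given $\ell_{0,h}\in\mathcal V_h$, $\ell_h:[0,\infty)\to\mathcal V_h$ is the unique $C^1$ function with $\ell_h(0)=\ell_{0,h}$ and $$(\partial_t\ell_h(t),\chi_h)_h+\kappa(\ell_h(t),\chi_h)=-\frac\Lambda2\dot L_0(t)\chi_h(0)\qquad\text{for all }\chi_h\in\mathcal V_h,\ t\ge0.$$ Equivalently, the nodal vector $L_h(t)=(\ell_h(y_1,t),\dots,\ell_h(y_N,t))^T$ solves $\frac{d}{dt}(\widetilde M_hL_h)+K_hL_h=\tilde f$, where $\widetilde M_h=h\,\mathrm{Id}$, $(K_h)_{ij}=\kappa(\Phi_i,\Phi_j)$, with $\Phi_j\in\mathcal V_h$ the hat functions $\Phi_j(y_k)=\delta_{jk}$ ($1\le j,k\le N$), and $\tilde f=(-\frac\Lambda2\dot L_0,0,\dots,0)^T$. Convention: derivatives of $\ell$ and $\ell_0$ in the estimate are in the sense of distributions, and an $L^2$ norm (or time integral) on the right-hand side is understood to be $+\infty$ if the corresponding function is not square integrable (so the estimate has content only when, in particular, $\ell_0\in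 H^2((0,\Lambda))$). *)

theory Defs
  imports "HOL-Analysis.Analysis"
begin

section \<open>Distributional derivatives and square integrable functions\<close>

text \<open>Elements of Lebesgue and Sobolev spaces are represented by measurable functions on the whole
  type, of which only the values almost everywhere on the domain matter.\<close>

definition iter_partial :: "'a::euclidean_space list \<Rightarrow> ('a \<Rightarrow> real) \<Rightarrow> 'a \<Rightarrow> real" where
  "iter_partial bs f = foldr (\<lambda>b g x. frechet_derivative g (at x) b) bs f"

text \<open>The space of smooth functions with compact support in \<open>\<Omega>\<close>. A function all of whose iterated
  partial derivatives exist and are differentiable is smooth, and conversely.\<close>

definition test_functions :: "'a::euclidean_space set \<Rightarrow> ('a \<Rightarrow> real) set" where
  "test_functions \<Omega> = {\<phi>. (\<forall>bs. set bs \<subseteq> Basis \<longrightarrow> (\<forall>x. iter_partial bs \<phi> differentiable (at x)))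
     \<and> compact (closure {x. \<phi> x \<noteq> 0}) \<and> closure {x. \<phi> x \<noteq> 0} \<subseteq> \<Omega>}"

definition locally_integrable :: "'a::euclidean_space set \<Rightarrow> ('a \<Rightarrow> real) \<Rightarrow> bool" where
  "locally_integrable \<Omega> u \<longleftrightarrow> (\<forall>S. compact S \<and> S \<subseteq> \<Omega> \<longrightarrow> integrable (lebesgue_on S) u)"

text \<open>\<open>weak_deriv \<Omega> [b\<^sub>1, \<dots>, b\<^sub>m] u g\<close>: the distributional derivative of \<open>u\<close> on the open set \<open>\<Omega>\<close> in
  the directions \<open>b\<^sub>1, \<dots>, b\<^sub>m\<close> is the locally integrable function \<open>g\<close>.\<close>

definition weak_deriv ::
    "'a::euclidean_space set \<Rightarrow> 'a list \<Rightarrow> ('a \<Rightarrow> real) \<Rightarrow> ('a \<Rightarrow> real) \<Rightarrow> bool" where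
  "weak_deriv \<Omega> bs u g \<longleftrightarrow> locally_integrable \<Omega> u \<and> locally_integrable \<Omega> g \<and>
     (\<forall>\<phi>\<in>test_functions \<Omega>.
        (LINT x|lebesgue_on \<Omega>. u x * iter_partial bs \<phi> x)
          = (- 1) ^ length bs * (LINT x|lebesgue_on \<Omega>. g x * \<phi> x))"

definition L2 :: "'a::euclidean_space set \<Rightarrow> ('a \<Rightarrow> real) set" where
  "L2 \<Omega> = {f \<in> borel_measurable (lebesgue_on \<Omega>). integrable (lebesgue_on \<Omega>) (\<lambda>x. (f x)\<^sup>2)}"

definition L2_norm :: "'a::euclidean_space set \<Rightarrow> ('a \<Rightarrow> real) \<Rightarrow> real" where
  "L2_norm \<Omega> f = sqrt (LINT x|lebesgue_on \<Omega>. (f x)\<^sup>2)"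

text \<open>\<open>L\<^sup>2\<close> norm of a distributional derivative, equal to \<open>\<infinity>\<close> if the derivative is not a square
  integrable function. All members of the set below agree almost everywhere on \<open>\<Omega>\<close>, so the infimum
  is over at most one value, and it is \<open>\<infinity>\<close> if there is none.\<close>

definition deriv_norm :: "'a::euclidean_space set \<Rightarrow> 'a list \<Rightarrow> ('a \<Rightarrow> real) \<Rightarrow> ennreal" where
  "deriv_norm \<Omega> bs u = (INF g\<in>{g \<in> L2 \<Omega>. weak_deriv \<Omega> bs u g}. ennreal (L2_norm \<Omega> g))"

text \<open>\<open>(\<integral>\<^sub>0\<^sup>t \<parallel>\<partial>\<^sub>y\<^sub>t u(s)\<parallel>\<^sup>2 ds)\<^sup>1\<^sup>/\<^sup>2\<close>, with the same convention. The mixed derivative is the one in the sense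
  of distributions on \<open>(0,\<Lambda>) \<times> (0,t)\<close>. Functions of time and space are curried with the time first,
  whereas points of this set have the space coordinate first.\<close>

definition mixed_deriv_norm :: "real \<Rightarrow> real \<Rightarrow> (real \<Rightarrow> real \<Rightarrow> real) \<Rightarrow> ennreal" where
  "mixed_deriv_norm \<Lambda> t u =
     (INF g\<in>{g \<in> L2 ({0<..<\<Lambda>} \<times> {0<..<t}).
              weak_deriv ({0<..<\<Lambda>} \<times> {0<..<t}) [(1, 0), (0, 1)] (\<lambda>(y, s). u s y) g}.
        ennreal (sqrt (LINT s|lebesgue_on {0<..<t}. (L2_norm {0<..<\<Lambda>} (\<lambda>y. g (y, s)))\<^sup>2)))"


section \<open>The space \<open>\<V>\<close> and the bilinear form\<close>

text \<open>The value at \<open>a \<in> [0,\<Lambda>]\<close> of the representative of \<open>u\<close> that is continuous on \<open>[0,\<Lambda>]\<close>.\<close>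

definition bdry_value :: "real \<Rightarrow> (real \<Rightarrow> real) \<Rightarrow> real \<Rightarrow> real" where
  "bdry_value \<Lambda> u a = (THE c. \<exists>w. continuous_on {0..\<Lambda>} w \<and>
     (AE x in lebesgue_on {0<..<\<Lambda>}. u x = w x) \<and> c = w a)"

definition H1 :: "real \<Rightarrow> (real \<Rightarrow> real) set" where
  "H1 \<Lambda> = {u \<in> L2 {0<..<\<Lambda>}. \<exists>g\<in>L2 {0<..<\<Lambda>}. weak_deriv {0<..<\<Lambda>} [1] u g}"

definition V :: "real \<Rightarrow> (real \<Rightarrow> real) set" where
  "V \<Lambda> = {u \<in> H1 \<Lambda>. bdry_value \<Lambda> u \<Lambda> = 0}"

text \<open>The weak derivative, which is determined up to a null set.\<close>

definition wderiv :: "real \<Rightarrow> (real \<Rightarrow> real) \<Rightarrow> real \<Rightarrow> real" where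
  "wderiv \<Lambda> u = (SOME g. weak_deriv {0<..<\<Lambda>} [1] u g)"

definition kappa ::
    "real \<Rightarrow> real \<Rightarrow> real \<Rightarrow> real \<Rightarrow> (real \<Rightarrow> real) \<Rightarrow> (real \<Rightarrow> real) \<Rightarrow> real" where
  "kappa \<Lambda> K ta a1 u v =
     \<Lambda>\<^sup>2 * K * (LINT y|lebesgue_on {0<..<\<Lambda>}. wderiv \<Lambda> u y * wderiv \<Lambda> v y)
     + \<Lambda> * K * ta / (2 * a1) * bdry_value \<Lambda> u 0 * bdry_value \<Lambda> v 0"


section \<open>The continuous problem\<close>

definition L0 :: "real \<Rightarrow> real \<Rightarrow> real \<Rightarrow> real \<Rightarrow> real" where
  "L0 L \<omega> \<epsilon> t = L * (1 + \<epsilon> * cos (\<omega> * t))"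

text \<open>\<open>L\<^sup>\<infinity>(0,T; L\<^sup>2((0,\<Lambda>)))\<close> and \<open>L\<^sup>2(0,T; \<V>)\<close>. As usual, time-dependent elements of \<open>L\<^sup>2((0,\<Lambda>))\<close> are
  identified with measurable functions of both variables.\<close>

definition Linf_L2 :: "real \<Rightarrow> real \<Rightarrow> (real \<Rightarrow> real \<Rightarrow> real) set" where
  "Linf_L2 \<Lambda> T = {u.
     (\<lambda>(y, t). u t y) \<in> borel_measurable (lebesgue_on ({0<..<\<Lambda>} \<times> {0<..<T})) \<and>
     (\<exists>B. AE t in lebesgue_on {0<..<T}. u t \<in> L2 {0<..<\<Lambda>} \<and> L2_norm {0<..<\<Lambda>} (u t) \<le> B)}"

definition L2_V :: "real \<Rightarrow> real \<Rightarrow> (real \<Rightarrow> real \<Rightarrow> real) set" where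
  "L2_V \<Lambda> T = {u.
     (\<lambda>(y, t). u t y) \<in> borel_measurable (lebesgue_on ({0<..<\<Lambda>} \<times> {0<..<T})) \<and>
     (\<exists>g\<in>L2 ({0<..<\<Lambda>} \<times> {0<..<T}). AE t in lebesgue_on {0<..<T}.
        u t \<in> V \<Lambda> \<and> weak_deriv {0<..<\<Lambda>} [1] (u t) (\<lambda>y. g (y, t)))}"

text \<open>\<open>\<ell>\<close> is the weak solution with initial data \<open>\<ell>\<^sub>0\<close>, in its representative that is continuous in time
  with values in \<open>L\<^sup>2((0,\<Lambda>))\<close>. The differential equation is understood in the sense of distributions
  in time, with the bilinear form moved to the right-hand side.\<close>

definition weak_solution ::
    "real \<Rightarrow> real \<Rightarrow> real \<Rightarrow> real \<Rightarrow> real \<Rightarrow> real \<Rightarrow> real \<Rightarrow> (real \<Rightarrow> real) \<Rightarrow> (real \<Rightarrow> real \<Rightarrow> real) \<Rightarrow> bool"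
  where
  "weak_solution \<Lambda> K ta a1 L \<omega> \<epsilon> l0 l \<longleftrightarrow>
     (\<forall>T>0. l \<in> Linf_L2 \<Lambda> T \<inter> L2_V \<Lambda> T) \<and>
     (\<forall>t\<ge>0. l t \<in> L2 {0<..<\<Lambda>}) \<and>
     (\<forall>t\<ge>0. ((\<lambda>s. L2_norm {0<..<\<Lambda>} (\<lambda>y. l s y - l t y)) \<longlongrightarrow> 0) (at t within {0..})) \<and>
     (AE y in lebesgue_on {0<..<\<Lambda>}. l 0 y = l0 y) \<and>
     (\<forall>T>0. \<forall>v\<in>V \<Lambda>. weak_deriv {0<..<T} [1]
        (\<lambda>t. LINT y|lebesgue_on {0<..<\<Lambda>}. l t y * v y)
        (\<lambda>t. - (\<Lambda> / 2) * deriv (L0 L \<omega> \<epsilon>) t * bdry_value \<Lambda> v 0 - kappa \<Lambda> K ta a1 (l t) v))"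


section \<open>The discrete problem\<close>

definition node :: "real \<Rightarrow> nat \<Rightarrow> nat \<Rightarrow> real" where
  "node \<Lambda> N j = (real j - 1) * (\<Lambda> / real N)"

definition Vh :: "real \<Rightarrow> nat \<Rightarrow> (real \<Rightarrow> real) set" where
  "Vh \<Lambda> N = {u. continuous_on {0..\<Lambda>} u \<and>
     (\<forall>j\<in>{1..N}. \<exists>a b. \<forall>y\<in>{node \<Lambda> N j..node \<Lambda> N (j + 1)}. u y = a * y + b) \<and> u \<Lambda> = 0}"

definition lumped_product :: "real \<Rightarrow> nat \<Rightarrow> (real \<Rightarrow> real) \<Rightarrow> (real \<Rightarrow> real) \<Rightarrow> real" where
  "lumped_product \<Lambda> N u v = (\<Lambda> / real N) * (\<Sum>j=1..N. u (node \<Lambda> N j) * v (node \<Lambda> N j))"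

text \<open>\<open>dl t\<close> is the time derivative at \<open>t\<close> (one-sided at \<open>0\<close>). As the discrete space has finite
  dimension, a function of time with values in it is \<open>C\<^sup>1\<close> iff it is so pointwise on \<open>[0,\<Lambda>]\<close>.\<close>

definition discrete_solution ::
    "real \<Rightarrow> real \<Rightarrow> real \<Rightarrow> real \<Rightarrow> real \<Rightarrow> real \<Rightarrow> real \<Rightarrow> nat \<Rightarrow> (real \<Rightarrow> real) \<Rightarrow> (real \<Rightarrow> real \<Rightarrow> real)
      \<Rightarrow> bool"
  where
  "discrete_solution \<Lambda> K ta a1 L \<omega> \<epsilon> N l0h lh \<longleftrightarrow>
     (\<forall>t\<ge>0. lh t \<in> Vh \<Lambda> N) \<and>
     (\<forall>y\<in>{0..\<Lambda>}. lh 0 y = l0h y) \<and>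
     (\<exists>dl. (\<forall>t\<ge>0. dl t \<in> Vh \<Lambda> N) \<and>
        (\<forall>y\<in>{0..\<Lambda>}. \<forall>t\<ge>0. ((\<lambda>s. lh s y) has_real_derivative dl t y) (at t within {0..})) \<and>
        (\<forall>y\<in>{0..\<Lambda>}. continuous_on {0..} (\<lambda>t. dl t y)) \<and>
        (\<forall>t\<ge>0. \<forall>v\<in>Vh \<Lambda> N.
           lumped_product \<Lambda> N (dl t) v + kappa \<Lambda> K ta a1 (lh t) v
             = - (\<Lambda> / 2) * deriv (L0 L \<omega> \<epsilon>) t * v 0))"

end

theory Submission
  imports Defs
begin

text \<open>
  The discrete solution is compared with the nodal interpolant of \<open>\<ell>\<close>. In one space dimension
  this interpolant is the Ritz projection for \<open>\<kappa>\<close>: discrete functions have constant derivatives on the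
  elements, so \<open>\<kappa>(u,\<chi>)\<close> depends only on the nodal values of \<open>u\<close> (\<open>kappa_Vh\<close>). Therefore the difference
  \<open>\<theta>\<close> of \<open>\<ell>\<^sub>h\<close> and the interpolant solves the discrete equation with a right-hand side that stems from
  mass lumping alone, formally
  \<open>(\<partial>\<^sub>t\<theta>,\<chi>)\<^sub>h + \<kappa>(\<theta>,\<chi>) = \<integral>\<partial>\<^sub>t\<ell> \<chi> - (\<partial>\<^sub>t\<ell>,\<chi>)\<^sub>h\<close>.
  The lumped product is a left end point rule. It differs from the trapezoidal rule by a boundary term
  at \<open>y = 0\<close>, which limits the order: the right-hand side is at most \<open>3 (\<Lambda> h)\<^sup>1\<^sup>/\<^sup>2 \<parallel>\<partial>\<^sub>y\<^sub>t\<ell>\<parallel>\<close> times the discrete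
  norm of \<open>\<chi>\<close> (\<open>lumping_error\<close>). With \<open>\<chi> = \<partial>\<^sub>t\<theta>\<close> the discrete norm is absorbed and
  \<open>\<kappa>(\<theta>(t),\<theta>(t)) \<le> \<kappa>(\<theta>(0),\<theta>(0)) + (9/2) \<Lambda> h \<integral>\<^sub>0\<^sup>t \<parallel>\<partial>\<^sub>y\<^sub>t\<ell>\<parallel>\<^sup>2\<close>.
  Interpolation does not increase the norm of the derivative, so \<open>\<theta>(0)\<close> is bounded by the initial error, and the
  interpolation error of \<open>\<ell>(t)\<close> is bounded by \<open>h \<parallel>\<partial>\<^sub>y\<^sub>y\<ell>(t)\<parallel>\<close> (\<open>interpolation_error\<close>).

  Since \<open>\<partial>\<^sub>t\<ell>\<close> is known only through the distributional mixed derivative, the argument is carried out with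
  increments in time. If the mixed derivative is a square integrable function \<open>g\<close>, then for all times
  \<open>a \<le> b\<close> the increment \<open>\<ell>(b) - \<ell>(a)\<close> has the weak derivative \<open>\<integral>\<^sub>a\<^sup>b g\<close> (\<open>mixed_derivative_increment\<close>). In
  consequence \<open>\<ell>(s)\<close> belongs to \<open>\<V>\<close> for every \<open>s \<in> [0,t]\<close> (\<open>weak_solution_trajectory\<close>). Both equations are
  integrated over \<open>[a,b]\<close> and tested with the increment of \<open>\<theta>\<close>. Summation over a uniform partition of
  \<open>[0,t]\<close>, with mesh size tending to \<open>0\<close>, yields the energy inequality (\<open>energy_estimate\<close>).

  The distributional statements rest on the fundamental lemma of the calculus of variations, for which
  smooth bump functions are constructed, and on its consequence that a function with an integrable weak
  derivative is a primitive of it. In the lemmas the letter \<open>A\<close> stands for \<open>\<Lambda>\<close>.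
\<close>

section \<open>Smooth functions\<close>

definition smooth :: "('a::euclidean_space \<Rightarrow> real) \<Rightarrow> bool" where
  "smooth f \<longleftrightarrow> (\<forall>bs. set bs \<subseteq> Basis \<longrightarrow> (\<forall>x. iter_partial bs f differentiable (at x)))"

lemma test_functions_iff:
  "\<phi> \<in> test_functions \<Omega> \<longleftrightarrow>
     smooth \<phi> \<and> compact (closure {x. \<phi> x \<noteq> 0}) \<and> closure {x. \<phi> x \<noteq> 0} \<subseteq> \<Omega>"
  by (simp add: test_functions_def smooth_def)

lemma iter_partial_append: "iter_partial (bs @ cs) f = iter_partial bs (iter_partial cs f)"
  by (simp add: iter_partial_def)

lemma frechet_derivative_real:
  "(f has_real_derivative d) (at x) \<Longrightarrow> frechet_derivative f (at x) 1 = d"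
  by (metis frechet_derivative_at has_field_derivative_def mult.right_neutral)

lemma iter_partial_real:
  assumes "\<And>x. (f has_real_derivative f' x) (at x)"
  shows "iter_partial [1] f = f'"
  using assms by (auto simp: iter_partial_def frechet_derivative_real)

text \<open>Smoothness is a greatest fixed point: a class of functions in which every member has a derivative
  that belongs to the class again consists of smooth functions. Smoothness of sums, of
  primitives and of the bumps below is obtained in this way, without a formula for higher derivatives.\<close>

lemma smooth_coinduct:
  fixes f :: "real \<Rightarrow> real"
  assumes "X f"
    and step: "\<And>f. X f \<Longrightarrow> \<exists>f'. X f' \<and> (\<forall>x. (f has_real_derivative f' x) (at x))"
  shows "smooth f"
proof -
  have "X (iter_partial bs f)" if "set bs \<subseteq> Basis" for bs
    using that
  proof (induction bs)
    case Nil
    then show ?case using assms by (simp add: iter_partial_def)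
  next
    case (Cons b bs)
    then obtain f' where f': "X f'" "\<And>x. (iter_partial bs f has_real_derivative f' x) (at x)"
      using step[of "iter_partial bs f"] by auto
    have "iter_partial (b # bs) f = iter_partial [1] (iter_partial bs f)"
      using Cons.prems iter_partial_append[of "[b]" bs f] by simp
    then show ?case
      using f' iter_partial_real by metis
  qed
  then show ?thesis
    unfolding smooth_def by (meson real_differentiable_def step)
qed

lemma smooth_derivative:
  fixes f :: "real \<Rightarrow> real"
  assumes "smooth f"
  shows "smooth (iter_partial [1] f)"
    and "(f has_real_derivative iter_partial [1] f x) (at x)"
proof -
  show "smooth (iter_partial [1] f)"
    unfolding smooth_def
  proof (intro allI impI)
    fix bs :: "real list" and x
    assume "set bs \<subseteq> Basis"
    then have "set (bs @ [1]) \<subseteq> Basis" by simp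
    with assms have "iter_partial (bs @ [1]) f differentiable (at x)"
      unfolding smooth_def by blast
    then show "iter_partial bs (iter_partial [1] f) differentiable (at x)"
      by (simp add: iter_partial_append)
  qed
  have "iter_partial [] f differentiable (at x)"
    using assms unfolding smooth_def by (metis empty_subsetI list.set(1))
  then have "f differentiable (at x)" by (simp add: iter_partial_def)
  then obtain d where "(f has_real_derivative d) (at x)"
    by (auto simp: real_differentiable_def)
  then show "(f has_real_derivative iter_partial [1] f x) (at x)"
    by (simp add: iter_partial_def frechet_derivative_real)
qed

lemma smooth_continuous:
  fixes f :: "real \<Rightarrow> real"
  assumes "smooth f"
  shows "continuous_on S f"
  by (meson DERIV_isCont assms continuous_at_imp_continuous_on smooth_derivative(2))

lemma smooth_lincomb:
  fixes f g :: "real \<Rightarrow> real"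
  assumes "smooth f" "smooth g"
  shows "smooth (\<lambda>x. f x - c * g x)"
proof (rule smooth_coinduct[where X = "\<lambda>u. \<exists>f g. smooth f \<and> smooth g \<and> u = (\<lambda>x. f x - c * g x)"])
  fix u :: "real \<Rightarrow> real"
  assume "\<exists>f g. smooth f \<and> smooth g \<and> u = (\<lambda>x. f x - c * g x)"
  then obtain f g where fg: "smooth f" "smooth g" "u = (\<lambda>x. f x - c * g x)" by blast
  have "(u has_real_derivative iter_partial [1] f x - c * iter_partial [1] g x) (at x)" for x
    unfolding fg(3) using smooth_derivative(2)[OF fg(1), of x] smooth_derivative(2)[OF fg(2), of x]
    by (auto intro!: derivative_eq_intros)
  then show "\<exists>f'. (\<exists>f g. smooth f \<and> smooth g \<and> f' = (\<lambda>x. f x - c * g x)) \<and>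
       (\<forall>x. (u has_real_derivative f' x) (at x))"
    using smooth_derivative(1)[OF fg(1)] smooth_derivative(1)[OF fg(2)]
    by (intro exI[of _ "\<lambda>x. iter_partial [1] f x - c * iter_partial [1] g x"]) blast
qed (use assms in blast)

lemma smooth_primitive:
  fixes f :: "real \<Rightarrow> real"
  assumes "smooth f" and "\<And>x. (F has_real_derivative f x) (at x)"
  shows "smooth F"
  by (rule smooth_coinduct[where X = "\<lambda>u. u = F \<or> smooth u"])
    (use assms smooth_derivative in blast)+

section \<open>Bump functions\<close>

text \<open>The derivatives of \<open>exp (- 1/x)\<close>, extended by \<open>0\<close> to \<open>x \<le> 0\<close>, are linear combinations of these
  functions.\<close>

definition flat :: "nat \<Rightarrow> real \<Rightarrow> real" where
  "flat k x = (if x > 0 then (1 / x) ^ k * exp (- (1 / x)) else 0)"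

text \<open>This gives the differentiability of \<open>flat k\<close> at \<open>0\<close>, since its difference quotient there is
  \<open>flat (k + 1)\<close>.\<close>

lemma flat_tendsto_0: "(flat k \<longlongrightarrow> 0) (at_right 0)"
proof -
  have "((\<lambda>y::real. y ^ k / exp y) \<longlongrightarrow> 0) at_top"
    by (rule tendsto_power_div_exp_0)
  moreover have "filterlim (\<lambda>x::real. 1 / x) at_top (at_right 0)"
    using filterlim_inverse_at_top_right by (simp add: inverse_eq_divide)
  ultimately have "((\<lambda>x::real. (1 / x) ^ k / exp (1 / x)) \<longlongrightarrow> 0) (at_right 0)"
    by (rule filterlim_compose)
  moreover have "eventually (\<lambda>x. (1 / x) ^ k / exp (1 / x) = flat k x) (at_right 0)"
    by (auto simp: flat_def eventually_at_filter exp_minus divide_simps)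
  ultimately show ?thesis by (rule Lim_transform_eventually)
qed

lemma flat_derivative:
  "(flat k has_real_derivative flat (k + 2) x - real k * flat (k + 1) x) (at x)"
proof (cases x "0::real" rule: linorder_cases)
  case less
  have "eventually (\<lambda>y. (0::real) = flat k y) (nhds x)"
    using less by (auto simp: flat_def eventually_nhds intro!: exI[of _ "{..<0}"])
  then have "(flat k has_real_derivative 0) (at x)"
    using DERIV_cong_ev[of x x "\<lambda>_. 0" "flat k" 0 0] by simp
  then show ?thesis using less by (simp add: flat_def)
next
  case greater
  have ev: "eventually (\<lambda>y. (1 / y) ^ k * exp (- (1 / y)) = flat k y) (nhds x)"
    using greater by (auto simp: flat_def eventually_nhds intro!: exI[of _ "{0<..}"])
  have "((\<lambda>y. (1 / y) ^ k * exp (- (1 / y))) has_real_derivative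
      flat (k + 2) x - real k * flat (k + 1) x) (at x)"
    using greater
    apply (auto intro!: derivative_eq_intros simp: flat_def)
    apply (cases k)
    apply (auto simp: field_simps power2_eq_square)
    done
  then show ?thesis
    using DERIV_cong_ev[OF refl ev refl] by blast
next
  case equal
  have "((\<lambda>h. (flat k h - flat k 0) / h) \<longlongrightarrow> 0) (at_right 0)"
  proof (rule Lim_transform_eventually[OF flat_tendsto_0[of "Suc k"]])
    show "eventually (\<lambda>h. flat (Suc k) h = (flat k h - flat k 0) / h) (at_right 0)"
      by (auto simp: flat_def eventually_at_filter divide_simps)
  qed
  moreover have "((\<lambda>h. (flat k h - flat k 0) / h) \<longlongrightarrow> 0) (at_left 0)"
    by (rule Lim_transform_eventually[of "\<lambda>_. 0"])
       (auto simp: flat_def eventually_at_filter)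
  ultimately have "((\<lambda>h. (flat k (0 + h) - flat k 0) / h) \<longlongrightarrow> 0) (at 0)"
    by (simp add: filterlim_split_at)
  then show ?thesis
    using equal by (simp add: DERIV_def flat_def)
qed

text \<open>A class of functions that is closed under differentiation. Products are included to have members with
  compact support.\<close>

inductive_set bumps :: "(real \<Rightarrow> real) set" where
  flat: "(\<lambda>x. flat k (\<alpha> * x + \<beta>)) \<in> bumps"
| scale: "f \<in> bumps \<Longrightarrow> (\<lambda>x. c * f x) \<in> bumps"
| add: "f \<in> bumps \<Longrightarrow> g \<in> bumps \<Longrightarrow> (\<lambda>x. f x + g x) \<in> bumps"
| mult: "f \<in> bumps \<Longrightarrow> g \<in> bumps \<Longrightarrow> (\<lambda>x. f x * g x) \<in> bumps"

lemma bumps_derivative: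
  "f \<in> bumps \<Longrightarrow> \<exists>f'\<in>bumps. \<forall>x. (f has_real_derivative f' x) (at x)"
proof (induction rule: bumps.induct)
  case (flat k \<alpha> \<beta>)
  let ?f = "\<lambda>x. \<alpha> * (flat (k + 2) (\<alpha> * x + \<beta>) + (- real k) * flat (k + 1) (\<alpha> * x + \<beta>))"
  have d: "((\<lambda>x. flat k (\<alpha> * x + \<beta>)) has_real_derivative ?f x) (at x)" for x
    by (rule DERIV_cong[OF DERIV_chain2[OF flat_derivative]])
       (auto intro!: derivative_eq_intros simp: algebra_simps)
  have "?f \<in> bumps" by (intro bumps.intros)
  then show ?case by (rule bexI[rotated]) (rule allI, rule d)
next
  case (scale f c)
  then obtain f' where f': "f' \<in> bumps" "\<And>x. (f has_real_derivative f' x) (at x)" by blast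
  then have d: "((\<lambda>x. c * f x) has_real_derivative c * f' x) (at x)" for x
    by (auto intro!: derivative_eq_intros)
  show ?case by (rule bexI[OF _ bumps.scale[OF f'(1), of c]]) (rule allI, rule d)
next
  case (add f g)
  then obtain f' g' where f': "f' \<in> bumps" "\<And>x. (f has_real_derivative f' x) (at x)"
    and g': "g' \<in> bumps" "\<And>x. (g has_real_derivative g' x) (at x)" by blast
  then have d: "((\<lambda>x. f x + g x) has_real_derivative f' x + g' x) (at x)" for x
    by (auto intro!: derivative_eq_intros)
  show ?case by (rule bexI[OF _ bumps.add[OF f'(1) g'(1)]]) (rule allI, rule d)
next
  case (mult f g)
  then obtain f' g' where f': "f' \<in> bumps" "\<And>x. (f has_real_derivative f' x) (at x)"
    and g': "g' \<in> bumps" "\<And>x. (g has_real_derivative g' x) (at x)" by blast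
  then have d: "((\<lambda>x. f x * g x) has_real_derivative f' x * g x + f x * g' x) (at x)" for x
    by (auto intro!: derivative_eq_intros)
  show ?case
    by (rule bexI[OF _ bumps.add[OF bumps.mult[OF f'(1) mult.hyps(2)] bumps.mult[OF mult.hyps(1) g'(1)]]])
      (rule allI, rule d)
qed

lemma bumps_smooth: "f \<in> bumps \<Longrightarrow> smooth f"
  by (rule smooth_coinduct[where X = "\<lambda>f. f \<in> bumps"]) (use bumps_derivative in blast)+

text \<open>For \<open>n \<rightarrow> \<infinity>\<close> these functions tend to the indicator of \<open>(a,b)\<close>, because
  \<open>exp (- 1/(n z)) \<rightarrow> 1\<close> for \<open>z > 0\<close>. They are bounded by \<open>1\<close>, so that a limit under the integral is
  possible.\<close>

definition bump :: "real \<Rightarrow> real \<Rightarrow> real \<Rightarrow> real \<Rightarrow> real" where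
  "bump n a b x = flat 0 (n * x + - n * a) * flat 0 (- n * x + n * b)"

lemma closure_support_subset:
  fixes f :: "real \<Rightarrow> real"
  assumes "\<And>x. x \<notin> {a..b} \<Longrightarrow> f x = 0"
  shows "closure {x. f x \<noteq> 0} \<subseteq> {a..b}"
  by (rule closure_minimal) (use assms in force)+

lemma test_functionI:
  fixes f :: "real \<Rightarrow> real"
  assumes "smooth f" "\<And>x. x \<notin> {a..b} \<Longrightarrow> f x = 0" "{a..b} \<subseteq> \<Omega>"
  shows "f \<in> test_functions \<Omega>"
proof -
  have c: "closure {x. f x \<noteq> 0} \<subseteq> {a..b}"
    using assms(2) by (rule closure_support_subset)
  then have "bounded (closure {x. f x \<noteq> 0})"
    by (meson bounded_closed_interval bounded_subset)
  with c assms show ?thesis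
    by (auto simp: test_functions_iff compact_eq_bounded_closed)
qed

lemma test_functionE:
  assumes "f \<in> test_functions {0<..<A::real}" "A > 0"
  obtains a b where "0 < a" "a < b" "b < A" "\<And>x. x \<notin> {a<..<b} \<Longrightarrow> f x = 0"
proof -
  define K where "K = closure {x. f x \<noteq> 0}"
  have K: "compact K" "K \<subseteq> {0<..<A}" "\<And>x. x \<notin> K \<Longrightarrow> f x = 0"
    using assms(1) closure_subset[of "{x. f x \<noteq> 0}"] unfolding test_functions_iff K_def by blast+
  show thesis
  proof (cases "K = {}")
    case True
    then show ?thesis using that[of "A/3" "A/2"] K assms(2) by auto
  next
    case False
    obtain l where l: "l \<in> K" "\<And>x. x \<in> K \<Longrightarrow> l \<le> x"
      using compact_attains_inf[OF K(1) False] by blast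
    obtain u where u: "u \<in> K" "\<And>x. x \<in> K \<Longrightarrow> x \<le> u"
      using compact_attains_sup[OF K(1) False] by blast
    have "0 < l" "u < A" "l \<le> u" using l u K by auto
    show ?thesis
    proof (rule that[of "l/2" "(u+A)/2"])
      fix x assume "x \<notin> {l/2<..<(u+A)/2}"
      then have "x \<notin> K" using l(2)[of x] u(2)[of x] \<open>0 < l\<close> \<open>u < A\<close> by auto
      then show "f x = 0" by (rule K)
    qed (use \<open>0 < l\<close> \<open>u < A\<close> \<open>l \<le> u\<close> in auto)
  qed
qed

lemma bump_smooth: "smooth (bump n a b)"
proof -
  have "bump n a b \<in> bumps"
    unfolding bump_def by (intro bumps.intros)
  then show ?thesis by (rule bumps_smooth)
qed

lemma bump_bounds: "0 \<le> bump n a b x" "bump n a b x \<le> 1"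
  by (auto simp: bump_def flat_def intro!: mult_le_one)

lemma bump_eq_0: "n > 0 \<Longrightarrow> x \<notin> {a<..<b} \<Longrightarrow> bump n a b x = 0"
  by (auto simp: bump_def flat_def algebra_simps)

lemma bump_pos: "n > 0 \<Longrightarrow> x \<in> {a<..<b} \<Longrightarrow> bump n a b x > 0"
  by (auto simp: bump_def flat_def algebra_simps)

lemma bump_test: "n > 0 \<Longrightarrow> 0 < a \<Longrightarrow> b < A \<Longrightarrow> bump n a b \<in> test_functions {0<..<A}"
  by (rule test_functionI[of _ a b]) (auto intro: bump_eq_0 bump_smooth)

lemma bump_tendsto:
  "(\<lambda>n. bump (real (Suc n)) a b x) \<longlonglongrightarrow> indicator {a<..<b} x"
proof (cases "x \<in> {a<..<b}")
  case True
  have *: "(\<lambda>n. exp (- (1 / (real (Suc n) * c)))) \<longlonglongrightarrow> 1" if "c > 0" for c :: real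
  proof -
    have "(\<lambda>n. inverse (real (Suc n)) * (1 / c)) \<longlonglongrightarrow> 0 * (1 / c)"
      by (intro tendsto_mult tendsto_const LIMSEQ_inverse_real_of_nat)
    then have "(\<lambda>n. exp (- (inverse (real (Suc n)) * (1 / c)))) \<longlonglongrightarrow> exp (- (0 * (1/c)))"
      by (intro tendsto_exp tendsto_minus)
    then show ?thesis by (simp add: divide_simps)
  qed
  have "bump (real (Suc n)) a b x =
      exp (- (1 / (real (Suc n) * (x - a)))) * exp (- (1 / (real (Suc n) * (b - x))))" for n
  proof -
    have "real (Suc n) * (x - a) > 0" "real (Suc n) * (b - x) > 0" using True by auto
    moreover have "real (Suc n) * (x - a) = real (Suc n) * x + - real (Suc n) * a"
      "real (Suc n) * (b - x) = - real (Suc n) * x + real (Suc n) * b" by (auto simp: algebra_simps)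
    ultimately show ?thesis
      unfolding bump_def flat_def by simp
  qed
  then show ?thesis
    using tendsto_mult[OF *[of "x - a"] *[of "b - x"]] True by simp
next
  case False
  then have "bump (real (Suc n)) a b x = 0" for n
    by (intro bump_eq_0) auto
  then show ?thesis using False by simp
qed

section \<open>The fundamental lemma of the calculus of variations\<close>

lemma integrable_lebesgue_on_iff:
  fixes f :: "'a::euclidean_space \<Rightarrow> real"
  assumes "S \<in> sets lebesgue"
  shows "integrable (lebesgue_on S) f \<longleftrightarrow> f absolutely_integrable_on S"
  using assms by (simp add: integrable_restrict_space set_integrable_def)

lemma LINT_lebesgue_on:
  fixes f :: "'a::euclidean_space \<Rightarrow> real"
  assumes "S \<in> sets lebesgue" "f absolutely_integrable_on S"
  shows "(LINT x|lebesgue_on S. f x) = integral S f"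
  using assms by (simp add: integrable_lebesgue_on_iff lebesgue_integral_eq_integral)

lemma AE_lebesgue_on_iff:
  assumes "S \<in> sets lebesgue"
  shows "(AE x in lebesgue_on S. P x) \<longleftrightarrow> negligible {x \<in> S. \<not> P x}"
proof -
  have "(AE x in lebesgue_on S. P x) \<longleftrightarrow> (AE x in lebesgue. x \<in> S \<longrightarrow> P x)"
    using assms by (simp add: AE_restrict_space_iff)
  also have "\<dots> \<longleftrightarrow> {x. \<not> (x \<in> S \<longrightarrow> P x)} \<in> null_sets lebesgue"
    unfolding eventually_ae_filter
    by (simp, metis negligible_iff_null_sets negligible_subset subset_refl)
  finally show ?thesis by (simp add: negligible_iff_null_sets conj_commute)
qed

lemma absolutely_integrable_interior_real:
  fixes f :: "real \<Rightarrow> real"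
  shows "f absolutely_integrable_on {a<..<b} \<longleftrightarrow> f absolutely_integrable_on {a..b}"
  unfolding absolutely_integrable_on_def by (simp add: integrable_on_open_interval_real)

text \<open>Almost every point is a Lebesgue point, where \<open>f x\<close> is the limit of the means of \<open>f\<close> over
  \<open>[x,x+h]\<close>.\<close>

lemma integral_zero_imp_AE_zero:
  fixes f :: "real \<Rightarrow> real"
  assumes "f integrable_on {a..b}"
    and "\<And>c d. a \<le> c \<Longrightarrow> c \<le> d \<Longrightarrow> d \<le> b \<Longrightarrow> integral {c..d} f = 0"
  shows "negligible {x \<in> {a..b}. f x \<noteq> 0}"
proof -
  define F where "F x = (if x \<in> {a..b} then f x else 0)" for x
  have "F integrable_on UNIV"
    using assms(1) by (simp add: F_def[abs_def] integrable_restrict_UNIV del: atLeastAtMost_iff)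
  then have F: "F integrable_on cbox c d" for c d
    using integrable_on_subcbox by blast
  obtain N where N: "negligible N" and
    lim: "\<And>x e. \<lbrakk>x \<notin> N; 0 < e\<rbrakk> \<Longrightarrow> \<exists>d>0. \<forall>h. 0 < h \<and> h < d \<longrightarrow>
                  norm (integral (cbox x (x + h *\<^sub>R One)) F /\<^sub>R h ^ DIM(real) - F x) < e"
    using integrable_ccontinuous_explicit[OF F] by blast
  have "f x = 0" if x: "x \<in> {a..<b}" "x \<notin> N" for x
  proof (rule ccontr)
    assume "f x \<noteq> 0"
    then obtain d where "d > 0" and d: "\<And>h. 0 < h \<and> h < d \<Longrightarrow>
        norm (integral (cbox x (x + h *\<^sub>R One)) F /\<^sub>R h ^ DIM(real) - F x) < \<bar>f x\<bar>"
      using lim[OF x(2), of "\<bar>f x\<bar>"] by auto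
    define h where "h = min (d / 2) (b - x)"
    have h: "0 < h" "h < d" "x + h \<le> b" using \<open>d > 0\<close> x by (auto simp: h_def)
    have "integral {x..x + h} F = integral {x..x + h} f"
      by (rule integral_cong) (use x h in \<open>auto simp: F_def\<close>)
    also have "\<dots> = 0" by (rule assms(2)) (use x h in auto)
    finally show False
      using d[of h] h x by (auto simp: F_def)
  qed
  then have "{x \<in> {a..b}. f x \<noteq> 0} \<subseteq> insert b N" by force
  then show ?thesis using N by (meson negligible_insert negligible_subset)
qed

lemma locally_integrable_Icc:
  assumes "locally_integrable {0<..<A} u" "0 < a" "b < (A::real)"
  shows "u absolutely_integrable_on {a..b}"
proof -
  have "compact {a..b}" "{a..b} \<subseteq> {0<..<A}" using assms by auto
  then have "integrable (lebesgue_on {a..b}) u"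
    using assms(1) unfolding locally_integrable_def by blast
  then show ?thesis by (simp add: integrable_lebesgue_on_iff)
qed

lemma locally_integrable_test:
  fixes u :: "real \<Rightarrow> real"
  assumes u: "locally_integrable {0<..<A} u" and \<phi>: "\<phi> \<in> test_functions {0<..<A}" and "A > 0"
  shows "(\<lambda>x. u x * \<phi> x) absolutely_integrable_on {0<..<A}"
proof -
  obtain a b where ab: "0 < a" "a < b" "b < A" "\<And>x. x \<notin> {a<..<b} \<Longrightarrow> \<phi> x = 0"
    using test_functionE[OF \<phi> \<open>A > 0\<close>] by blast
  have sm: "smooth \<phi>" using \<phi> by (simp add: test_functions_iff)
  have "u absolutely_integrable_on {a..b}"
    using locally_integrable_Icc[OF u] ab by blast
  then have "(\<lambda>x. \<phi> x * u x) absolutely_integrable_on {a..b}"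
    by (intro absolutely_integrable_bounded_measurable_product_real)
      (auto intro!: continuous_imp_measurable_on_sets_lebesgue compact_imp_bounded
        compact_continuous_image smooth_continuous[OF sm])
  then show ?thesis
    by (subst mult.commute, rule absolutely_integrable_spike_set)
      (use ab in \<open>auto intro!: negligible_subset[OF negligible_empty]\<close>)
qed

lemma test_function_deriv:
  assumes "\<phi> \<in> test_functions {0<..<A::real}" "A > 0"
  shows "iter_partial [1] \<phi> \<in> test_functions {0<..<A}"
proof -
  obtain a b where ab: "0 < a" "a < b" "b < A" "\<And>x. x \<notin> {a<..<b} \<Longrightarrow> \<phi> x = 0"
    using test_functionE[OF assms] by blast
  have sm: "smooth \<phi>" using assms by (simp add: test_functions_iff)
  have "iter_partial [1] \<phi> x = 0" if x: "x \<notin> {a..b}" for x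
  proof -
    have "open (- {a..b})" by (intro open_Compl closed_atLeastAtMost)
    then have "eventually (\<lambda>y. \<phi> y = 0) (nhds x)"
      unfolding eventually_nhds using x ab(4) by (intro exI[of _ "- {a..b}"]) auto
    then have "(\<phi> has_real_derivative 0) (at x)"
      using DERIV_cong_ev[of x x \<phi> "\<lambda>_. 0" 0 0] by simp
    then show ?thesis
      using smooth_derivative(2)[OF sm, of x] DERIV_unique by blast
  qed
  then show ?thesis
    using ab by (intro test_functionI[of _ a b] smooth_derivative(1)[OF sm]) auto
qed

text \<open>Testing with bumps that tend to the indicator of an interval shows that all integrals of \<open>w\<close> over
  compact subintervals vanish.\<close>

lemma fundamental_lemma:
  fixes w :: "real \<Rightarrow> real"
  assumes w: "locally_integrable {0<..<A} w" and "A > 0"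
    and zero: "\<And>\<phi>. \<phi> \<in> test_functions {0<..<A} \<Longrightarrow> integral {0<..<A} (\<lambda>x. w x * \<phi> x) = 0"
  shows "negligible {x \<in> {0<..<A}. w x \<noteq> 0}"
proof -
  have int: "w absolutely_integrable_on {a..b}" if "0 < a" "b < A" for a b
    using locally_integrable_Icc[OF w] that by blast
  have z: "integral {a..b} w = 0" if ab: "0 < a" "a \<le> b" "b < A" for a b
  proof -
    let ?f = "\<lambda>n x. w x * bump (real (Suc n)) a b x"
    have "(\<lambda>n. integral {a..b} (?f n)) \<longlonglongrightarrow> integral {a..b} (\<lambda>x. w x * indicator {a<..<b} x)"
    proof (rule dominated_convergence)
      show "?f n integrable_on {a..b}" for n
      proof -
        have "(\<lambda>x. w x * bump (real (Suc n)) a b x) absolutely_integrable_on {0<..<A}"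
          by (rule locally_integrable_test[OF w bump_test \<open>A > 0\<close>]) (use ab in auto)
        then have "(\<lambda>x. w x * bump (real (Suc n)) a b x) absolutely_integrable_on {a..b}"
          by (rule set_integrable_subset) (use ab in auto)
        then show ?thesis by (simp add: absolutely_integrable_on_def)
      qed
      show "(\<lambda>x. \<bar>w x\<bar>) integrable_on {a..b}"
        using int[OF ab(1,3)] by (simp add: absolutely_integrable_on_def)
      show "norm (?f n x) \<le> \<bar>w x\<bar>" for n x
        using bump_bounds[of "real (Suc n)" a b x] 
        by (simp add: abs_mult mult_left_le)
      show "(\<lambda>n. ?f n x) \<longlonglongrightarrow> w x * indicator {a<..<b} x" for x
        by (intro tendsto_mult tendsto_const bump_tendsto)
    qed
    moreover have "integral {a..b} (?f n) = 0" for n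
    proof -
      have b0: "bump (real (Suc n)) a b x = 0" if "x \<notin> {a..b}" for x
        by (rule bump_eq_0) (use that in auto)
      have "integral {a..b} (?f n) = integral {0<..<A} (?f n)"
      proof (rule integral_spike_set)
        have "{x \<in> {0<..<A} - {a..b}. ?f n x \<noteq> 0} = {}"
          using b0 by (auto simp del: of_nat_Suc)
        then show "negligible {x \<in> {0<..<A} - {a..b}. ?f n x \<noteq> 0}"
          using negligible_empty by metis
        have "{x \<in> {a..b} - {0<..<A}. ?f n x \<noteq> 0} = {}"
          using ab by auto
        then show "negligible {x \<in> {a..b} - {0<..<A}. ?f n x \<noteq> 0}"
          using negligible_empty by metis
      qed
      also have "\<dots> = 0"
        by (rule zero) (use ab in \<open>auto intro!: bump_test\<close>)
      finally show ?thesis .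
    qed
    ultimately have "integral {a..b} (\<lambda>x. w x * indicator {a<..<b} x) = 0"
      by (simp add: LIMSEQ_const_iff)
    moreover have "integral {a..b} (\<lambda>x. w x * indicator {a<..<b} x) = integral {a..b} w"
      by (rule integral_spike[of "{a,b}"]) auto
    ultimately show ?thesis by simp
  qed
  \<comment> \<open>As \<open>w\<close> is integrable on compact subsets only, the interval is exhausted by compact ones.\<close>
  have "negligible {x \<in> {A / real (n + 2)..A - A / real (n + 2)}. w x \<noteq> 0}" for n
  proof (rule integral_zero_imp_AE_zero)
    have p: "A / real (n + 2) > 0" using \<open>A > 0\<close> by simp
    show "w integrable_on {A / real (n + 2)..A - A / real (n + 2)}"
      using int[OF p, of "A - A / real (n + 2)"] p by (simp add: absolutely_integrable_on_def)
    show "integral {c..d} w = 0"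
      if "A / real (n + 2) \<le> c" "c \<le> d" "d \<le> A - A / real (n + 2)" for c d
      using p that by (intro z) linarith+
  qed
  then have "negligible (\<Union>n. {x \<in> {A / real (n + 2)..A - A / real (n + 2)}. w x \<noteq> 0})"
    by auto
  moreover have "{x \<in> {0<..<A}. w x \<noteq> 0} \<subseteq> (\<Union>n. {x \<in> {A / real (n + 2)..A - A / real (n + 2)}. w x \<noteq> 0})"
  proof safe
    fix x assume x: "x \<in> {0<..<A}" "w x \<noteq> 0"
    obtain n where n: "A / min x (A - x) < real n"
      using reals_Archimedean2 by blast
    have m: "min x (A - x) > 0" using x by auto
    then have "A < real n * min x (A - x)" using n by (simp add: divide_simps mult.commute)
    also have "\<dots> \<le> real (n + 2) * min x (A - x)" using m by (intro mult_right_mono) auto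
    finally have "A < min x (A - x) * real (n + 2)" by (simp only: mult.commute)
    then have "A / real (n + 2) < min x (A - x)" 
      using pos_divide_less_eq[of "real (n + 2)" A "min x (A - x)"] by linarith
    then have "A / real (n + 2) < x" "A / real (n+2) < A - x" by auto
    then show "x \<in> (\<Union>n. {x \<in> {A / real (n + 2)..A - A / real (n + 2)}. w x \<noteq> 0})"
      using x by (intro UN_I[of n]) auto
  qed
  ultimately show ?thesis by (rule negligible_subset)
qed

lemma test_function_absolutely_integrable:
  assumes "\<phi> \<in> test_functions {0<..<A::real}" "S \<in> sets lebesgue" "bounded S"
  shows "\<phi> absolutely_integrable_on S"
proof -
  have "smooth \<phi>" using assms by (simp add: test_functions_iff)
  then have "continuous_on (cbox (-r) r) \<phi>" for r by (rule smooth_continuous)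
  then have "\<phi> absolutely_integrable_on cbox (-r) r" for r
    by (rule absolutely_integrable_continuous)
  moreover obtain r where "S \<subseteq> cbox (-r) r"
    using \<open>bounded S\<close> bounded_subset_cbox_symmetric by metis
  ultimately show ?thesis using assms set_integrable_subset by blast
qed

text \<open>The mean has to vanish for the primitive to have compact support.\<close>

lemma test_function_primitive:
  fixes \<psi> :: "real \<Rightarrow> real"
  assumes \<psi>: "\<psi> \<in> test_functions {0<..<A}" and "A > 0" and "integral {0..A} \<psi> = 0"
  obtains \<Psi> where "\<Psi> \<in> test_functions {0<..<A}" "iter_partial [1] \<Psi> = \<psi>"
proof -
  obtain a b where ab: "0 < a" "a < b" "b < A" "\<And>x. x \<notin> {a<..<b} \<Longrightarrow> \<psi> x = 0"
    using test_functionE[OF \<psi> \<open>A > 0\<close>] by blast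
  have sm: "smooth \<psi>" using \<psi> by (simp add: test_functions_iff)
  have "isCont \<psi> x" for x
    using smooth_continuous[OF sm, of UNIV] by (simp add: continuous_on_eq_continuous_at)
  then obtain F where F: "\<And>x. (F has_vector_derivative \<psi> x) (at x)"
    using einterval_antiderivative[of "-\<infinity>" \<infinity> \<psi>] by auto
  define \<Psi> where "\<Psi> x = F x - F 0" for x
  have d: "(\<Psi> has_real_derivative \<psi> x) (at x)" for x
    using F[of x] unfolding \<Psi>_def has_real_derivative_iff_has_vector_derivative
    by (auto intro!: derivative_eq_intros)
  have I: "(\<psi> has_integral (\<Psi> y - \<Psi> x)) {x..y}" if "x \<le> y" for x y
    by (rule fundamental_theorem_of_calculus[OF that])
       (use d in \<open>auto simp: has_real_derivative_iff_has_vector_derivative intro: has_vector_derivative_at_within\<close>)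
  have Z: "\<Psi> x = \<Psi> y" if "x \<le> y" "{x..y} \<inter> {a<..<b} = {}" for x y
  proof -
    have "(\<psi> has_integral 0) {x..y}"
      by (rule has_integral_is_0) (use that ab(4) in blast)
    then have "\<Psi> y - \<Psi> x = 0" using I[OF that(1)] has_integral_unique by blast
    then show ?thesis by simp
  qed
  have "\<Psi> 0 = 0" by (simp add: \<Psi>_def)
  have "\<Psi> A = 0"
    using I[of 0 A] assms(2,3) \<open>\<Psi> 0 = 0\<close> by (simp add: has_integral_iff)
  have \<Psi>0: "\<Psi> x = 0" if "x \<notin> {a..b}" for x
  proof -
    consider "x \<le> 0" | "0 \<le> x" "x < a" | "b < x" "x \<le> A" | "A \<le> x"
      using \<open>x \<notin> {a..b}\<close> by fastforce
    then show ?thesis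
    proof cases
      case 1
      then show ?thesis using Z[of x 0] ab \<open>\<Psi> 0 = 0\<close> by force
    next
      case 2
      then show ?thesis using Z[of 0 x] ab \<open>\<Psi> 0 = 0\<close> by force
    next
      case 3
      then show ?thesis using Z[of x A] ab \<open>\<Psi> A = 0\<close> by force
    next
      case 4
      then show ?thesis using Z[of A x] ab \<open>\<Psi> A = 0\<close> by force
    qed
  qed
  have "\<Psi> \<in> test_functions {0<..<A}"
    by (rule test_functionI[OF smooth_primitive[OF sm d] \<Psi>0]) (use ab in auto)
  moreover have "iter_partial [1] \<Psi> = \<psi>"
    using d by (rule iter_partial_real)
  ultimately show thesis by (rule that)
qed

text \<open>Du Bois-Reymond. Every test function differs from the derivative of a test function by a multiple
  of a fixed bump \<open>\<eta>\<close>. Subtracting the constant \<open>c = \<integral>w\<eta> / \<integral>\<eta>\<close> from \<open>w\<close> therefore reduces the claim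
  to the fundamental lemma.\<close>

lemma weak_derivative_zero_imp_const:
  fixes w :: "real \<Rightarrow> real"
  assumes w: "locally_integrable {0<..<A} w" and "A > 0"
    and zero: "\<And>\<phi>. \<phi> \<in> test_functions {0<..<A} \<Longrightarrow>
      integral {0<..<A} (\<lambda>x. w x * iter_partial [1] \<phi> x) = 0"
  obtains c where "negligible {x \<in> {0<..<A}. w x \<noteq> c}"
proof -
  let ?I = "\<lambda>f. integral {0<..<A} f"
  define \<eta> where "\<eta> = bump 1 (A/3) (2*A/3)"
  have \<eta>: "\<eta> \<in> test_functions {0<..<A}"
    unfolding \<eta>_def by (rule bump_test) (use \<open>A > 0\<close> in auto)
  have int: "\<phi> integrable_on {0<..<A}" if "\<phi> \<in> test_functions {0<..<A}" for \<phi>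
    using test_function_absolutely_integrable[OF that, of "{0<..<A}"] 
    by (auto simp: absolutely_integrable_on_def)
  have wint: "(\<lambda>x. w x * \<phi> x) integrable_on {0<..<A}" if "\<phi> \<in> test_functions {0<..<A}" for \<phi>
    using locally_integrable_test[OF w that \<open>A > 0\<close>] by (simp add: absolutely_integrable_on_def)
  have sm: "smooth \<eta>" using \<eta> by (simp add: test_functions_iff)
  define k where "k = ?I \<eta>"
  have "k \<noteq> 0"
  proof
    assume "k = 0"
    have "integral {0..A} \<eta> = 0" using \<open>k = 0\<close> by (simp add: k_def integral_open_interval_real)
    moreover have "continuous_on {0..A} \<eta>" by (rule smooth_continuous[OF sm])
    moreover have "\<And>x. x \<in> {0..A} \<Longrightarrow> 0 \<le> \<eta> x" by (simp add: \<eta>_def bump_bounds)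
    ultimately have "\<forall>x\<in>{0..A}. \<eta> x = 0"
      using integral_eq_0_iff[of 0 A \<eta>] \<open>A > 0\<close> by auto
    moreover have "\<eta> (A/2) > 0" unfolding \<eta>_def by (rule bump_pos) (use \<open>A > 0\<close> in auto)
    ultimately show False using \<open>A > 0\<close> by (auto dest!: bspec[of _ _ "A/2"])
  qed
  define c where "c = ?I (\<lambda>x. w x * \<eta> x) / k"
  have "negligible {x \<in> {0<..<A}. w x - c \<noteq> 0}"
  proof (rule fundamental_lemma)
    show "locally_integrable {0<..<A} (\<lambda>x. w x - c)"
      unfolding locally_integrable_def
    proof safe
      fix S assume S: "compact S" "S \<subseteq> {0<..<A}"
      then interpret finite_measure "lebesgue_on S"
        by (simp add: finite_measure_lebesgue_on lmeasurable_compact)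
      show "integrable (lebesgue_on S) (\<lambda>x. w x - c)"
        using w S unfolding locally_integrable_def
        by (intro Bochner_Integration.integrable_diff integrable_const) blast
    qed
    fix \<phi> :: "real \<Rightarrow> real" assume \<phi>: "\<phi> \<in> test_functions {0<..<A}"
    define \<psi> where "\<psi> x = \<phi> x - ?I \<phi> / k * \<eta> x" for x
    have "smooth \<phi>" using \<phi> by (simp add: test_functions_iff)
    then have "smooth \<psi>" unfolding \<psi>_def using sm by (rule smooth_lincomb)
    moreover obtain a b where ab: "0 < a" "a < b" "b < A" "\<And>x. x \<notin> {a<..<b} \<Longrightarrow> \<phi> x = 0"
      using test_functionE[OF \<phi> \<open>A > 0\<close>] by blast
    have \<psi>0: "\<psi> x = 0" if "x \<notin> {min a (A/3)..max b (2*A/3)}" for x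
    proof -
      have "\<phi> x = 0" by (rule ab(4)) (use that in auto)
      moreover have "\<eta> x = 0" unfolding \<eta>_def by (rule bump_eq_0) (use that in auto)
      ultimately show ?thesis by (simp add: \<psi>_def)
    qed
    ultimately have \<psi>: "\<psi> \<in> test_functions {0<..<A}"
      using ab \<open>A > 0\<close> by (intro test_functionI[of _ "min a (A/3)" "max b (2*A/3)"]) auto
    have "?I \<psi> = ?I \<phi> - ?I (\<lambda>x. ?I \<phi> / k * \<eta> x)"
      unfolding \<psi>_def by (intro integral_diff integrable_on_mult_right int \<phi> \<eta>)
    also have "?I (\<lambda>x. ?I \<phi> / k * \<eta> x) = ?I \<phi> / k * k"
      unfolding k_def by (rule integral_mult_right)
    finally have "?I \<psi> = 0" using \<open>k \<noteq> 0\<close> by simp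
    then obtain \<Psi> where "\<Psi> \<in> test_functions {0<..<A}" "iter_partial [1] \<Psi> = \<psi>"
      using test_function_primitive[OF \<psi> \<open>A > 0\<close>] by (auto simp: integral_open_interval_real)
    then have "?I (\<lambda>x. w x * \<psi> x) = 0" using zero by metis
    moreover have "?I (\<lambda>x. w x * \<psi> x) = ?I (\<lambda>x. w x * \<phi> x - ?I \<phi> / k * (w x * \<eta> x))"
      by (simp add: \<psi>_def algebra_simps)
    moreover have "?I (\<lambda>x. w x * \<phi> x - ?I \<phi> / k * (w x * \<eta> x))
        = ?I (\<lambda>x. w x * \<phi> x) - ?I (\<lambda>x. ?I \<phi> / k * (w x * \<eta> x))"
      by (intro integral_diff integrable_on_mult_right wint \<phi> \<eta>)
    moreover have "?I (\<lambda>x. ?I \<phi> / k * (w x * \<eta> x)) = ?I \<phi> / k * ?I (\<lambda>x. w x * \<eta> x)"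
      by (rule integral_mult_right)
    ultimately have eq: "?I (\<lambda>x. w x * \<phi> x) = c * ?I \<phi>"
      by (simp add: c_def)
    have "?I (\<lambda>x. (w x - c) * \<phi> x) = ?I (\<lambda>x. w x * \<phi> x) - ?I (\<lambda>x. c * \<phi> x)"
      unfolding left_diff_distrib by (intro integral_diff integrable_on_mult_right wint int \<phi>)
    also have "?I (\<lambda>x. c * \<phi> x) = c * ?I \<phi>"
      by (rule integral_mult_right)
    finally show "?I (\<lambda>x. (w x - c) * \<phi> x) = 0"
      using eq by simp
  qed (rule \<open>A > 0\<close>)
  then show thesis using that[of c] by simp
qed

section \<open>Weak derivatives and primitives on an interval\<close>

lemma AE_lborel_imp_negligible:
  assumes "AE x in lborel. P x"
  shows "negligible {x::'a::euclidean_space. \<not> P x}"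
proof -
  obtain N where "N \<in> null_sets lebesgue" "{x. \<not> P x} \<subseteq> N"
    using AE_completion[OF assms] unfolding eventually_ae_filter by auto
  then show ?thesis by (metis negligible_iff_null_sets negligible_subset)
qed

text \<open>Lebesgue measure is complete, so both functions are integrable or none is; in the latter case both
  integrals are \<open>0\<close> by convention.\<close>

lemma LINT_AE_cong:
  fixes f g :: "'a::euclidean_space \<Rightarrow> real"
  assumes S: "S \<in> sets lebesgue" and "negligible {x \<in> S. f x \<noteq> g x}"
  shows "integrable (lebesgue_on S) f \<longleftrightarrow> integrable (lebesgue_on S) g"
    and "(LINT x|lebesgue_on S. f x) = (LINT x|lebesgue_on S. g x)"
proof -
  show i: "integrable (lebesgue_on S) f \<longleftrightarrow> integrable (lebesgue_on S) g"
    unfolding integrable_lebesgue_on_iff[OF S]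
    by (rule absolutely_integrable_spike_eq[OF assms(2)]) auto
  show "(LINT x|lebesgue_on S. f x) = (LINT x|lebesgue_on S. g x)"
  proof (cases "integrable (lebesgue_on S) f")
    case True
    have "integral S f = integral S g"
      by (rule integral_spike[OF assms(2)]) auto
    then show ?thesis
      using True i lebesgue_integral_eq_integral S by metis
  next
    case False
    then show ?thesis using i by (simp add: not_integrable_integral_eq)
  qed
qed

lemma weak_deriv_AE_cong:
  assumes \<Omega>: "\<Omega> \<in> sets lebesgue" and u: "negligible {x \<in> \<Omega>. u x \<noteq> u' x}"
    and g: "negligible {x \<in> \<Omega>. g x \<noteq> g' x}" and w: "weak_deriv \<Omega> bs u g"
  shows "weak_deriv \<Omega> bs u' g'"
proof -
  have loc: "locally_integrable \<Omega> f'"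
    if f: "locally_integrable \<Omega> f" and n: "negligible {x \<in> \<Omega>. f x \<noteq> f' x}" for f f'
    unfolding locally_integrable_def
  proof safe
    fix S assume S: "compact S" "S \<subseteq> \<Omega>"
    have "negligible {x \<in> S. f x \<noteq> f' x}"
      by (rule negligible_subset[OF n]) (use S in auto)
    moreover have "S \<in> sets lebesgue" using S lmeasurable_compact by blast
    ultimately show "integrable (lebesgue_on S) f'"
      using LINT_AE_cong(1)[of S f f'] f S unfolding locally_integrable_def by blast
  qed
  have "(LINT x|lebesgue_on \<Omega>. u' x * iter_partial bs \<phi> x)
          = (- 1) ^ length bs * (LINT x|lebesgue_on \<Omega>. g' x * \<phi> x)" if "\<phi> \<in> test_functions \<Omega>" for \<phi>
  proof -
    have "(LINT x|lebesgue_on \<Omega>. u x * iter_partial bs \<phi> x) = (LINT x|lebesgue_on \<Omega>. u' x * iter_partial bs \<phi> x)"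
      by (rule LINT_AE_cong[OF \<Omega>], rule negligible_subset[OF u]) auto
    moreover have "(LINT x|lebesgue_on \<Omega>. g x * \<phi> x) = (LINT x|lebesgue_on \<Omega>. g' x * \<phi> x)"
      by (rule LINT_AE_cong[OF \<Omega>], rule negligible_subset[OF g]) auto
    ultimately show ?thesis
      using w that unfolding weak_deriv_def by metis
  qed
  then show ?thesis
    using w loc[OF _ u] loc[OF _ g] unfolding weak_deriv_def by blast
qed

lemma weak_deriv_real_iff:
  assumes "A > 0"
  shows "weak_deriv {0<..<A::real} [1] u g \<longleftrightarrow>
    locally_integrable {0<..<A} u \<and> locally_integrable {0<..<A} g \<and>
    (\<forall>\<phi>\<in>test_functions {0<..<A}. integral {0<..<A} (\<lambda>x. u x * iter_partial [1] \<phi> x)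
       = - integral {0<..<A} (\<lambda>x. g x * \<phi> x))"
proof -
  have "(LINT x|lebesgue_on {0<..<A}. u x * \<phi> x) = integral {0<..<A} (\<lambda>x. u x * \<phi> x)"
    if "locally_integrable {0<..<A} u" "\<phi> \<in> test_functions {0<..<A}" for u \<phi>
    using locally_integrable_test[OF that assms] by (intro LINT_lebesgue_on) auto
  then show ?thesis
    unfolding weak_deriv_def using test_function_deriv[OF _ assms] by (auto cong: conj_cong)
qed

lemma weak_derivD:
  assumes "weak_deriv {0<..<A::real} [1] u g" "A > 0" "\<phi> \<in> test_functions {0<..<A}"
  shows "integral {0<..<A} (\<lambda>x. u x * iter_partial [1] \<phi> x) = - integral {0<..<A} (\<lambda>x. g x * \<phi> x)"
  using assms by (simp add: weak_deriv_real_iff)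

lemma locally_integrable_of_integrable:
  fixes f :: "real \<Rightarrow> real"
  assumes "f absolutely_integrable_on {0..A}"
  shows "locally_integrable {0<..<A} f"
  unfolding locally_integrable_def
proof safe
  fix S assume S: "compact S" "S \<subseteq> {0<..<A}"
  then have "S \<in> sets lebesgue" using lmeasurable_compact by blast
  moreover have "f absolutely_integrable_on S"
    by (rule set_integrable_subset[OF assms]) (use S lmeasurable_compact in auto)
  ultimately show "integrable (lebesgue_on S) f" by (simp add: integrable_lebesgue_on_iff)
qed

lemma locally_integrable_diff:
  assumes "locally_integrable \<Omega> f" "locally_integrable \<Omega> g"
  shows "locally_integrable \<Omega> (\<lambda>x. f x - g x)"
  unfolding locally_integrable_def
proof (intro allI impI)
  fix S assume "compact S \<and> S \<subseteq> \<Omega>"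
  then have "integrable (lebesgue_on S) f" "integrable (lebesgue_on S) g"
    using assms unfolding locally_integrable_def by auto
  then show "integrable (lebesgue_on S) (\<lambda>x. f x - g x)"
    by (rule Bochner_Integration.integrable_diff)
qed

text \<open>Product measures are available for Borel functions, whereas the functions in the definition of weak
  derivatives are only Lebesgue measurable.\<close>

lemma ex_borel_version:
  fixes f :: "'a::euclidean_space \<Rightarrow> real"
  assumes "f absolutely_integrable_on S"
  obtains g where "g \<in> borel_measurable borel" "integrable lborel g"
    "AE x in lborel. indicator S x * f x = g x"
proof -
  have f: "integrable lebesgue (\<lambda>x. indicator S x * f x)"
    using assms by (simp add: set_integrable_def)
  then obtain g where g: "g \<in> borel_measurable lborel" "AE x in lborel. indicator S x * f x = g x"
    using completion_ex_borel_measurable_real[of "\<lambda>x. indicator S x * f x" lborel] by auto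
  have "integrable lebesgue g"
    using f AE_completion[OF g(2)] g(1) 
    by (subst integrable_cong_AE[of _ _ "\<lambda>x. indicator S x * f x"])
      (auto intro: measurable_completion elim!: eventually_mono)
  then have "integrable lborel g" using g(1) by (simp add: integrable_completion)
  then show thesis using g that by simp
qed

lemma integral_borel_version:
  fixes f g :: "'a::euclidean_space \<Rightarrow> real"
  assumes "AE x in lborel. indicator S x * f x = g x" "integrable lborel g" "T \<in> sets borel" "T \<subseteq> S"
  shows "integral T f = (LBINT x. indicator T x * g x)"
proof -
  have "integrable lborel (\<lambda>x. indicator T x * g x)"
    using assms(2,3) integrable_mult_indicator[of T lborel g] by simp
  then have "(LBINT x. indicator T x * g x) = integral UNIV (\<lambda>x. indicator T x * g x)"
    by (simp add: integral_lborel)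
  also have "\<dots> = integral UNIV (\<lambda>x. if x \<in> T then f x else 0)"
    by (rule integral_spike[OF AE_lborel_imp_negligible[OF assms(1)]])
      (use assms(4) in \<open>auto simp: indicator_def\<close>)
  also have "\<dots> = integral T f" by (rule integral_restrict_UNIV)
  finally show ?thesis by simp
qed

lemma integrable_lborel_mult_fst_snd:
  fixes a :: "'a::euclidean_space \<Rightarrow> real" and b :: "'b::euclidean_space \<Rightarrow> real"
  assumes "integrable lborel a" "integrable lborel b"
  shows "integrable (lborel \<Otimes>\<^sub>M lborel) (\<lambda>(x, y). a x * b y)"
proof (rule lborel_pair.Fubini_integrable)
  have [measurable]: "a \<in> borel_measurable borel" "b \<in> borel_measurable borel"
    using assms by (auto dest: borel_measurable_integrable)
  show "(\<lambda>(x, y). a x * b y) \<in> borel_measurable (lborel \<Otimes>\<^sub>M lborel)"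
    by measurable
  show "integrable lborel (\<lambda>x. LBINT y. norm (case (x, y) of (x, y) \<Rightarrow> a x * b y))"
    using assms by (simp add: abs_mult)
  show "AE x in lborel. integrable lborel (\<lambda>y. case (x, y) of (x, y) \<Rightarrow> a x * b y)"
    using assms by simp
qed

text \<open>The integrand \<open>g\<close> is merely integrable, so that its primitive need not have a derivative at every
  point. Instead of a product rule, the order of integration is exchanged over the triangle
  \<open>0 \<le> z \<le> y \<le> A\<close>.\<close>

lemma primitive_by_parts:
  fixes g :: "real \<Rightarrow> real"
  assumes g: "g absolutely_integrable_on {0..A}" and \<phi>: "\<phi> \<in> test_functions {0<..<A}" and "A > 0"
  shows "integral {0..A} (\<lambda>y. integral {0..y} g * iter_partial [1] \<phi> y)
    = - integral {0..A} (\<lambda>y. g y * \<phi> y)"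
proof -
  obtain h0 where h0: "h0 \<in> borel_measurable borel" "integrable lborel h0"
    "AE x in lborel. indicator {0..A} x * g x = h0 x"
    using ex_borel_version[OF g] by blast
  define h where "h x = indicator {0..A} x * h0 x" for x
  have h: "h \<in> borel_measurable borel" "integrable lborel h"
    "AE x in lborel. indicator {0..A} x * g x = h x"
  proof -
    note [measurable] = h0(1)
    show "h \<in> borel_measurable borel" unfolding h_def by measurable
    show "integrable lborel h"
      using h0(2) integrable_mult_indicator[of "{0..A}" lborel h0] unfolding h_def[abs_def] by simp
    show "AE x in lborel. indicator {0..A} x * g x = h x"
      using h0(3)
    proof eventually_elim
      case (elim x)
      then show ?case by (cases "x \<in> {0..A}") (simp_all add: h_def)
    qed
  qed
  note [measurable] = h(1)
  define d where "d = iter_partial [1] \<phi>"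
  have sm: "smooth \<phi>" using \<phi> by (simp add: test_functions_iff)
  have cont: "continuous_on X d" for X
    unfolding d_def by (intro smooth_continuous smooth_derivative(1) sm)
  have [measurable]: "d \<in> borel_measurable borel"
    using cont by (rule borel_measurable_continuous_onI)
  \<comment> \<open>The part of the integrand that depends on \<open>y\<close> only; it is cut off to be integrable on the whole line.\<close>
  define a where "a y = indicator {0..A} y * d y" for y
  have a: "integrable lborel a"
    using borel_integrable_atLeastAtMost'[OF cont, of 0 A] by (simp add: a_def[abs_def] set_integrable_def)
  have [measurable]: "a \<in> borel_measurable borel" using a by (auto dest: borel_measurable_integrable)
  define H where "H y z = (if z \<le> y then a y * h z else 0)" for y z
  have H: "integrable (lborel \<Otimes>\<^sub>M lborel) (\<lambda>(y, z). H y z)"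
  proof (rule Bochner_Integration.integrable_bound[OF integrable_lborel_mult_fst_snd[OF a h(2)]])
    show "(\<lambda>(y, z). H y z) \<in> borel_measurable (lborel \<Otimes>\<^sub>M lborel)"
      unfolding H_def by measurable
  qed (auto simp: H_def)
  have "(LBINT z. LBINT y. H y z) = (LBINT y. LBINT z. H y z)"
    by (rule lborel_pair.Fubini_integral[OF H])
  moreover have "(LBINT z. H y z) = indicator {0..A} y * (integral {0..y} g * d y)" for y
  proof (cases "y \<in> {0..A}")
    case True
    have "(LBINT z. H y z) = (LBINT z. a y * (indicator {0..y} z * h z))"
      by (rule Bochner_Integration.integral_cong) (auto simp: H_def h_def indicator_def)
    also have "\<dots> = a y * integral {0..y} g"
      using integral_borel_version[OF h(3,2), of "{0..y}"] True by simp
    finally show ?thesis using True by (simp add: a_def)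
  next
    case False
    then show ?thesis by (simp add: H_def a_def if_distrib cong: if_cong)
  qed
  moreover have "(LBINT y. H y z) = - (indicator {0..A} z * (\<phi> z * h z))" for z
  proof (cases "z \<in> {0..A}")
    case True
    have eq: "H y z = h z * (indicator {z..A} y * d y)" for y
      using True by (auto simp: H_def a_def indicator_def)
    have "(d has_integral (\<phi> A - \<phi> z)) {z..A}"
      by (rule fundamental_theorem_of_calculus)
        (use True smooth_derivative(2)[OF sm] in \<open>auto simp: d_def 
            has_real_derivative_iff_has_vector_derivative[symmetric] intro: has_field_derivative_at_within\<close>)
    moreover obtain p q where pq: "0 < p" "p < q" "q < A" "\<And>x. x \<notin> {p<..<q} \<Longrightarrow> \<phi> x = 0"
      using test_functionE[OF \<phi> \<open>A > 0\<close>] by blast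
    moreover have "\<phi> A = 0" by (rule pq(4)) (use pq in auto)
    ultimately have "integral {z..A} d = - \<phi> z" by (simp add: has_integral_iff)
    moreover have "(LBINT y. indicator {z..A} y * d y) = integral {z..A} d"
      using set_borel_integral_eq_integral(2)[OF borel_integrable_atLeastAtMost'[OF cont, of z A]]
      by (simp add: set_lebesgue_integral_def)
    ultimately show ?thesis using True by (simp add: eq)
  next
    case False
    then show ?thesis by (simp add: H_def h_def if_distrib cong: if_cong)
  qed
  ultimately have eq: "- (LBINT z. indicator {0..A} z * (\<phi> z * h z))
      = (LBINT y. indicator {0..A} y * (integral {0..y} g * d y))"
    by simp
  have "continuous_on {0..A} (\<lambda>y. integral {0..y} g)"
    using g by (intro indefinite_integral_continuous_1) (simp add: absolutely_integrable_on_def)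
  then have "continuous_on {0..A} (\<lambda>y. integral {0..y} g * d y)"
    by (intro continuous_intros cont)
  from set_borel_integral_eq_integral(2)[OF borel_integrable_atLeastAtMost'[OF this]]
  have 1: "(LBINT y. indicator {0..A} y * (integral {0..y} g * d y)) = integral {0..A} (\<lambda>y. integral {0..y} g * d y)"
    by (simp add: set_lebesgue_integral_def)
  have gphi: "(\<lambda>x. g x * \<phi> x) absolutely_integrable_on {0..A}"
    using locally_integrable_test[OF locally_integrable_of_integrable[OF g] \<phi> \<open>A > 0\<close>]
    by (simp add: absolutely_integrable_interior_real)
  have [measurable]: "\<phi> \<in> borel_measurable borel"
    using smooth_continuous[OF sm, of UNIV] by (rule borel_measurable_continuous_onI)
  have "integrable lborel (\<lambda>x. h x * \<phi> x)"
  proof -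
    have "bounded (\<phi> ` {0..A})"
      by (intro compact_imp_bounded compact_continuous_image smooth_continuous[OF sm]) simp
    then obtain B where B: "\<And>x. x \<in> {0..A} \<Longrightarrow> \<bar>\<phi> x\<bar> \<le> B"
      unfolding bounded_iff real_norm_def by blast
    show ?thesis
    proof (rule Bochner_Integration.integrable_bound[of _ "\<lambda>x. B * h x"])
      have "\<bar>h x * \<phi> x\<bar> \<le> \<bar>B * h x\<bar>" for x
      proof (cases "x \<in> {0..A}")
        case True
        then have "\<bar>\<phi> x\<bar> \<le> \<bar>B\<bar>" using B by force
        then show ?thesis by (simp add: abs_mult mult.commute mult_right_mono)
      qed (simp add: h_def)
      then show "AE x in lborel. norm (h x * \<phi> x) \<le> norm (B * h x)" by simp
    qed (use h in auto)
  qed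
  moreover have "AE x in lborel. indicator {0..A} x * (g x * \<phi> x) = h x * \<phi> x"
    using h(3) by eventually_elim (auto simp: algebra_simps)
  ultimately have 2: "integral {0..A} (\<lambda>x. g x * \<phi> x) = (LBINT z. indicator {0..A} z * (h z * \<phi> z))"
    by (intro integral_borel_version) auto
  show ?thesis using eq 1 2 by (simp add: d_def mult.commute)
qed

lemma continuous_absolutely_integrable:
  fixes f :: "real \<Rightarrow> real"
  assumes "continuous_on {a..b} f"
  shows "f absolutely_integrable_on {a..b}"
  using absolutely_integrable_continuous[of a b f] assms by simp

lemma primitive_continuous:
  fixes g :: "real \<Rightarrow> real"
  assumes "g absolutely_integrable_on {a..b}"
  shows "continuous_on {a..b} (\<lambda>y. c + integral {a..y} g)"
  using assms by (intro continuous_intros indefinite_integral_continuous_1) (simp add: absolutely_integrable_on_def)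

lemma weak_deriv_primitive:
  fixes g :: "real \<Rightarrow> real"
  assumes g: "g absolutely_integrable_on {0..A}" and "A > 0"
  shows "weak_deriv {0<..<A} [1] (\<lambda>y. c + integral {0..y} g) g"
  unfolding weak_deriv_real_iff[OF \<open>A > 0\<close>]
proof (intro conjI ballI)
  let ?G = "\<lambda>y. integral {0..y} g"
  show "locally_integrable {0<..<A} (\<lambda>y. c + ?G y)"
    by (intro locally_integrable_of_integrable continuous_absolutely_integrable primitive_continuous g)
  show "locally_integrable {0<..<A} g" by (rule locally_integrable_of_integrable[OF g])
  fix \<phi> :: "real \<Rightarrow> real" assume \<phi>: "\<phi> \<in> test_functions {0<..<A}"
  let ?d = "iter_partial [1] \<phi>"
  have sm: "smooth \<phi>" using \<phi> by (simp add: test_functions_iff)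
  obtain p q where pq: "0 < p" "p < q" "q < A" "\<And>x. x \<notin> {p<..<q} \<Longrightarrow> \<phi> x = 0"
    using test_functionE[OF \<phi> \<open>A > 0\<close>] by blast
  have "\<phi> 0 = 0" "\<phi> A = 0" by (rule pq(4), use pq in simp)+
  have "(?d has_integral (\<phi> A - \<phi> 0)) {0..A}"
    by (rule fundamental_theorem_of_calculus)
      (use \<open>A > 0\<close> smooth_derivative(2)[OF sm] in \<open>auto simp: 
            has_real_derivative_iff_has_vector_derivative[symmetric] intro: has_field_derivative_at_within\<close>)
  then have 0: "(?d has_integral 0) {0..A}" by (simp add: \<open>\<phi> 0 = 0\<close> \<open>\<phi> A = 0\<close>)
  have Gd: "(\<lambda>y. ?G y * ?d y) integrable_on {0..A}"
    using primitive_continuous[OF g, of 0]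
    by (intro integrable_continuous_interval continuous_on_mult
        smooth_continuous[OF smooth_derivative(1)[OF sm]]) simp
  have "integral {0..A} (\<lambda>y. (c + ?G y) * ?d y) = integral {0..A} (\<lambda>y. c * ?d y) + integral {0..A} (\<lambda>y. ?G y * ?d y)"
    unfolding distrib_right using 0 Gd
    by (intro integral_add integrable_on_mult_right) (auto simp: has_integral_iff)
  also have "integral {0..A} (\<lambda>y. c * ?d y) = c * integral {0..A} ?d" by (rule integral_mult_right)
  also have "\<dots> = 0" using 0 by (simp add: has_integral_iff)
  finally show "integral {0<..<A} (\<lambda>y. (c + ?G y) * ?d y) = - integral {0<..<A} (\<lambda>y. g y * \<phi> y)"
    using primitive_by_parts[OF g \<phi> \<open>A > 0\<close>] by (simp add: integral_open_interval_real)
qed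

text \<open>A function with an integrable weak derivative differs from the primitive of this derivative by a function
  with weak derivative \<open>0\<close>.\<close>

lemma weak_deriv_imp_primitive:
  fixes g :: "real \<Rightarrow> real"
  assumes u: "weak_deriv {0<..<A} [1] u g" and g: "g absolutely_integrable_on {0..A}" and "A > 0"
  obtains c where "negligible {x \<in> {0<..<A}. u x \<noteq> c + integral {0..x} g}"
proof -
  let ?G = "\<lambda>y. 0 + integral {0..y} g"
  have G: "weak_deriv {0<..<A} [1] ?G g" by (rule weak_deriv_primitive[OF g \<open>A > 0\<close>])
  have lu: "locally_integrable {0<..<A} u" and lG: "locally_integrable {0<..<A} ?G"
    using u G by (simp_all add: weak_deriv_def)
  have W1: "locally_integrable {0<..<A} (\<lambda>x. u x - ?G x)"
    by (rule locally_integrable_diff[OF lu lG])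
  have W2: "integral {0<..<A} (\<lambda>x. (u x - ?G x) * iter_partial [1] \<phi> x) = 0"
    if \<phi>: "\<phi> \<in> test_functions {0<..<A}" for \<phi>
  proof -
    have "integral {0<..<A} (\<lambda>x. (u x - ?G x) * iter_partial [1] \<phi> x)
      = integral {0<..<A} (\<lambda>x. u x * iter_partial [1] \<phi> x) - integral {0<..<A} (\<lambda>x. ?G x * iter_partial [1] \<phi> x)"
      unfolding left_diff_distrib
      using locally_integrable_test[OF lu test_function_deriv[OF \<phi> \<open>A > 0\<close>] \<open>A > 0\<close>]
        locally_integrable_test[OF lG test_function_deriv[OF \<phi> \<open>A > 0\<close>] \<open>A > 0\<close>]
      by (intro integral_diff) (auto simp: absolutely_integrable_on_def)
    also have "\<dots> = 0"
      unfolding weak_derivD[OF u \<open>A > 0\<close> \<phi>] weak_derivD[OF G \<open>A > 0\<close> \<phi>] by simp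
    finally show ?thesis .
  qed
  obtain c where "negligible {x \<in> {0<..<A}. u x - ?G x \<noteq> c}"
    using weak_derivative_zero_imp_const[OF W1 \<open>A > 0\<close> W2] by blast
  moreover have "{x \<in> {0<..<A}. u x \<noteq> c + integral {0..x} g} = {x \<in> {0<..<A}. u x - ?G x \<noteq> c}"
    by auto
  ultimately show thesis by (intro that[of c]) simp
qed

lemma weak_deriv_unique:
  fixes g :: "real \<Rightarrow> real"
  assumes "weak_deriv {0<..<A} [1] u g" "weak_deriv {0<..<A} [1] u g'" "A > 0"
  shows "negligible {x \<in> {0<..<A}. g x \<noteq> g' x}"
proof -
  have l: "locally_integrable {0<..<A} g" "locally_integrable {0<..<A} g'"
    using assms by (simp_all add: weak_deriv_def)
  have "negligible {x \<in> {0<..<A}. g x - g' x \<noteq> 0}"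
  proof (rule fundamental_lemma[OF _ \<open>A > 0\<close>])
    show "locally_integrable {0<..<A} (\<lambda>x. g x - g' x)"
      by (rule locally_integrable_diff[OF l])
    fix \<phi> :: "real \<Rightarrow> real" assume \<phi>: "\<phi> \<in> test_functions {0<..<A}"
    have "integral {0<..<A} (\<lambda>x. (g x - g' x) * \<phi> x)
      = integral {0<..<A} (\<lambda>x. g x * \<phi> x) - integral {0<..<A} (\<lambda>x. g' x * \<phi> x)"
      unfolding left_diff_distrib
      using locally_integrable_test[OF l(1) \<phi> \<open>A > 0\<close>] locally_integrable_test[OF l(2) \<phi> \<open>A > 0\<close>]
      by (intro integral_diff) (auto simp: absolutely_integrable_on_def)
    also have "\<dots> = 0"
    proof -
      have "- integral {0<..<A} (\<lambda>x. g x * \<phi> x) = - integral {0<..<A} (\<lambda>x. g' x * \<phi> x)"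
        unfolding weak_derivD[OF assms(1) \<open>A > 0\<close> \<phi>, symmetric]
          weak_derivD[OF assms(2) \<open>A > 0\<close> \<phi>, symmetric] by simp
      then show ?thesis by linarith
    qed
    finally show "integral {0<..<A} (\<lambda>x. (g x - g' x) * \<phi> x) = 0" .
  qed
  then show ?thesis by simp
qed

section \<open>Sobolev functions on an interval\<close>

lemma L2_iff:
  assumes "S \<in> lmeasurable"
  shows "f \<in> L2 S \<longleftrightarrow> f absolutely_integrable_on S \<and> (\<lambda>x. (f x)\<^sup>2) absolutely_integrable_on S"
proof
  have S: "S \<in> sets lebesgue" using assms by auto
  assume f: "f \<in> L2 S"
  interpret finite_measure "lebesgue_on S" using assms by (rule finite_measure_lebesgue_on)
  have m: "f \<in> borel_measurable (lebesgue_on S)" and i: "integrable (lebesgue_on S) (\<lambda>x. (f x)\<^sup>2)"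
    using f by (auto simp: L2_def)
  have b: "\<bar>f x\<bar> \<le> \<bar>1 + (f x)\<^sup>2\<bar>" for x
    using zero_le_power2[of "\<bar>f x\<bar> - 1"] zero_le_power2[of "f x"] unfolding power2_diff by simp
  have "integrable (lebesgue_on S) f"
  proof (rule Bochner_Integration.integrable_bound)
    show "integrable (lebesgue_on S) (\<lambda>x. 1 + (f x)\<^sup>2)"
      by (intro Bochner_Integration.integrable_add integrable_const i)
    show "AE x in lebesgue_on S. norm (f x) \<le> norm (1 + (f x)\<^sup>2)"
      using b by simp
  qed (rule m)
  with i show "f absolutely_integrable_on S \<and> (\<lambda>x. (f x)\<^sup>2) absolutely_integrable_on S"
    by (simp add: integrable_lebesgue_on_iff[OF S])
next
  have S: "S \<in> sets lebesgue" using assms by auto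
  assume "f absolutely_integrable_on S \<and> (\<lambda>x. (f x)\<^sup>2) absolutely_integrable_on S"
  then show "f \<in> L2 S"
    by (simp add: L2_def integrable_lebesgue_on_iff[OF S, symmetric] borel_measurable_integrable)
qed

lemma L2_Ioo_iff:
  "f \<in> L2 {0<..<A} \<longleftrightarrow> f absolutely_integrable_on {0..A} \<and> (\<lambda>x. (f x)\<^sup>2) absolutely_integrable_on {0..A::real}"
  by (simp add: L2_iff absolutely_integrable_interior_real)

lemma L2_norm_eq:
  assumes "f \<in> L2 {0<..<A::real}"
  shows "L2_norm {0<..<A} f = sqrt (integral {0..A} (\<lambda>x. (f x)\<^sup>2))"
  using assms LINT_lebesgue_on[of "{0<..<A}" "\<lambda>x. (f x)\<^sup>2"]
  by (simp add: L2_norm_def L2_Ioo_iff absolutely_integrable_interior_real integral_open_interval_real)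

text \<open>With \<open>m\<close> the mean of \<open>f\<close>, this is \<open>0 \<le> \<integral>(f - m)\<^sup>2\<close>.\<close>

lemma integrable_cauchy_schwarz:
  fixes f :: "real \<Rightarrow> real"
  assumes f: "f integrable_on {a..b}" and f2: "(\<lambda>x. (f x)\<^sup>2) integrable_on {a..b}" and "a \<le> b"
  shows "(integral {a..b} f)\<^sup>2 \<le> (b - a) * integral {a..b} (\<lambda>x. (f x)\<^sup>2)"
proof (cases "a = b")
  case False
  define m where "m = integral {a..b} f / (b - a)"
  define I where "I = integral {a..b} (\<lambda>x. (f x)\<^sup>2)"
  have m: "integral {a..b} f = m * (b - a)" using False by (simp add: m_def)
  have 1: "((\<lambda>x. (f x)\<^sup>2 - 2 * m * f x + m\<^sup>2) has_integral (I - 2 * m * (m * (b - a)) + m\<^sup>2 * (b - a))) {a..b}"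
  proof (intro has_integral_add has_integral_diff has_integral_mult_right)
    show "((\<lambda>x. (f x)\<^sup>2) has_integral I) {a..b}"
      using f2 unfolding I_def by (rule integrable_integral)
    show "(f has_integral m * (b - a)) {a..b}"
      using integrable_integral[OF f] unfolding m .
    show "((\<lambda>x. m\<^sup>2) has_integral m\<^sup>2 * (b - a)) {a..b}"
      using has_integral_const_real[of "m\<^sup>2" a b] \<open>a \<le> b\<close> by (simp add: mult.commute)
  qed
  have "0 \<le> I - 2 * m * (m * (b - a)) + m\<^sup>2 * (b - a)"
  proof (rule has_integral_nonneg[OF 1])
    fix x
    have "0 \<le> (f x - m)\<^sup>2" by simp
    also have "(f x - m)\<^sup>2 = (f x)\<^sup>2 - 2 * m * f x + m\<^sup>2" by (simp add: power2_diff)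
    finally show "0 \<le> (f x)\<^sup>2 - 2 * m * f x + m\<^sup>2" .
  qed
  then have "(b - a) * m\<^sup>2 \<le> I" by (simp add: power2_eq_square algebra_simps)
  then have "(b - a) * ((b - a) * m\<^sup>2) \<le> (b - a) * I"
    using \<open>a \<le> b\<close> by (intro mult_left_mono) auto
  then show ?thesis
    unfolding m I_def by (simp add: power2_eq_square mult_ac)
qed simp

text \<open>Makes the representative in the definition of boundary values unique, also at the end points.\<close>

lemma continuous_AE_eq_imp_eq:
  fixes v w :: "real \<Rightarrow> real"
  assumes "continuous_on {0..A} v" "continuous_on {0..A} w" "negligible {x \<in> {0<..<A}. v x \<noteq> w x}"
    and "A > 0" "a \<in> {0..A}"
  shows "v a = w a"
proof -
  have c: "continuous_on {0..A} (\<lambda>x. \<bar>v x - w x\<bar>)" by (intro continuous_intros assms)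
  have n: "negligible ({x \<in> {0<..<A}. v x \<noteq> w x} \<union> {0, A})"
    using assms(3) by (intro negligible_Un) auto
  have "integral {0..A} (\<lambda>x. \<bar>v x - w x\<bar>) = integral {0..A} (\<lambda>x. 0)"
    by (rule integral_spike[OF n]) auto
  then have "\<forall>x\<in>{0..A}. \<bar>v x - w x\<bar> = 0"
    using integral_eq_0_iff[OF c \<open>A > 0\<close>] by auto
  then show ?thesis using assms by auto
qed

lemma bdry_value_eq:
  assumes w: "continuous_on {0..A} w" and u: "negligible {x \<in> {0<..<A}. u x \<noteq> w x}" 
    and A: "A > 0" and a: "a \<in> {0..A}"
  shows "bdry_value A u a = w a"
  unfolding bdry_value_def
proof (rule the_equality)
  show "\<exists>wa. continuous_on {0..A} wa \<and> (AE x in lebesgue_on {0<..<A}. u x = wa x) \<and> w a = wa a"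
    using w u by (intro exI[of _ w]) (simp add: AE_lebesgue_on_iff)
  fix c
  assume "\<exists>wa. continuous_on {0..A} wa \<and> (AE x in lebesgue_on {0<..<A}. u x = wa x) \<and> c = wa a"
  then obtain w' where w': "continuous_on {0..A} w'" "negligible {x \<in> {0<..<A}. u x \<noteq> w' x}" "c = w' a"
    by (auto simp: AE_lebesgue_on_iff)
  have "negligible {x \<in> {0<..<A}. w' x \<noteq> w x}"
    by (rule negligible_subset[OF negligible_Un[OF u w'(2)]]) auto
  then show "c = w a"
    using continuous_AE_eq_imp_eq[OF w'(1) w _ A a] w'(3) by simp
qed

text \<open>In one dimension the elements of \<open>H\<^sup>1\<close> are the functions that agree almost everywhere with a primitive
  \<open>c + \<integral>\<^sub>0\<^sup>y D\<close> of a square integrable function. The number \<open>c\<close> is the boundary value at \<open>0\<close>.\<close>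

definition has_repr :: "real \<Rightarrow> (real \<Rightarrow> real) \<Rightarrow> real \<Rightarrow> (real \<Rightarrow> real) \<Rightarrow> bool" where
  "has_repr A u c D \<longleftrightarrow> D \<in> L2 {0<..<A} \<and> negligible {x \<in> {0<..<A}. u x \<noteq> c + integral {0..x} D}"

lemma has_reprE:
  assumes "weak_deriv {0<..<A} [1] u D" "D \<in> L2 {0<..<A}" "A > 0"
  obtains c where "has_repr A u c D"
  using weak_deriv_imp_primitive[OF assms(1) _ assms(3)] assms(2)
  unfolding has_repr_def L2_Ioo_iff by blast

lemma has_repr_abs: "has_repr A u c D \<Longrightarrow> D absolutely_integrable_on {0..A}"
  by (simp add: has_repr_def L2_Ioo_iff)

lemma has_repr_continuous: "has_repr A u c D \<Longrightarrow> continuous_on {0..A} (\<lambda>y. c + integral {0..y} D)"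
  by (intro primitive_continuous) (rule has_repr_abs)

lemma has_repr_weak_deriv:
  assumes "has_repr A u c D" "A > 0"
  shows "weak_deriv {0<..<A} [1] u D"
proof (rule weak_deriv_AE_cong[OF _ _ _ weak_deriv_primitive[OF has_repr_abs[OF assms(1)] \<open>A > 0\<close>]])
  show "negligible {x \<in> {0<..<A}. c + integral {0..x} D \<noteq> u x}"
    using assms(1) by (simp add: has_repr_def eq_commute)
qed auto

lemma has_repr_bdry_value:
  "has_repr A u c D \<Longrightarrow> A > 0 \<Longrightarrow> a \<in> {0..A} \<Longrightarrow> bdry_value A u a = c + integral {0..a} D"
  by (rule bdry_value_eq[OF has_repr_continuous]) (auto simp: has_repr_def)

lemma has_repr_L2:
  assumes u: "has_repr A u c D" and "A > 0"
  shows "u \<in> L2 {0<..<A}"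
proof -
  let ?w = "\<lambda>y. c + integral {0..y} D"
  have n: "negligible {x \<in> {0<..<A}. ?w x \<noteq> u x}"
    using u by (simp add: has_repr_def eq_commute)
  have w: "?w absolutely_integrable_on {0<..<A}" "(\<lambda>y. (?w y)\<^sup>2) absolutely_integrable_on {0<..<A}"
    unfolding absolutely_integrable_interior_real
    by (intro continuous_absolutely_integrable continuous_intros has_repr_continuous[OF u])+
  have "u absolutely_integrable_on {0<..<A}"
    by (rule absolutely_integrable_spike[OF w(1) n]) simp
  moreover have "(\<lambda>y. (u y)\<^sup>2) absolutely_integrable_on {0<..<A}"
    by (rule absolutely_integrable_spike[OF w(2) n]) simp
  ultimately show ?thesis by (simp add: L2_iff)
qed

lemma has_repr_V:
  assumes u: "has_repr A u c D" and "A > 0" "c + integral {0..A} D = 0"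
  shows "u \<in> V A"
  using has_repr_L2[OF u] has_repr_weak_deriv[OF u] has_repr_bdry_value[OF u, of A] assms
  by (auto simp: V_def H1_def has_repr_def)

lemma has_repr_diff:
  assumes "has_repr A u c D" "has_repr A u' c' D'"
  shows "has_repr A (\<lambda>y. u y - u' y) (c - c') (\<lambda>y. D y - D' y)"
proof -
  have a: "D absolutely_integrable_on {0..A}" "(\<lambda>y. (D y)\<^sup>2) absolutely_integrable_on {0..A}"
    "D' absolutely_integrable_on {0..A}" "(\<lambda>y. (D' y)\<^sup>2) absolutely_integrable_on {0..A}"
    using assms by (auto simp: has_repr_def L2_Ioo_iff)
  have "(\<lambda>y. (D y - D' y)\<^sup>2) absolutely_integrable_on {0..A}"
  proof (rule measurable_bounded_by_integrable_imp_absolutely_integrable)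
    show "(\<lambda>x. (D x - D' x)\<^sup>2) \<in> borel_measurable (lebesgue_on {0..A})"
      using a(1,3) by (intro borel_measurable_power borel_measurable_diff)
        (simp_all add: integrable_lebesgue_on_iff[symmetric] borel_measurable_integrable)
    show "(\<lambda>x. 2 * (D x)\<^sup>2 + 2 * (D' x)\<^sup>2) integrable_on {0..A}"
      using a(2,4) by (intro integrable_add integrable_on_mult_right) (auto simp: absolutely_integrable_on_def)
    show "norm ((D x - D' x)\<^sup>2) \<le> 2 * (D x)\<^sup>2 + 2 * (D' x)\<^sup>2" for x
      using zero_le_power2[of "D x + D' x"]
      by (simp only: real_norm_def abs_power2) (simp add: power2_diff power2_sum)
  qed auto
  then have L: "(\<lambda>y. D y - D' y) \<in> L2 {0<..<A}"
    using a by (simp add: L2_Ioo_iff set_integral_diff(1))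
  have n: "negligible ({x \<in> {0<..<A}. u x \<noteq> c + integral {0..x} D} \<union> {x \<in> {0<..<A}. u' x \<noteq> c' + integral {0..x} D'})"
    using assms by (auto simp: has_repr_def)
  have "integral {0..x} (\<lambda>y. D y - D' y) = integral {0..x} D - integral {0..x} D'" if "x \<in> {0<..<A}" for x
    using a(1,3) that
    by (intro integral_diff) (auto simp: absolutely_integrable_on_def intro: integrable_on_subinterval)
  then have "{x \<in> {0<..<A}. u x - u' x \<noteq> c - c' + integral {0..x} (\<lambda>y. D y - D' y)} \<subseteq>
    {x \<in> {0<..<A}. u x \<noteq> c + integral {0..x} D} \<union> {x \<in> {0<..<A}. u' x \<noteq> c' + integral {0..x} D'}"
    by auto
  then show ?thesis using L negligible_subset[OF n] by (simp add: has_repr_def)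
qed

lemma L2_mult_absolutely_integrable:
  assumes "f \<in> L2 {0<..<A}" "g \<in> L2 {0<..<A}"
  shows "(\<lambda>y. f y * g y) absolutely_integrable_on {0..A::real}"
proof (rule measurable_bounded_by_integrable_imp_absolutely_integrable)
  have a: "f absolutely_integrable_on {0..A}" "(\<lambda>y. (f y)\<^sup>2) absolutely_integrable_on {0..A}"
    "g absolutely_integrable_on {0..A}" "(\<lambda>y. (g y)\<^sup>2) absolutely_integrable_on {0..A}"
    using assms by (auto simp: L2_Ioo_iff)
  show "(\<lambda>x. f x * g x) \<in> borel_measurable (lebesgue_on {0..A})"
    using a(1,3) by (intro borel_measurable_times)
      (simp_all add: integrable_lebesgue_on_iff[symmetric] borel_measurable_integrable)
  show "(\<lambda>x. (f x)\<^sup>2 + (g x)\<^sup>2) integrable_on {0..A}"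
    using a(2,4) by (intro integrable_add) (auto simp: absolutely_integrable_on_def)
  fix x
  show "norm (f x * g x) \<le> (f x)\<^sup>2 + (g x)\<^sup>2"
  proof -
    have "0 \<le> (\<bar>f x\<bar> - \<bar>g x\<bar>)\<^sup>2" "0 \<le> \<bar>f x\<bar> * \<bar>g x\<bar>" by simp_all
    moreover have "(\<bar>f x\<bar> - \<bar>g x\<bar>)\<^sup>2 = (f x)\<^sup>2 - 2 * (\<bar>f x\<bar> * \<bar>g x\<bar>) + (g x)\<^sup>2"
      by (simp add: power2_diff)
    ultimately show ?thesis unfolding real_norm_def abs_mult by linarith
  qed
qed auto

text \<open>Weak derivatives are unique up to null sets, so the choice made in \<open>wderiv\<close> is immaterial.\<close>

lemma kappa_repr:
  assumes u: "has_repr A u c D" and v: "has_repr A v c' D'" and "A > 0"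
  shows "kappa A K ta a1 u v = A\<^sup>2 * K * integral {0..A} (\<lambda>y. D y * D' y) + A * K * ta / (2 * a1) * c * c'"
proof -
  have w: "negligible {x \<in> {0<..<A}. wderiv A u x \<noteq> D x}" if "has_repr A u c D" for u c D
  proof -
    have d: "weak_deriv {0<..<A} [1] u D" by (rule has_repr_weak_deriv[OF that \<open>A > 0\<close>])
    then have "weak_deriv {0<..<A} [1] u (wderiv A u)"
      unfolding wderiv_def by (rule someI[where P = "weak_deriv {0<..<A} [1] u"])
    then show ?thesis using weak_deriv_unique[OF _ d \<open>A > 0\<close>] by blast
  qed
  have "(LINT y|lebesgue_on {0<..<A}. wderiv A u y * wderiv A v y) = (LINT y|lebesgue_on {0<..<A}. D y * D' y)"
    by (rule LINT_AE_cong(2), simp, rule negligible_subset[OF negligible_Un[OF w[OF u] w[OF v]]]) auto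
  also have "\<dots> = integral {0..A} (\<lambda>y. D y * D' y)"
    using L2_mult_absolutely_integrable[of D A D'] u v 
    by (subst LINT_lebesgue_on) (auto simp: has_repr_def absolutely_integrable_interior_real integral_open_interval_real)
  finally show ?thesis
    using has_repr_bdry_value[OF u, of 0] has_repr_bdry_value[OF v, of 0] \<open>A > 0\<close>
    by (simp add: kappa_def)
qed

section \<open>Piecewise linear functions on a uniform grid\<close>

definition grid :: "real \<Rightarrow> nat \<Rightarrow> real" where
  "grid h j = real j * h"

text \<open>The derivative of the piecewise linear function with value \<open>z j\<close> at the node \<open>j h\<close>. The elements are
  half-open to make them disjoint. Nodes are counted from \<open>0\<close>, so that \<open>grid h j\<close> is the
  node number \<open>j + 1\<close> of the discrete problem.\<close>

definition slope :: "real \<Rightarrow> nat \<Rightarrow> (nat \<Rightarrow> real) \<Rightarrow> real \<Rightarrow> real" where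
  "slope h N z y = (\<Sum>j<N. (z (Suc j) - z j) / h * indicator {grid h j..<grid h (Suc j)} y)"

lemma grid_0 [simp]: "grid h 0 = 0" by (simp add: grid_def)

lemma grid_Suc: "grid h (Suc j) = grid h j + h" by (simp add: grid_def algebra_simps)

lemma grid_mono: "h \<ge> 0 \<Longrightarrow> i \<le> j \<Longrightarrow> grid h i \<le> grid h j"
  by (simp add: grid_def mult_right_mono)

lemma grid_nonneg: "h \<ge> 0 \<Longrightarrow> 0 \<le> grid h j"
  by (simp add: grid_def)

lemma ex_element:
  assumes "h > 0" "0 \<le> x" "x < grid h N"
  obtains j where "j < N" "x \<in> {grid h j..<grid h (Suc j)}"
proof -
  define j where "j = nat \<lfloor>x / h\<rfloor>"
  have "real j = of_int \<lfloor>x / h\<rfloor>" using assms by (simp add: j_def)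
  then have "real j \<le> x / h" "x / h < real j + 1" by linarith+
  then have *: "real j * h \<le> x" "x < (real j + 1) * h" using assms(1) by (simp_all add: field_simps)
  have "real j * h < real N * h" using *(1) assms(3) by (simp add: grid_def)
  then have "j < N" using assms(1) by simp
  then show thesis using * by (intro that[of j]) (auto simp: grid_def algebra_simps)
qed

lemma slope_eq:
  assumes "h > 0" "j < N" "y \<in> {grid h j..<grid h (Suc j)}"
  shows "slope h N z y = (z (Suc j) - z j) / h"
proof -
  have ind: "indicator {grid h i..<grid h (Suc i)} y = (if i = j then 1 else 0 :: real)" for i
  proof (cases i j rule: linorder_cases)
    case less
    then have "grid h (Suc i) \<le> y" using grid_mono[of h "Suc i" j] assms by auto
    with less show ?thesis by (simp add: indicator_def)
  next
    case greater
    then have "y < grid h i" using grid_mono[of h "Suc j" i] assms by auto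
    with greater show ?thesis by (simp add: indicator_def)
  qed (use assms in simp)
  show ?thesis
    unfolding slope_def ind using assms(2) by (simp add: if_distrib cong: if_cong)
qed

lemma slope_diff: "slope h N (\<lambda>j. z j - w j) y = slope h N z y - slope h N w y"
  by (simp add: slope_def sum_subtractf[symmetric] algebra_simps diff_divide_distrib add_divide_distrib)

lemma slope_measurable: "slope h N z \<in> borel_measurable borel"
  unfolding slope_def by measurable

lemma slope_L2: "slope h N z \<in> L2 {0<..<A}"
proof -
  define B where "B = (\<Sum>j<N. \<bar>(z (Suc j) - z j) / h\<bar>)"
  have b: "\<bar>slope h N z y\<bar> \<le> B" for y
    unfolding slope_def B_def
    by (rule order_trans[OF sum_abs]) (auto intro!: sum_mono simp: indicator_def)
  have m: "slope h N z \<in> borel_measurable (lebesgue_on {0..A})"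
    by (intro measurable_restrict_space1 measurable_completion) (simp add: slope_measurable)
  have "slope h N z absolutely_integrable_on {0..A}"
    by (rule measurable_bounded_by_integrable_imp_absolutely_integrable[of _ _ "\<lambda>_. B"]) (use b m in auto)
  moreover have "(\<lambda>y. (slope h N z y)\<^sup>2) absolutely_integrable_on {0..A}"
  proof (rule measurable_bounded_by_integrable_imp_absolutely_integrable[of _ _ "\<lambda>_. B\<^sup>2"])
    show "(\<lambda>y. (slope h N z y)\<^sup>2) \<in> borel_measurable (lebesgue_on {0..A})"
      by (intro borel_measurable_power m)
    show "norm ((slope h N z y)\<^sup>2) \<le> B\<^sup>2" for y
      using b[of y] by (simp add: abs_le_square_iff[symmetric])
  qed auto
  ultimately show ?thesis by (simp add: L2_Ioo_iff)
qed

lemma integral_elements: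
  fixes f :: "real \<Rightarrow> real"
  assumes "h \<ge> 0" "f integrable_on {0..grid h N}"
  shows "integral {0..grid h N} f = (\<Sum>j<N. integral {grid h j..grid h (Suc j)} f)"
  using assms(2)
proof (induction N)
  case (Suc N)
  have "f integrable_on {0..grid h N}"
    by (rule integrable_on_subinterval[OF Suc.prems]) (use grid_mono[of h N "Suc N"] assms(1) in auto)
  then show ?case
    using Suc Henstock_Kurzweil_Integration.integral_combine[OF _ _ Suc.prems, of "grid h N"]
      grid_mono[of h N "Suc N"] grid_nonneg[of h N] assms(1) by simp
qed simp

text \<open>Only the means of \<open>D\<close> over the elements matter, hence only the nodal values of a primitive of \<open>D\<close>. This is
  why nodal interpolation is the Ritz projection in one dimension.\<close>

lemma slope_mult_integral:
  assumes "h > 0" "D absolutely_integrable_on {0..grid h N}"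
  shows "integral {0..grid h N} (\<lambda>y. D y * slope h N z y)
    = (\<Sum>j<N. (z (Suc j) - z j) / h * integral {grid h j..grid h (Suc j)} D)"
proof -
  have s: "slope h N z absolutely_integrable_on {0..grid h N}" 
    using slope_L2[of h N z "grid h N"] by (simp add: L2_Ioo_iff)
  have "bounded (slope h N z ` {0..grid h N})"
  proof -
    have "\<bar>slope h N z y\<bar> \<le> (\<Sum>j<N. \<bar>(z (Suc j) - z j) / h\<bar>)" for y
      unfolding slope_def
      by (rule order_trans[OF sum_abs]) (auto intro!: sum_mono simp: indicator_def)
    then show ?thesis unfolding bounded_iff by auto
  qed
  then have "(\<lambda>y. slope h N z y * D y) absolutely_integrable_on {0..grid h N}"
    using assms s by (intro absolutely_integrable_bounded_measurable_product_real)
     (auto simp: integrable_lebesgue_on_iff[symmetric] borel_measurable_integrable)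
  then have "(\<lambda>y. D y * slope h N z y) integrable_on {0..grid h N}"
    by (simp add: absolutely_integrable_on_def mult.commute)
  then have "integral {0..grid h N} (\<lambda>y. D y * slope h N z y)
      = (\<Sum>j<N. integral {grid h j..grid h (Suc j)} (\<lambda>y. D y * slope h N z y))"
    using assms(1) by (intro integral_elements) auto
  also have "\<dots> = (\<Sum>j<N. (z (Suc j) - z j) / h * integral {grid h j..grid h (Suc j)} D)"
  proof (rule sum.cong[OF refl])
    fix j assume "j \<in> {..<N}"
    then have "integral {grid h j..grid h (Suc j)} (\<lambda>y. D y * slope h N z y)
      = integral {grid h j..grid h (Suc j)} (\<lambda>y. (z (Suc j) - z j) / h * D y)"
      using slope_eq[OF assms(1), of j N _ z]
      by (intro integral_spike[of "{grid h (Suc j)}"]) auto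
    then show "integral {grid h j..grid h (Suc j)} (\<lambda>y. D y * slope h N z y)
      = (z (Suc j) - z j) / h * integral {grid h j..grid h (Suc j)} D"
      by simp
  qed
  finally show ?thesis .
qed

lemma slope_integral_element:
  assumes "h > 0" "j < N"
  shows "integral {grid h j..grid h (Suc j)} (slope h N z) = z (Suc j) - z j"
proof -
  have "integral {grid h j..grid h (Suc j)} (slope h N z) = integral {grid h j..grid h (Suc j)} (\<lambda>_. (z (Suc j) - z j) / h)"
    using slope_eq[OF assms, of _ z] by (intro integral_spike[of "{grid h (Suc j)}"]) auto
  also have "\<dots> = z (Suc j) - z j" using assms(1) by (simp add: grid_Suc)
  finally show ?thesis .
qed

lemma slope_product_integral:
  assumes "h > 0"
  shows "integral {0..grid h N} (\<lambda>y. slope h N x y * slope h N z y)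
    = (\<Sum>j<N. (x (Suc j) - x j) * (z (Suc j) - z j)) / h"
  using slope_mult_integral[OF assms, where D = "slope h N x" and N = N and z = z] slope_L2[of h N x "grid h N"]
  by (simp add: slope_integral_element[OF assms] L2_Ioo_iff sum_divide_distrib mult.commute)

lemma grid_facts:
  assumes "A > 0" "h = A / real N" "N \<ge> 1"
  shows "h > 0" "grid h N = A" "j \<le> N \<Longrightarrow> grid h j \<in> {0..A}"
proof -
  show h: "h > 0" unfolding assms(2) using assms(1,3) by simp
  show N: "grid h N = A" unfolding assms(2) grid_def using assms(3) by simp
  show "grid h j \<in> {0..A}" if "j \<le> N"
    using grid_nonneg[of h j] grid_mono[of h j N] that N h by auto
qed

lemma Vh_affine:
  assumes "u \<in> Vh A N" "h = A / real N" "A > 0" "j < N" "y \<in> {grid h j..grid h (Suc j)}"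
  shows "u y = u (grid h j) + (u (grid h (Suc j)) - u (grid h j)) / h * (y - grid h j)"
proof -
  have n: "node A N (Suc i) = grid h i" for i by (simp add: node_def grid_def assms(2))
  have "h > 0" unfolding assms(2) using \<open>A > 0\<close> \<open>j < N\<close> by simp
  obtain a b where ab: "\<And>y. y \<in> {grid h j..grid h (Suc j)} \<Longrightarrow> u y = a * y + b"
    using assms(1,4) n[of j] n[of "Suc j"] unfolding Vh_def 
    by (auto dest!: bspec[of _ _ "Suc j"])
  have "u (grid h j) = a * grid h j + b" "u (grid h (Suc j)) = a * (grid h j + h) + b"
    using ab[of "grid h j"] ab[of "grid h (Suc j)"] \<open>h > 0\<close> by (auto simp: grid_Suc)
  then have "(u (grid h (Suc j)) - u (grid h j)) / h = a"
    using \<open>h > 0\<close> by (simp add: field_simps)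
  then show ?thesis using ab[OF assms(5)] \<open>u (grid h j) = a * grid h j + b\<close> by (simp add: algebra_simps)
qed

lemma Vh_primitive:
  assumes u: "u \<in> Vh A N" and h: "h = A / real N" and "A > 0" "N \<ge> 1" and y: "y \<in> {0..A}"
  shows "u y = u 0 + integral {0..y} (slope h N (\<lambda>j. u (grid h j)))"
proof -
  have "h > 0" unfolding h using \<open>A > 0\<close> \<open>N \<ge> 1\<close> by simp
  have A: "grid h N = A" unfolding h grid_def using \<open>N \<ge> 1\<close> by simp
  let ?s = "slope h N (\<lambda>j. u (grid h j))"
  have "(?s has_integral u y - u 0) {0..y}"
  proof (rule fundamental_theorem_of_calculus_interior_strong)
    show "finite (grid h ` {..N})" by simp
    show "0 \<le> y" using y by simp
    show "continuous_on {0..y} u"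
      using u y unfolding Vh_def by (auto intro: continuous_on_subset)
    fix x assume x: "x \<in> {0<..<y} - grid h ` {..N}"
    obtain j where j: "j < N" "x \<in> {grid h j..<grid h (Suc j)}"
      using ex_element[OF \<open>h > 0\<close>, of x N] x y A by auto
    then have x': "x \<in> {grid h j<..<grid h (Suc j)}" using x by force
    let ?a = "(u (grid h (Suc j)) - u (grid h j)) / h"
    have lin: "((\<lambda>z. p + a * (z - q)) has_real_derivative a) (at x)" for p a q :: real
      by (auto intro!: derivative_eq_intros)
    have d: "((\<lambda>z. u (grid h j) + ?a * (z - grid h j)) has_real_derivative ?a) (at x)"
      by (rule lin)
    have ev: "eventually (\<lambda>z. u (grid h j) + ?a * (z - grid h j) = u z) (nhds x)"
      unfolding eventually_nhds
    proof (intro exI conjI ballI)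
      show "open {grid h j<..<grid h (Suc j)}" by simp
      show "x \<in> {grid h j<..<grid h (Suc j)}" by (rule x')
      fix z assume "z \<in> {grid h j<..<grid h (Suc j)}"
      then show "u (grid h j) + ?a * (z - grid h j) = u z"
        by (intro Vh_affine[OF u h \<open>A > 0\<close> j(1), symmetric]) auto
    qed
    have "(u has_real_derivative ?a) (at x)"
      by (rule DERIV_cong_ev[OF refl ev refl, THEN iffD1, OF d])
    then show "(u has_vector_derivative ?s x) (at x)"
      using slope_eq[OF \<open>h > 0\<close> j, of "\<lambda>j. u (grid h j)"]
      by (simp add: has_real_derivative_iff_has_vector_derivative)
  qed
  then show ?thesis by (simp add: has_integral_iff)
qed

lemma Vh_repr:
  assumes "u \<in> Vh A N" "h = A / real N" "A > 0" "N \<ge> 1"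
  shows "has_repr A u (u 0) (slope h N (\<lambda>j. u (grid h j)))"
proof -
  have e: "u x = u 0 + integral {0..x} (slope h N (\<lambda>j. u (grid h j)))" if "x \<in> {0<..<A}" for x
    by (rule Vh_primitive[OF assms]) (use that in auto)
  have "{x \<in> {0<..<A}. u x \<noteq> u 0 + integral {0..x} (slope h N (\<lambda>j. u (grid h j)))} \<subseteq> {}"
    using e by blast
  then have "negligible {x \<in> {0<..<A}. u x \<noteq> u 0 + integral {0..x} (slope h N (\<lambda>j. u (grid h j)))}"
    by (rule negligible_subset[OF negligible_empty])
  then show ?thesis unfolding has_repr_def using slope_L2 by blast
qed

lemma Vh_interpolant:
  assumes h: "h = A / real N" and A: "A > 0" and N: "N \<ge> 1" and zN: "z N = 0"
  obtains v where "v \<in> Vh A N" "\<And>j. j \<le> N \<Longrightarrow> v (grid h j) = z j"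
proof -
  note h0 = grid_facts(1)[OF A h N] and AN = grid_facts(2)[OF A h N]
  have n: "node A N (Suc i) = grid h i" for i by (simp add: node_def grid_def h)
  define v where "v y = z 0 + integral {0..y} (slope h N z)" for y
  have sa: "slope h N z absolutely_integrable_on {0..A}" using slope_L2[of h N z A] by (simp add: L2_Ioo_iff)
  then have si: "slope h N z integrable_on {a..b}" if "0 \<le> a" "b \<le> A" for a b
    using that by (auto simp: absolutely_integrable_on_def intro: integrable_on_subinterval)
  have node: "0 \<le> grid h j" "grid h j \<le> A" if "j \<le> N" for j
    using grid_nonneg[of h j] grid_mono[of h j N] that AN h0 by auto
  have vn: "v (grid h j) = z j" if "j \<le> N" for j
  proof -
    have "integral {0..grid h j} (slope h N z) = (\<Sum>i<j. integral {grid h i..grid h (Suc i)} (slope h N z))"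
      by (rule integral_elements) (use h0 node[OF that] si in auto)
    also have "\<dots> = (\<Sum>i<j. z (Suc i) - z i)"
      by (rule sum.cong) (use slope_integral_element[OF h0] that in auto)
    also have "\<dots> = z j - z 0" by (rule sum_lessThan_telescope)
    finally show ?thesis by (simp add: v_def)
  qed
  have affine: "v y = (z (Suc j) - z j) / h * y + (z j - (z (Suc j) - z j) / h * grid h j)"
    if j: "j < N" and y: "y \<in> {grid h j..grid h (Suc j)}" for j y
  proof -
    have yA: "y \<le> A" using y node[of "Suc j"] j by simp
    have "integral {0..y} (slope h N z) = integral {0..grid h j} (slope h N z) + integral {grid h j..y} (slope h N z)"
      using Henstock_Kurzweil_Integration.integral_combine[of 0 "grid h j" y "slope h N z"] node[of j] y j si[of 0 y] yA by simp
    also have "integral {grid h j..y} (slope h N z) = integral {grid h j..y} (\<lambda>_. (z (Suc j) - z j) / h)"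
      using slope_eq[OF h0 j, of _ z] y by (intro integral_spike[of "{grid h (Suc j)}"]) auto
    also have "\<dots> = (y - grid h j) * ((z (Suc j) - z j) / h)" using y by simp
    finally have "v y = v (grid h j) + (y - grid h j) * ((z (Suc j) - z j) / h)" by (simp add: v_def)
    also have "\<dots> = z j + (y - grid h j) * ((z (Suc j) - z j) / h)" using vn[of j] j by simp
    finally show ?thesis by (simp only: left_diff_distrib right_diff_distrib mult.commute)
  qed
  have "v \<in> Vh A N"
    unfolding Vh_def
  proof (intro CollectI conjI ballI)
    show "continuous_on {0..A} v" unfolding v_def by (rule primitive_continuous[OF sa])
    show "v A = 0" using vn[of N] AN zN by simp
    fix j assume "j \<in> {1..N}"
    then obtain i where i: "j = Suc i" "i < N" by (cases j) auto
    show "\<exists>a b. \<forall>y\<in>{node A N j..node A N (j + 1)}. v y = a * y + b"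
      unfolding i(1) Suc_eq_plus1[symmetric] n using affine[OF i(2)] by blast
  qed
  then show thesis using vn by (rule that)
qed

section \<open>Errors of mass lumping and of interpolation\<close>

lemma primitive_increment_bound:
  fixes D :: "real \<Rightarrow> real"
  assumes D: "D absolutely_integrable_on {0..A}" and "0 \<le> a" "a \<le> x" "x \<le> y" "y \<le> b" "b \<le> A"
  shows "\<bar>integral {0..y} D - integral {0..x} D\<bar> \<le> integral {a..b} (\<lambda>s. \<bar>D s\<bar>)"
proof -
  have i: "D integrable_on {p..q}" "(\<lambda>s. \<bar>D s\<bar>) integrable_on {p..q}" if "0 \<le> p" "q \<le> A" for p q
    using D that by (auto simp: absolutely_integrable_on_def intro: integrable_on_subinterval)
  have "integral {0..y} D = integral {0..x} D + integral {x..y} D"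
    using Henstock_Kurzweil_Integration.integral_combine[of 0 x y D] i[of 0 y] assms by auto
  then have "\<bar>integral {0..y} D - integral {0..x} D\<bar> = \<bar>integral {x..y} D\<bar>" by simp
  also have "\<dots> \<le> integral {x..y} (\<lambda>s. \<bar>D s\<bar>)"
    using integral_norm_bound_integral[OF i(1)[of x y] i(2)[of x y]] assms by simp
  also have "\<dots> \<le> integral {a..b} (\<lambda>s. \<bar>D s\<bar>)"
    by (rule integral_subset_le) (use assms i in auto)
  finally show ?thesis .
qed

lemma abs_integral_square:
  assumes D: "D \<in> L2 {0<..<A}" and "0 \<le> a" "a \<le> b" "b \<le> A"
  shows "(integral {a..b} (\<lambda>s. \<bar>D s\<bar>))\<^sup>2 \<le> (b - a) * integral {a..b} (\<lambda>s. (D s)\<^sup>2)"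
proof -
  have "(\<lambda>s. \<bar>D s\<bar>) integrable_on {a..b}" "(\<lambda>s. \<bar>D s\<bar>\<^sup>2) integrable_on {a..b}"
    using D assms by (auto simp: L2_Ioo_iff absolutely_integrable_on_def intro: integrable_on_subinterval)
  from integrable_cauchy_schwarz[OF this \<open>a \<le> b\<close>] show ?thesis by simp
qed

lemma abel_sum:
  fixes v u :: "nat \<Rightarrow> real"
  shows "(\<Sum>j<N. v j * (u (Suc j) - u j)) = v N * u N - v 0 * u 0 - (\<Sum>j<N. (v (Suc j) - v j) * u (Suc j))"
  by (induction N) (simp_all add: algebra_simps)

text \<open>On one element, the error of the left end point rule for \<open>v u\<close> consists of the error committed by
  replacing \<open>v\<close> with its value at the left node, which is bounded by the oscillation of \<open>v\<close>, and of the term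
  \<open>v (j h) h (u ((j+1) h) - u (j h)) / 2\<close>. The latter is kept exactly, as its sum over the elements has
  cancellations.\<close>

lemma quadrature_element:
  assumes u: "u \<in> Vh A N" and h: "h = A / real N" and A: "A > 0" and j: "j < N"
    and D: "D absolutely_integrable_on {0..A}"
    and v: "\<And>y. y \<in> {0..A} \<Longrightarrow> v y = c + integral {0..y} D"
  shows "\<bar>integral {grid h j..grid h (Suc j)} (\<lambda>y. v y * u y) - h * (v (grid h j) * u (grid h j))
      - v (grid h j) * (h / 2 * (u (grid h (Suc j)) - u (grid h j)))\<bar>
    \<le> h * (integral {grid h j..grid h (Suc j)} (\<lambda>s. \<bar>D s\<bar>) * (\<bar>u (grid h j)\<bar> + \<bar>u (grid h (Suc j))\<bar>))"
proof -
  have "h > 0" unfolding h using A j by simp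
  have AN: "grid h N = A" unfolding h grid_def using j by simp
  define a where "a = grid h j"
  define b where "b = grid h (Suc j)"
  have ab: "0 \<le> a" "a < b" "b \<le> A" "b = a + h"
    using grid_nonneg[of h j] grid_mono[of h "Suc j" N] j AN \<open>h > 0\<close> by (auto simp: a_def b_def grid_Suc)
  define m where "m = (u b - u a) / h"
  have um: "u b = u a + m * h" using \<open>h > 0\<close> by (simp add: m_def)
  have ue: "u y = u a + m * (y - a)" if "y \<in> {a..b}" for y
    using Vh_affine[OF u h A j, of y] that by (simp add: a_def b_def m_def)
  have I1: "(u has_integral (u a * h + m * h\<^sup>2 / 2)) {a..b}"
  proof -
    have "((\<lambda>y. u a + m * (y - a)) has_integral
        ((u a * b + m * (b - a)\<^sup>2 / 2) - (u a * a + m * (a - a)\<^sup>2 / 2))) {a..b}"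
      by (rule fundamental_theorem_of_calculus)
        (use ab in \<open>auto intro!: derivative_eq_intros simp: has_real_derivative_iff_has_vector_derivative[symmetric] field_simps\<close>)
    moreover have "(u a * b + m * (b - a)\<^sup>2 / 2) - (u a * a + m * (a - a)\<^sup>2 / 2) = u a * h + m * h\<^sup>2 / 2"
      unfolding ab(4) by (simp add: distrib_left)
    ultimately have "((\<lambda>y. u a + m * (y - a)) has_integral (u a * h + m * h\<^sup>2 / 2)) {a..b}"
      by simp
    then show ?thesis
      by (rule has_integral_eq[rotated]) (rule ue[symmetric])
  qed
  have cv: "continuous_on {a..b} v"
  proof -
    have "continuous_on {0..A} (\<lambda>y. c + integral {0..y} D)" by (rule primitive_continuous[OF D])
    then have "continuous_on {a..b} (\<lambda>y. c + integral {0..y} D)"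
      by (rule continuous_on_subset) (use ab in auto)
    then show ?thesis
    proof (rule continuous_on_eq)
      fix y assume "y \<in> {a..b}"
      then show "c + integral {0..y} D = v y" by (intro v[symmetric]) (use ab in auto)
    qed
  qed
  have cu: "continuous_on {a..b} u"
    using u ab unfolding Vh_def by (auto intro: continuous_on_subset)
  let ?d = "integral {a..b} (\<lambda>s. \<bar>D s\<bar>)"
  have "(\<lambda>y. (v y - v a) * u y) integrable_on {a..b}"
    by (intro integrable_continuous_interval continuous_intros cv cu)
  then have I2: "((\<lambda>y. (v y - v a) * u y) has_integral integral {a..b} (\<lambda>y. (v y - v a) * u y)) {a..b}"
    by (rule integrable_integral)
  have "((\<lambda>y. (v y - v a) * u y + v a * u y) has_integral
      (integral {a..b} (\<lambda>y. (v y - v a) * u y) + v a * (u a * h + m * h\<^sup>2 / 2))) {a..b}"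
    by (intro has_integral_add I2 has_integral_mult_right I1)
  then have "integral {a..b} (\<lambda>y. v y * u y) =
      integral {a..b} (\<lambda>y. (v y - v a) * u y) + v a * (u a * h + m * h\<^sup>2 / 2)"
    by (intro integral_unique) (simp add: algebra_simps)
  then have eq: "integral {a..b} (\<lambda>y. v y * u y) - h * (v a * u a) - v a * (h / 2 * (u b - u a))
      = integral {a..b} (\<lambda>y. (v y - v a) * u y)"
    using um by (simp add: algebra_simps power2_eq_square)
  have d0: "0 \<le> ?d"
    using D ab by (intro integral_nonneg) (auto simp: absolutely_integrable_on_def intro: integrable_on_subinterval)
  have "norm (integral {a..b} (\<lambda>y. (v y - v a) * u y)) \<le> ?d * (\<bar>u a\<bar> + \<bar>u b\<bar>) * (b - a)"
  proof (rule integral_bound)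
    show "a \<le> b" using ab by simp
    show "continuous_on {a..b} (\<lambda>y. (v y - v a) * u y)" by (intro continuous_intros cv cu)
    fix y assume y: "y \<in> {a..b}"
    have "\<bar>v y - v a\<bar> \<le> ?d"
      using primitive_increment_bound[OF D, of a a y b] v[of y] v[of a] y ab by auto
    moreover have "\<bar>u y\<bar> \<le> \<bar>u a\<bar> + \<bar>u b\<bar>"
    proof -
      define \<theta> where "\<theta> = (y - a) / h"
      have \<theta>: "0 \<le> \<theta>" "\<theta> \<le> 1" "y - a = \<theta> * h" using y ab \<open>h > 0\<close> by (auto simp: \<theta>_def field_simps)
      have "u y = (1 - \<theta>) * u a + \<theta> * u b"
        using ue[OF y] um \<theta>(3) by (simp add: algebra_simps)
      also have "\<bar>\<dots>\<bar> \<le> \<bar>(1 - \<theta>) * u a\<bar> + \<bar>\<theta> * u b\<bar>" by (rule abs_triangle_ineq)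
      also have "\<dots> \<le> 1 * \<bar>u a\<bar> + 1 * \<bar>u b\<bar>"
        unfolding abs_mult using \<theta> by (intro add_mono mult_right_mono) auto
      finally show ?thesis by simp
    qed
    ultimately show "norm ((v y - v a) * u y) \<le> ?d * (\<bar>u a\<bar> + \<bar>u b\<bar>)"
      unfolding real_norm_def abs_mult using d0 by (intro mult_mono) auto
  qed
  then show ?thesis
    using eq ab(4) by (simp add: a_def b_def mult_ac)
qed

lemma sum_shift_vanishing:
  fixes u :: "nat \<Rightarrow> real"
  assumes "u N = 0"
  shows "(\<Sum>j<N. (u (Suc j))\<^sup>2) \<le> (\<Sum>j<N. (u j)\<^sup>2)"
proof -
  have "(\<Sum>j<N. (u (Suc j))\<^sup>2) + (u 0)\<^sup>2 = (\<Sum>j<N. (u j)\<^sup>2) + (u N)\<^sup>2"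
    using sum.lessThan_Suc_shift[of "\<lambda>j. (u j)\<^sup>2" N] by simp
  moreover have "0 \<le> (u 0)\<^sup>2" "(u N)\<^sup>2 = 0" using assms by simp_all
  ultimately show ?thesis by linarith
qed

text \<open>After summation by parts, the terms that \<open>quadrature_element\<close> keeps exactly are controlled by the increments of
  \<open>v\<close>, except for the boundary term \<open>h v(0) u(0) / 2\<close>: mass lumping is the trapezoidal rule with a wrong
  weight at \<open>0\<close>. All other terms are of order \<open>h\<close>. In the boundary term, \<open>u(0)\<close> is bounded by \<open>h\<^sup>-\<^sup>1\<^sup>/\<^sup>2\<close>
  times the discrete norm of \<open>u\<close>, which leaves the order \<open>h\<^sup>1\<^sup>/\<^sup>2\<close>.\<close>

lemma lumping_error:
  assumes u: "u \<in> Vh A N" and h: "h = A / real N" and A: "A > 0" and N: "N \<ge> 1"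
    and D: "D \<in> L2 {0<..<A}"
    and v: "\<And>y. y \<in> {0..A} \<Longrightarrow> v y = c + integral {0..y} D" and vA: "v A = 0"
  shows "(integral {0..A} (\<lambda>y. v y * u y) - h * (\<Sum>j<N. v (grid h j) * u (grid h j)))\<^sup>2
    \<le> 9 * A * h * integral {0..A} (\<lambda>y. (D y)\<^sup>2) * (h * (\<Sum>j<N. (u (grid h j))\<^sup>2))"
proof -
  note h0 = grid_facts(1)[OF A h N] and AN = grid_facts(2)[OF A h N]
  have hA: "h \<le> A" using grid_mono[of h 1 N] AN h0 N by (simp add: grid_Suc)
  have Da: "D absolutely_integrable_on {0..A}" and Di: "D integrable_on {0..A}"
    and D2i: "(\<lambda>y. (D y)\<^sup>2) integrable_on {0..A}"
    using D by (auto simp: L2_Ioo_iff absolutely_integrable_on_def)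
  define d where "d j = integral {grid h j..grid h (Suc j)} (\<lambda>s. \<bar>D s\<bar>)" for j
  define w where "w j = u (grid h j)" for j
  define V where "V j = v (grid h j)" for j
  define G where "G = sqrt (integral {0..A} (\<lambda>y. (D y)\<^sup>2))"
  define U where "U = sqrt (\<Sum>j<N. (w j)\<^sup>2)"
  define T where "T = sqrt (\<Sum>j<N. (d j)\<^sup>2)"
  have nonneg: "0 \<le> integral {0..A} (\<lambda>y. (D y)\<^sup>2)"
    using D2i by (intro integral_nonneg) auto
  have pos: "0 \<le> G" "0 \<le> U" "0 \<le> T"
    unfolding G_def U_def T_def using nonneg by (auto intro!: sum_nonneg)
  have wN: "w N = 0" using u AN by (simp add: w_def Vh_def)
  have VN: "V N = 0" using vA AN by (simp add: V_def)
  have node: "grid h j \<in> {0..A}" if "j \<le> N" for j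
    using grid_nonneg[of h j] grid_mono[of h j N] that AN h0 by auto
  have d0: "0 \<le> d j" if "j < N" for j
    unfolding d_def using Da node[of j] node[of "Suc j"] that
    by (intro integral_nonneg) (auto simp: absolutely_integrable_on_def intro: integrable_on_subinterval)
  have cu: "continuous_on {0..A} u" using u by (simp add: Vh_def)
  have "continuous_on {0..A} (\<lambda>y. c + integral {0..y} D)" by (rule primitive_continuous[OF Da])
  then have cv: "continuous_on {0..A} v"
    by (rule continuous_on_eq) (rule v[symmetric])
  have "(\<lambda>y. v y * u y) integrable_on {0..A}"
    by (intro integrable_continuous_interval continuous_intros cv cu)
  then have split: "integral {0..A} (\<lambda>y. v y * u y) = (\<Sum>j<N. integral {grid h j..grid h (Suc j)} (\<lambda>y. v y * u y))"
    using integral_elements[of h "\<lambda>y. v y * u y" N] h0 AN by simp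
  \<comment> \<open>What remains on element \<open>j\<close> after removal of the term that is treated by summation by parts.\<close>
  define e where "e j = integral {grid h j..grid h (Suc j)} (\<lambda>y. v y * u y) - h * (V j * w j)
      - V j * (h / 2 * (w (Suc j) - w j))" for j
  have e: "\<bar>e j\<bar> \<le> h * (d j * (\<bar>w j\<bar> + \<bar>w (Suc j)\<bar>))" if "j < N" for j
    using quadrature_element[OF u h A that Da v] by (simp add: e_def d_def w_def V_def)
  have "integral {0..A} (\<lambda>y. v y * u y) - h * (\<Sum>j<N. V j * w j)
      = (\<Sum>j<N. e j) + h / 2 * (\<Sum>j<N. V j * (w (Suc j) - w j))"
    unfolding split e_def by (simp add: sum_subtractf sum_distrib_left algebra_simps sum.distrib)
  also have "(\<Sum>j<N. V j * (w (Suc j) - w j)) = - V 0 * w 0 - (\<Sum>j<N. (V (Suc j) - V j) * w (Suc j))"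
    using abel_sum[of V w N] wN by simp
  finally have E: "integral {0..A} (\<lambda>y. v y * u y) - h * (\<Sum>j<N. V j * w j)
      = (\<Sum>j<N. e j) + h / 2 * (- V 0 * w 0 - (\<Sum>j<N. (V (Suc j) - V j) * w (Suc j)))" .
  have dw: "(\<Sum>j<N. d j * \<bar>w j\<bar>) \<le> T * U"
    using L2_set_mult_ineq[of d w "{..<N}"] d0 
    by (simp add: T_def U_def L2_set_def)
  have dw': "(\<Sum>j<N. d j * \<bar>w (Suc j)\<bar>) \<le> T * U"
  proof -
    have "(\<Sum>j<N. d j * \<bar>w (Suc j)\<bar>) \<le> T * sqrt (\<Sum>j<N. (w (Suc j))\<^sup>2)"
      using L2_set_mult_ineq[of d "\<lambda>j. w (Suc j)" "{..<N}"] d0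
      by (simp add: T_def L2_set_def)
    also have "\<dots> \<le> T * U"
      unfolding U_def using pos sum_shift_vanishing[where u = w, OF wN] by (intro mult_left_mono) auto
    finally show ?thesis .
  qed
  have T: "T \<le> sqrt h * G"
  proof -
    have "(\<Sum>j<N. (d j)\<^sup>2) \<le> (\<Sum>j<N. h * integral {grid h j..grid h (Suc j)} (\<lambda>s. (D s)\<^sup>2))"
    proof (rule sum_mono)
      fix j assume "j \<in> {..<N}"
      then show "(d j)\<^sup>2 \<le> h * integral {grid h j..grid h (Suc j)} (\<lambda>s. (D s)\<^sup>2)"
        using abs_integral_square[OF D, of "grid h j" "grid h (Suc j)"] node[of j] node[of "Suc j"] h0
        by (simp add: d_def grid_Suc)
    qed
    also have "\<dots> = h * integral {0..A} (\<lambda>s. (D s)\<^sup>2)"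
      using integral_elements[of h "\<lambda>s. (D s)\<^sup>2" N] h0 AN D2i by (simp add: sum_distrib_left)
    finally show ?thesis unfolding T_def G_def real_sqrt_mult[symmetric] by (rule real_sqrt_le_mono)
  qed
  have V0: "\<bar>V 0\<bar> \<le> sqrt A * G"
  proof -
    have "V 0 = - integral {0..A} D" using v[of 0] v[of A] vA A by (simp add: V_def)
    then have "(V 0)\<^sup>2 \<le> A * integral {0..A} (\<lambda>s. (D s)\<^sup>2)"
      using integrable_cauchy_schwarz[OF Di D2i] A by simp
    then have "sqrt ((V 0)\<^sup>2) \<le> sqrt (A * integral {0..A} (\<lambda>s. (D s)\<^sup>2))" by (rule real_sqrt_le_mono)
    then show ?thesis by (simp add: real_sqrt_mult G_def)
  qed
  have w0: "\<bar>w 0\<bar> \<le> U"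
  proof -
    have "(w 0)\<^sup>2 \<le> (\<Sum>j<N. (w j)\<^sup>2)"
      by (rule member_le_sum) (use N in auto)
    then have "sqrt ((w 0)\<^sup>2) \<le> U" unfolding U_def by (rule real_sqrt_le_mono)
    then show ?thesis by simp
  qed
  have "\<bar>\<Sum>j<N. e j\<bar> \<le> (\<Sum>j<N. h * (d j * (\<bar>w j\<bar> + \<bar>w (Suc j)\<bar>)))"
    by (rule order_trans[OF sum_abs sum_mono]) (use e in auto)
  also have "\<dots> = h * ((\<Sum>j<N. d j * \<bar>w j\<bar>) + (\<Sum>j<N. d j * \<bar>w (Suc j)\<bar>))"
    by (simp add: sum_distrib_left sum.distrib distrib_left)
  also have "\<dots> \<le> h * (T * U + T * U)"
    using h0 dw dw' by (intro mult_left_mono add_mono) auto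
  finally have 1: "\<bar>\<Sum>j<N. e j\<bar> \<le> h * (2 * (T * U))" by simp
  have "\<bar>\<Sum>j<N. (V (Suc j) - V j) * w (Suc j)\<bar> \<le> (\<Sum>j<N. d j * \<bar>w (Suc j)\<bar>)"
  proof (rule order_trans[OF sum_abs sum_mono])
    fix j assume "j \<in> {..<N}"
    then have "\<bar>V (Suc j) - V j\<bar> \<le> d j"
      using primitive_increment_bound[OF Da, of "grid h j" "grid h j" "grid h (Suc j)" "grid h (Suc j)"]
        v[of "grid h j"] v[of "grid h (Suc j)"] node[of j] node[of "Suc j"] h0
      by (simp add: V_def d_def grid_Suc)
    then show "\<bar>(V (Suc j) - V j) * w (Suc j)\<bar> \<le> d j * \<bar>w (Suc j)\<bar>"
      by (simp add: abs_mult mult_right_mono)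
  qed
  also note dw'
  finally have 2: "\<bar>\<Sum>j<N. (V (Suc j) - V j) * w (Suc j)\<bar> \<le> T * U" .
  have 3: "\<bar>V 0 * w 0\<bar> \<le> sqrt A * G * U"
    unfolding abs_mult using V0 w0 A pos by (intro mult_mono) auto
  have TU: "T * U \<le> sqrt A * G * U"
  proof (rule mult_right_mono)
    have "sqrt h * G \<le> sqrt A * G" using hA pos by (intro mult_right_mono) auto
    with T show "T \<le> sqrt A * G" by (rule order_trans)
  qed (rule pos)
  have "\<bar>integral {0..A} (\<lambda>y. v y * u y) - h * (\<Sum>j<N. V j * w j)\<bar>
      \<le> \<bar>\<Sum>j<N. e j\<bar> + h / 2 * (\<bar>V 0 * w 0\<bar> + \<bar>\<Sum>j<N. (V (Suc j) - V j) * w (Suc j)\<bar>)"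
  proof -
    have "\<bar>h / 2 * (- V 0 * w 0 - (\<Sum>j<N. (V (Suc j) - V j) * w (Suc j)))\<bar>
        = h / 2 * \<bar>- V 0 * w 0 - (\<Sum>j<N. (V (Suc j) - V j) * w (Suc j))\<bar>"
      using h0 by (simp add: abs_mult)
    also have "\<dots> \<le> h / 2 * (\<bar>V 0 * w 0\<bar> + \<bar>\<Sum>j<N. (V (Suc j) - V j) * w (Suc j)\<bar>)"
      using h0 by (intro mult_left_mono) auto
    finally show ?thesis unfolding E by linarith
  qed
  also have "\<dots> \<le> h * (2 * (sqrt A * G * U)) + h / 2 * (sqrt A * G * U + sqrt A * G * U)"
    using 1 2 3 TU h0
    by (intro add_mono mult_left_mono order_trans[OF 1]) auto
  also have "\<dots> = 3 * h * (sqrt A * G * U)" by (simp add: algebra_simps)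
  finally have "\<bar>integral {0..A} (\<lambda>y. v y * u y) - h * (\<Sum>j<N. V j * w j)\<bar> \<le> 3 * h * (sqrt A * G * U)" .
  from power_mono[OF this, of 2]
  have "(integral {0..A} (\<lambda>y. v y * u y) - h * (\<Sum>j<N. V j * w j))\<^sup>2 \<le> (3 * h * (sqrt A * G * U))\<^sup>2"
    by simp
  also have "\<dots> = 9 * A * h * integral {0..A} (\<lambda>y. (D y)\<^sup>2) * (h * (\<Sum>j<N. (w j)\<^sup>2))"
  proof -
    have "(sqrt A)\<^sup>2 = A" "G\<^sup>2 = integral {0..A} (\<lambda>y. (D y)\<^sup>2)" "U\<^sup>2 = (\<Sum>j<N. (w j)\<^sup>2)"
      using A nonneg by (auto simp: G_def U_def intro!: real_sqrt_pow2 sum_nonneg)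
    then show ?thesis by (simp add: power_mult_distrib power2_eq_square[of h])
  qed
  finally show ?thesis by (simp add: w_def V_def)
qed

text \<open>On each element the interpolant has the mean of \<open>D\<close> as its derivative, and the deviation of \<open>D\<close> from its mean is
  at most the integral of \<open>\<bar>D2\<bar>\<close> over the element.\<close>

lemma interpolation_error:
  assumes D: "D \<in> L2 {0<..<A}" and r: "has_repr A D c D2" and h: "h = A / real N" and A: "A > 0" and N: "N \<ge> 1"
    and w: "\<And>j. j < N \<Longrightarrow> w (Suc j) - w j = integral {grid h j..grid h (Suc j)} D"
  shows "integral {0..A} (\<lambda>y. (slope h N w y - D y)\<^sup>2) \<le> h\<^sup>2 * integral {0..A} (\<lambda>y. (D2 y)\<^sup>2)"
proof -
  note h0 = grid_facts(1)[OF A h N] and AN = grid_facts(2)[OF A h N] and node = grid_facts(3)[OF A h N]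
  have D2: "D2 \<in> L2 {0<..<A}" using r by (simp add: has_repr_def)
  have D2a: "D2 absolutely_integrable_on {0..A}" by (rule has_repr_abs[OF r])
  have D2i: "(\<lambda>y. (D2 y)\<^sup>2) integrable_on {0..A}"
    using D2 by (simp add: L2_Ioo_iff absolutely_integrable_on_def)
  define W where "W y = c + integral {0..y} D2" for y
  have cW: "continuous_on {0..A} W" unfolding W_def by (rule primitive_continuous[OF D2a])
  have neg: "negligible ({x \<in> {0<..<A}. D x \<noteq> W x} \<union> {0, A})"
    using r by (auto simp: has_repr_def W_def)
  define g where "g j = integral {grid h j..grid h (Suc j)} (\<lambda>s. \<bar>D2 s\<bar>)" for j
  have el: "integral {grid h j..grid h (Suc j)} (\<lambda>y. (slope h N w y - D y)\<^sup>2)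
     \<le> h\<^sup>2 * integral {grid h j..grid h (Suc j)} (\<lambda>y. (D2 y)\<^sup>2)" if j: "j < N" for j
  proof -
    define a where "a = grid h j"
    define b where "b = grid h (Suc j)"
    have ab: "0 \<le> a" "a < b" "b \<le> A" "b = a + h"
      using node[of j] node[of "Suc j"] j h0 by (auto simp: a_def b_def grid_Suc)
    have c: "continuous_on {a..b} W" by (rule continuous_on_subset[OF cW]) (use ab in auto)
    define m where "m = (w (Suc j) - w j) / h"
    have "integral {a..b} W = integral {a..b} D"
      by (rule integral_spike[OF neg]) (use ab in auto)
    then have m: "integral {a..b} W = m * h"
      using w[OF j] h0 by (simp add: m_def a_def b_def)
    have osc: "\<bar>W y - W x\<bar> \<le> g j" if "x \<in> {a..b}" "y \<in> {a..b}" for x y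
    proof (cases "x \<le> y")
      case True
      then show ?thesis
        using primitive_increment_bound[OF D2a, of a x y b] that ab
        by (simp add: W_def g_def a_def b_def)
    next
      case False
      then show ?thesis
        using primitive_increment_bound[OF D2a, of a y x b] that ab
        by (simp add: W_def g_def a_def b_def abs_minus_commute)
    qed
    have dev: "\<bar>m - W y\<bar> \<le> g j" if y: "y \<in> {a..b}" for y
    proof -
      have i: "integral {a..b} (\<lambda>x. W x - W y) = m * h - W y * h"
      proof -
        have "integral {a..b} (\<lambda>x. W x - W y) = integral {a..b} W - integral {a..b} (\<lambda>x. W y)"
          by (intro integral_diff integrable_continuous_interval c continuous_on_const)
        also have "integral {a..b} (\<lambda>x. W y) = W y * h" using ab by simp
        finally show ?thesis by (simp add: m)
      qed
      have "norm (integral {a..b} (\<lambda>x. W x - W y)) \<le> g j * (b - a)"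
        by (rule integral_bound) (use ab y osc c in \<open>auto intro!: continuous_intros\<close>)
      then have "\<bar>m - W y\<bar> * h \<le> g j * h"
        unfolding i using ab(4) h0 by (simp add: left_diff_distrib[symmetric] abs_mult)
      then show ?thesis using h0 by simp
    qed
    have "integral {a..b} (\<lambda>y. (slope h N w y - D y)\<^sup>2) = integral {a..b} (\<lambda>y. (m - W y)\<^sup>2)"
    proof (rule integral_spike)
      show "negligible (({x \<in> {0<..<A}. D x \<noteq> W x} \<union> {0, A}) \<union> {b})"
        by (intro negligible_Un neg) auto
      fix y assume "y \<in> {a..b} - (({x \<in> {0<..<A}. D x \<noteq> W x} \<union> {0, A}) \<union> {b})"
      then show "(m - W y)\<^sup>2 = (slope h N w y - D y)\<^sup>2"
        using slope_eq[OF h0 j, of y w] ab by (auto simp: m_def a_def b_def)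
    qed
    also have "\<dots> \<le> (g j)\<^sup>2 * (b - a)"
    proof -
      have "norm (integral {a..b} (\<lambda>y. (m - W y)\<^sup>2)) \<le> (g j)\<^sup>2 * (b - a)"
      proof (rule integral_bound)
        show "continuous_on {a..b} (\<lambda>y. (m - W y)\<^sup>2)" by (intro continuous_intros c)
        show "norm ((m - W y)\<^sup>2) \<le> (g j)\<^sup>2" if "y \<in> {a..b}" for y
          using power_mono[OF dev[OF that], of 2] by simp
      qed (use ab in simp)
      then show ?thesis by simp
    qed
    also have "\<dots> = h * (g j)\<^sup>2" using ab by simp
    also have "\<dots> \<le> h * (h * integral {a..b} (\<lambda>y. (D2 y)\<^sup>2))"
      using abs_integral_square[OF D2, of a b] ab h0
      by (intro mult_left_mono) (auto simp: g_def a_def b_def)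
    finally show ?thesis by (simp add: a_def b_def power2_eq_square)
  qed
  have i1: "(\<lambda>y. (slope h N w y - D y)\<^sup>2) integrable_on {0..A}"
  proof -
    have "(\<lambda>y. slope h N w y * slope h N w y) absolutely_integrable_on {0..A}"
      "(\<lambda>y. slope h N w y * D y) absolutely_integrable_on {0..A}"
      "(\<lambda>y. D y * D y) absolutely_integrable_on {0..A}"
      by (intro L2_mult_absolutely_integrable slope_L2 D)+
    then have "(\<lambda>y. slope h N w y * slope h N w y - 2 * (slope h N w y * D y) + D y * D y) integrable_on {0..A}"
      unfolding absolutely_integrable_on_def by (intro integrable_add integrable_diff integrable_on_mult_right) auto
    then show ?thesis by (simp add: power2_eq_square algebra_simps)
  qed
  have "integral {0..A} (\<lambda>y. (slope h N w y - D y)\<^sup>2)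
      = (\<Sum>j<N. integral {grid h j..grid h (Suc j)} (\<lambda>y. (slope h N w y - D y)\<^sup>2))"
    using integral_elements[of h _ N] h0 AN i1 by simp
  also have "\<dots> \<le> (\<Sum>j<N. h\<^sup>2 * integral {grid h j..grid h (Suc j)} (\<lambda>y. (D2 y)\<^sup>2))"
    by (rule sum_mono) (use el in auto)
  also have "\<dots> = h\<^sup>2 * integral {0..A} (\<lambda>y. (D2 y)\<^sup>2)"
    using integral_elements[of h _ N] h0 AN D2i by (simp add: sum_distrib_left)
  finally show ?thesis .
qed

section \<open>The energy estimate for nodal vectors\<close>

text \<open>The remainders sum up to at most the mesh size of the partition times \<open>n t - n 0\<close>. This replaces the
  integration of a differential inequality for \<open>F\<close>, of which no derivative has to exist.\<close>

lemma telescoping_limit: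
  fixes F m n :: "real \<Rightarrow> real"
  assumes t: "0 \<le> t"
    and step: "\<And>a b. 0 \<le> a \<Longrightarrow> a \<le> b \<Longrightarrow> b \<le> t \<Longrightarrow> F b - F a \<le> m b - m a + (b - a) * (n b - n a)"
  shows "F t - F 0 \<le> m t - m 0"
proof -
  have "F t - F 0 \<le> m t - m 0 + t * (n t - n 0) * inverse (real (Suc k))" for k
  proof -
    define K where "K = real (Suc k)"
    have K: "K > 0" by (simp add: K_def)
    define p where "p i = real i * t / K" for i :: nat
    have p: "0 \<le> p i" "p i \<le> p (Suc i)" "p (Suc i) - p i = t / K" for i
      using t K by (auto simp: p_def field_simps)
    have pt: "p (Suc i) \<le> t" if "i < Suc k" for i
    proof -
      have "real (Suc i) * t \<le> K * t" using that t by (intro mult_right_mono) (auto simp: K_def)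
      then show ?thesis using K by (simp add: p_def divide_simps mult.commute)
    qed
    have p0: "p 0 = 0" "p (Suc k) = t" by (auto simp: p_def K_def)
    have "F t - F 0 = (\<Sum>i<Suc k. F (p (Suc i)) - F (p i))"
      by (subst sum_lessThan_telescope) (simp add: p0)
    also have "\<dots> \<le> (\<Sum>i<Suc k. (m (p (Suc i)) - m (p i)) + t / K * (n (p (Suc i)) - n (p i)))"
    proof (rule sum_mono)
      fix i assume "i \<in> {..<Suc k}"
      then show "F (p (Suc i)) - F (p i) \<le> (m (p (Suc i)) - m (p i)) + t / K * (n (p (Suc i)) - n (p i))"
        using step[of "p i" "p (Suc i)"] p[of i] pt[of i] by simp
    qed
    also have "\<dots> = (m (p (Suc k)) - m (p 0)) + t / K * (n (p (Suc k)) - n (p 0))"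
      unfolding sum.distrib sum_distrib_left[symmetric] sum_lessThan_telescope[of "\<lambda>i. m (p i)"]
        sum_lessThan_telescope[of "\<lambda>i. n (p i)"] ..
    finally show ?thesis by (simp add: p0 K_def divide_inverse mult_ac)
  qed
  moreover have "(\<lambda>k. m t - m 0 + t * (n t - n 0) * inverse (real (Suc k))) \<longlonglongrightarrow> m t - m 0 + t * (n t - n 0) * 0"
    by (intro tendsto_add tendsto_mult tendsto_const LIMSEQ_inverse_real_of_nat)
  ultimately show ?thesis
    using LIMSEQ_le_const[of _ "m t - m 0 + t * (n t - n 0) * 0" "F t - F 0"] by simp
qed

text \<open>The form \<open>\<kappa>\<close> on nodal vectors, with \<open>p = A\<^sup>2 K / h\<close> and \<open>q\<close> the weight of the boundary term.\<close>

definition stiffness :: "nat \<Rightarrow> real \<Rightarrow> real \<Rightarrow> (nat \<Rightarrow> real) \<Rightarrow> (nat \<Rightarrow> real) \<Rightarrow> real" where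
  "stiffness N p q x z = p * (\<Sum>j<N. (x (Suc j) - x j) * (z (Suc j) - z j)) + q * x 0 * z 0"

lemma stiffness_add_left:
  "stiffness N p q (\<lambda>j. x j + y j) z = stiffness N p q x z + stiffness N p q y z"
  by (simp add: stiffness_def algebra_simps sum.distrib sum_subtractf)

lemma stiffness_diff_left:
  "stiffness N p q (\<lambda>j. x j - y j) z = stiffness N p q x z - stiffness N p q y z"
  by (simp add: stiffness_def algebra_simps sum.distrib sum_subtractf)

lemma stiffness_diff_squares:
  "stiffness N p q (\<lambda>j. x j + y j) (\<lambda>j. x j - y j) = stiffness N p q x x - stiffness N p q y y"
  by (simp add: stiffness_def algebra_simps sum.distrib sum_subtractf)

lemma stiffness_bound:
  assumes "0 \<le> p" "0 \<le> q" "\<And>j. j \<le> N \<Longrightarrow> \<bar>x j\<bar> \<le> 2 * \<rho>" "\<And>j. j \<le> N \<Longrightarrow> \<bar>z j\<bar> \<le> \<rho>"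
  shows "stiffness N p q x z \<le> (8 * p * real N + 2 * q) * \<rho>\<^sup>2"
proof -
  have \<rho>: "0 \<le> \<rho>" using assms(4)[of 0] by simp
  have "(x (Suc j) - x j) * (z (Suc j) - z j) \<le> 8 * \<rho>\<^sup>2" if "j < N" for j
  proof -
    have "\<bar>x (Suc j) - x j\<bar> \<le> 4 * \<rho>" "\<bar>z (Suc j) - z j\<bar> \<le> 2 * \<rho>"
      using assms(3)[of j] assms(3)[of "Suc j"] assms(4)[of j] assms(4)[of "Suc j"] that by auto
    then have "\<bar>x (Suc j) - x j\<bar> * \<bar>z (Suc j) - z j\<bar> \<le> (4 * \<rho>) * (2 * \<rho>)"
      using \<rho> by (intro mult_mono) auto
    then show ?thesis
      using abs_ge_self[of "(x (Suc j) - x j) * (z (Suc j) - z j)"]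
      by (simp add: abs_mult power2_eq_square)
  qed
  then have "(\<Sum>j<N. (x (Suc j) - x j) * (z (Suc j) - z j)) \<le> real N * (8 * \<rho>\<^sup>2)"
    using sum_bounded_above[of "{..<N}" "\<lambda>j. (x (Suc j) - x j) * (z (Suc j) - z j)" "8 * \<rho>\<^sup>2"] by simp
  then have 1: "p * (\<Sum>j<N. (x (Suc j) - x j) * (z (Suc j) - z j)) \<le> p * (real N * (8 * \<rho>\<^sup>2))"
    using assms(1) by (rule mult_left_mono)
  have "\<bar>x 0\<bar> * \<bar>z 0\<bar> \<le> (2 * \<rho>) * \<rho>" using assms(3)[of 0] assms(4)[of 0] \<rho> by (intro mult_mono) auto
  then have "x 0 * z 0 \<le> 2 * \<rho>\<^sup>2"
    using abs_ge_self[of "x 0 * z 0"] by (simp add: abs_mult power2_eq_square)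
  then have "q * (x 0 * z 0) \<le> q * (2 * \<rho>\<^sup>2)" using assms(2) by (rule mult_left_mono)
  with 1 show ?thesis by (simp add: stiffness_def algebra_simps)
qed

text \<open>This absorbs the consistency error \<open>r\<close> into the square \<open>P\<close> of the discrete norm in the energy estimate.\<close>

lemma young_square:
  fixes r P Y :: real
  assumes "r\<^sup>2 \<le> Y * P" "0 \<le> P" "0 \<le> Y"
  shows "r \<le> P + Y / 4"
proof -
  have "(P + Y / 4)\<^sup>2 = (P - Y / 4)\<^sup>2 + Y * P"
    by (simp add: power2_eq_square field_simps)
  moreover have "0 \<le> (P - Y / 4)\<^sup>2" by simp
  ultimately have "r\<^sup>2 \<le> (P + Y / 4)\<^sup>2" using assms(1) by linarith
  moreover have "0 \<le> P + Y / 4" using assms(2,3) by simp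
  ultimately show ?thesis by (rule power2_le_imp_le)
qed

text \<open>A time-integrated form of the usual energy argument. The assumption \<open>eq\<close> says that the evolution
  equation, integrated over \<open>[a,b]\<close> and tested with the increment of \<open>x\<close>, holds up to a consistency error that
  is bounded through \<open>c\<close> and \<open>\<Gamma>\<close>. The square of the discrete norm of this
  increment absorbs the consistency error. The energy at the end points and the mean of the form over
  \<open>[a,b]\<close> differ by a product of two increments of \<open>x\<close>, which by \<open>reg\<close> is a remainder of the kind that
  disappears in \<open>telescoping_limit\<close>.\<close>

lemma energy_estimate:
  fixes x :: "real \<Rightarrow> nat \<Rightarrow> real" and \<Gamma> n :: "real \<Rightarrow> real"
  assumes t: "0 \<le> t" and pq: "0 \<le> p" "0 \<le> q" and h: "0 \<le> h" and c: "0 \<le> c"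
    and cont: "\<And>j. j \<le> N \<Longrightarrow> continuous_on {0..t} (\<lambda>s. x s j)"
    and eq: "\<And>a b. 0 \<le> a \<Longrightarrow> a \<le> b \<Longrightarrow> b \<le> t \<Longrightarrow>
      (h * (\<Sum>j<N. (x b j - x a j)\<^sup>2) + integral {a..b} (\<lambda>s. stiffness N p q (x s) (\<lambda>j. x b j - x a j)))\<^sup>2
        \<le> c * (b - a) * (\<Gamma> b - \<Gamma> a) * (h * (\<Sum>j<N. (x b j - x a j)\<^sup>2))"
    and reg: "\<And>a b j. 0 \<le> a \<Longrightarrow> a \<le> b \<Longrightarrow> b \<le> t \<Longrightarrow> j \<le> N \<Longrightarrow> (x b j - x a j)\<^sup>2 \<le> (b - a) * (n b - n a)"
    and nmono: "\<And>a b. 0 \<le> a \<Longrightarrow> a \<le> b \<Longrightarrow> b \<le> t \<Longrightarrow> n a \<le> n b"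
    and \<Gamma>mono: "\<And>a b. 0 \<le> a \<Longrightarrow> a \<le> b \<Longrightarrow> b \<le> t \<Longrightarrow> \<Gamma> a \<le> \<Gamma> b"
  shows "stiffness N p q (x t) (x t) \<le> stiffness N p q (x 0) (x 0) + c / 2 * (\<Gamma> t - \<Gamma> 0)"
proof -
  \<comment> \<open>\<open>B \<rho>\<^sup>2\<close> bounds the form on vectors with entries of size \<open>2 \<rho>\<close> and \<open>\<rho>\<close>, by \<open>stiffness_bound\<close>.\<close>
  define B where "B = 8 * p * real N + 2 * q"
  define E where "E s = stiffness N p q (x s) (x s)" for s
  have "E t - E 0 \<le> c / 2 * \<Gamma> t - c / 2 * \<Gamma> 0"
  proof (rule telescoping_limit[where n = "\<lambda>s. B * n s", OF t])
    fix a b :: real assume ab: "0 \<le> a" "a \<le> b" "b \<le> t"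
    show "E b - E a \<le> c / 2 * \<Gamma> b - c / 2 * \<Gamma> a + (b - a) * (B * n b - B * n a)"
    proof (cases "a = b")
      case False
      define z where "z j = x b j - x a j" for j
      define \<rho> where "\<rho> = sqrt ((b - a) * (n b - n a))"
      have nn: "0 \<le> (b - a) * (n b - n a)" using ab nmono[of a b] by simp
      have osc: "\<bar>x s' j - x s j\<bar> \<le> \<rho>" if "a \<le> s" "s \<le> s'" "s' \<le> b" "j \<le> N" for s s' j
      proof -
        have "(x s' j - x s j)\<^sup>2 \<le> (s' - s) * (n s' - n s)" using that ab by (intro reg) auto
        also have "\<dots> \<le> (b - a) * (n b - n a)"
          using that ab nmono[of a s] nmono[of s s'] nmono[of s' b] by (intro mult_mono) auto
        finally have "sqrt ((x s' j - x s j)\<^sup>2) \<le> \<rho>" unfolding \<rho>_def by (rule real_sqrt_le_mono)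
        then show ?thesis by simp
      qed
      have cz: "continuous_on {a..b} (\<lambda>s. stiffness N p q (x s) z)"
        unfolding stiffness_def
        by (intro continuous_intros continuous_on_subset[OF cont]) (use ab in auto)
      then have iz: "(\<lambda>s. stiffness N p q (x s) z) integrable_on {a..b}"
        by (rule integrable_continuous_interval)
      define P where "P = h * (\<Sum>j<N. (z j)\<^sup>2)"
      define I where "I = integral {a..b} (\<lambda>s. stiffness N p q (x s) z)"
      have "(P + I)\<^sup>2 \<le> (c * (b - a) * (\<Gamma> b - \<Gamma> a)) * P"
        using eq[OF ab] by (simp add: P_def I_def z_def[abs_def])
      then have "P + I \<le> P + c * (b - a) * (\<Gamma> b - \<Gamma> a) / 4"
        by (rule young_square) (use h c ab \<Gamma>mono[OF ab] in \<open>auto simp: P_def intro!: mult_nonneg_nonneg sum_nonneg\<close>)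
      then have I: "I \<le> c * (b - a) * (\<Gamma> b - \<Gamma> a) / 4" by simp
      have Eab: "E b - E a = stiffness N p q (\<lambda>j. x b j + x a j) z"
        unfolding E_def z_def by (rule stiffness_diff_squares[symmetric])
      \<comment> \<open>The sum of \<open>x a\<close> and \<open>x b\<close> is \<open>2 x s\<close> plus a difference of two increments.\<close>
      have pt: "E b - E a \<le> 2 * stiffness N p q (x s) z + B * \<rho>\<^sup>2" if s: "s \<in> {a..b}" for s
      proof -
        have "stiffness N p q (\<lambda>j. (x b j - x s j) - (x s j - x a j)) z \<le> B * \<rho>\<^sup>2"
          unfolding B_def
        proof (rule stiffness_bound[OF pq])
          fix j assume j: "j \<le> N"
          show "\<bar>(x b j - x s j) - (x s j - x a j)\<bar> \<le> 2 * \<rho>"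
            using osc[of s b j] osc[of a s j] s j by auto
          show "\<bar>z j\<bar> \<le> \<rho>" using osc[of a b j] ab j by (simp add: z_def)
        qed
        moreover have "stiffness N p q (\<lambda>j. x b j + x a j) z
            = 2 * stiffness N p q (x s) z + stiffness N p q (\<lambda>j. (x b j - x s j) - (x s j - x a j)) z"
          by (simp only: stiffness_add_left stiffness_diff_left)
        ultimately show ?thesis unfolding Eab by linarith
      qed
      have "integral {a..b} (\<lambda>s. E b - E a) \<le> integral {a..b} (\<lambda>s. 2 * stiffness N p q (x s) z + B * \<rho>\<^sup>2)"
        by (rule integral_le) (use pt iz in \<open>auto intro!: integrable_add integrable_on_mult_right\<close>)
      also have "\<dots> = 2 * I + B * \<rho>\<^sup>2 * (b - a)"
      proof -
        have "integral {a..b} (\<lambda>s. 2 * stiffness N p q (x s) z + B * \<rho>\<^sup>2)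
          = integral {a..b} (\<lambda>s. 2 * stiffness N p q (x s) z) + integral {a..b} (\<lambda>s. B * \<rho>\<^sup>2)"
          by (intro integral_add integrable_on_mult_right iz integrable_const_ivl)
        also have "integral {a..b} (\<lambda>s. B * \<rho>\<^sup>2) = B * \<rho>\<^sup>2 * (b - a)" using ab by simp
        also have "integral {a..b} (\<lambda>s. 2 * stiffness N p q (x s) z) = 2 * I" unfolding I_def by simp
        finally show ?thesis .
      qed
      finally have "(E b - E a) * (b - a) \<le> 2 * I + B * \<rho>\<^sup>2 * (b - a)"
        using ab by (simp add: mult.commute)
      also have "\<dots> \<le> (c / 2 * (\<Gamma> b - \<Gamma> a) + B * \<rho>\<^sup>2) * (b - a)"
        using I by (simp add: algebra_simps)
      finally have "E b - E a \<le> c / 2 * (\<Gamma> b - \<Gamma> a) + B * \<rho>\<^sup>2"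
        using ab False by simp
      moreover have \<rho>2: "\<rho>\<^sup>2 = (b - a) * (n b - n a)" unfolding \<rho>_def using nn by simp
      have "B * \<rho>\<^sup>2 = (b - a) * (B * n b - B * n a)" unfolding \<rho>2 by (simp add: algebra_simps)
      ultimately show ?thesis by (simp add: right_diff_distrib)
    qed simp
  qed
  then show ?thesis unfolding E_def right_diff_distrib by linarith
qed

section \<open>Fubini's theorem and test functions of space and time\<close>

text \<open>The points are pairs of space and time, and the inner integral runs over space.\<close>

lemma Fubini_lebesgue:
  fixes f :: "real \<times> real \<Rightarrow> real"
  assumes "f absolutely_integrable_on UNIV"
  shows "(\<lambda>s. integral UNIV (\<lambda>y. f (y, s))) absolutely_integrable_on UNIV"
    and "integral UNIV f = integral UNIV (\<lambda>s. integral UNIV (\<lambda>y. f (y, s)))"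
    and "negligible {s. \<not> (\<lambda>y. f (y, s)) absolutely_integrable_on UNIV}"
proof -
  obtain g where g: "g \<in> borel_measurable borel" "integrable lborel g" "AE x in lborel. indicator UNIV x * f x = g x"
    using ex_borel_version[OF assms] by blast
  have gp: "integrable (lborel \<Otimes>\<^sub>M lborel) (\<lambda>(y, s). g (y, s))"
    using g(2) by (simp add: lborel_prod)
  have "AE x in lborel \<Otimes>\<^sub>M lborel. f x = g x"
    using g(3) by (subst lborel_prod) simp
  then obtain N where N: "N \<in> null_sets (lborel \<Otimes>\<^sub>M lborel)" "{x \<in> space (lborel \<Otimes>\<^sub>M lborel). f x \<noteq> g x} \<subseteq> N"
    by (auto simp: eventually_ae_filter)
  have Nm: "N \<in> sets (lborel \<Otimes>\<^sub>M lborel)" using N by auto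
  have "AE y in lborel. AE s in lborel. (y, s) \<notin> N"
    by (rule lborel_pair.AE_pair[OF AE_not_in[OF N(1)]])
  moreover have "{x \<in> space (lborel \<Otimes>\<^sub>M lborel). (fst x, snd x) \<notin> N} \<in> sets (lborel \<Otimes>\<^sub>M lborel)"
  proof -
    have "{x \<in> space (lborel \<Otimes>\<^sub>M lborel). (fst x, snd x) \<notin> N} = space (lborel \<Otimes>\<^sub>M lborel) - N" by auto
    then show ?thesis using sets.compl_sets[OF Nm] by metis
  qed
  ultimately have "AE s in lborel. AE y in lborel. (y, s) \<notin> N"
    using lborel_pair.AE_commute[of "\<lambda>y s. (y, s) \<notin> N"] by simp
  moreover have "AE s in lborel. integrable lborel (\<lambda>y. g (y, s))"
    by (rule lborel_pair.AE_integrable_snd[OF gp])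
  ultimately have ae: "AE s in lborel. integrable lborel (\<lambda>y. g (y, s)) \<and> negligible {y. f (y, s) \<noteq> g (y, s)}"
  proof eventually_elim
    case (elim s)
    have "negligible {y. \<not> (y, s) \<notin> N}" by (rule AE_lborel_imp_negligible[OF elim(1)])
    moreover have "{y. f (y, s) \<noteq> g (y, s)} \<subseteq> {y. \<not> (y, s) \<notin> N}"
      using N(2) by (auto simp: space_pair_measure)
    ultimately show ?case using elim(2) negligible_subset by blast
  qed
  have abs: "u absolutely_integrable_on UNIV" "integral UNIV u = (LBINT x. u x)" 
    if "integrable lborel u" for u :: "'b::euclidean_space \<Rightarrow> real"
  proof -
    have "integrable lebesgue u" using that by (simp add: integrable_completion)
    then show "u absolutely_integrable_on UNIV" by (simp add: set_integrable_def)
    show "integral UNIV u = (LBINT x. u x)" using that by (rule integral_lborel)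
  qed
  have good: "(\<lambda>y. f (y, s)) absolutely_integrable_on UNIV \<and> integral UNIV (\<lambda>y. f (y, s)) = (LBINT y. g (y, s))"
    if "integrable lborel (\<lambda>y. g (y, s)) \<and> negligible {y. f (y, s) \<noteq> g (y, s)}" for s
  proof
    have i: "integrable lborel (\<lambda>y. g (y, s))" and n: "negligible {y. f (y, s) \<noteq> g (y, s)}"
      using that by auto
    show "(\<lambda>y. f (y, s)) absolutely_integrable_on UNIV"
      by (rule absolutely_integrable_spike[OF abs(1)[OF i] n]) auto
    have "integral UNIV (\<lambda>y. f (y, s)) = integral UNIV (\<lambda>y. g (y, s))"
      by (rule integral_spike[OF n]) auto
    then show "integral UNIV (\<lambda>y. f (y, s)) = (LBINT y. g (y, s))"
      using abs(2)[OF i] by simp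
  qed
  have neg: "negligible {s. \<not> (integrable lborel (\<lambda>y. g (y, s)) \<and> negligible {y. f (y, s) \<noteq> g (y, s)})}"
    by (rule AE_lborel_imp_negligible[OF ae])
  show "negligible {s. \<not> (\<lambda>y. f (y, s)) absolutely_integrable_on UNIV}"
    by (rule negligible_subset[OF neg]) (use good in blast)
  have si: "integrable lborel (\<lambda>s. LBINT y. g (y, s))"
    by (rule lborel_pair.integrable_snd[OF gp])
  show "(\<lambda>s. integral UNIV (\<lambda>y. f (y, s))) absolutely_integrable_on UNIV"
    by (rule absolutely_integrable_spike[OF abs(1)[OF si] neg]) (use good in blast)
  have "integral UNIV f = integral UNIV g"
    by (rule integral_spike[OF AE_lborel_imp_negligible[OF g(3)]]) auto
  also have "\<dots> = (LBINT x. g x)" by (rule abs(2)[OF g(2)])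
  also have "\<dots> = (LBINT s. LBINT y. g (y, s))"
    using lborel_pair.integral_snd[OF gp] by (simp add: lborel_prod)
  also have "\<dots> = integral UNIV (\<lambda>s. LBINT y. g (y, s))" by (rule abs(2)[OF si, symmetric])
  also have "\<dots> = integral UNIV (\<lambda>s. integral UNIV (\<lambda>y. f (y, s)))"
    by (rule integral_spike[OF neg]) (use good in blast)
  finally show "integral UNIV f = integral UNIV (\<lambda>s. integral UNIV (\<lambda>y. f (y, s)))" .
qed

text \<open>For a function that is continuous up to the boundary the increments are determined at all times,
  not only almost everywhere.\<close>

lemma weak_deriv_continuous_increment:
  fixes F :: "real \<Rightarrow> real"
  assumes p: "continuous_on {0..t} p" and w: "weak_deriv {0<..<t} [1] p F"
    and F: "F absolutely_integrable_on {0..t}" and t: "t > 0" and ab: "0 \<le> a" "a \<le> b" "b \<le> t"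
  shows "p b - p a = integral {a..b} F"
proof -
  obtain c where "negligible {x \<in> {0<..<t}. p x \<noteq> c + integral {0..x} F}"
    using weak_deriv_imp_primitive[OF w F t] by blast
  then have e: "p s = c + integral {0..s} F" if "s \<in> {0..t}" for s
    using continuous_AE_eq_imp_eq[OF p primitive_continuous[OF F] _ t that] by blast
  have "F integrable_on {0..b}"
    using F ab by (auto simp: absolutely_integrable_on_def intro: integrable_on_subinterval)
  then have "integral {0..b} F = integral {0..a} F + integral {a..b} F"
    using Henstock_Kurzweil_Integration.integral_combine[of 0 a b F] ab by simp
  then show ?thesis using e[of a] e[of b] ab by simp
qed

text \<open>Test functions of the form \<open>\<phi>(y) \<psi>(s)\<close> turn the distributional mixed derivative into a weak derivative
  in time of integrals over space.\<close>

lemma tensor_has_derivative: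
  fixes \<phi> \<psi> :: "real \<Rightarrow> real"
  assumes "smooth \<phi>" "smooth \<psi>"
  shows "((\<lambda>(y, s). \<phi> y * \<psi> s) has_derivative
    (\<lambda>(u, v). iter_partial [1] \<phi> (fst x) * u * \<psi> (snd x) + \<phi> (fst x) * (iter_partial [1] \<psi> (snd x) * v))) (at x)"
proof -
  have "((\<lambda>z. \<phi> (fst z)) has_derivative (\<lambda>h. iter_partial [1] \<phi> (fst x) * fst h)) (at x)"
  proof -
    have "(\<phi> has_derivative (\<lambda>h. iter_partial [1] \<phi> (fst x) * h)) (at (fst x))"
      using smooth_derivative(2)[OF assms(1), of "fst x"] by (simp add: has_field_derivative_def)
    from has_derivative_compose[OF bounded_linear_imp_has_derivative[OF bounded_linear_fst] this]
    show ?thesis .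
  qed
  moreover have "((\<lambda>z. \<psi> (snd z)) has_derivative (\<lambda>h. iter_partial [1] \<psi> (snd x) * snd h)) (at x)"
  proof -
    have "(\<psi> has_derivative (\<lambda>h. iter_partial [1] \<psi> (snd x) * h)) (at (snd x))"
      using smooth_derivative(2)[OF assms(2), of "snd x"] by (simp add: has_field_derivative_def)
    from has_derivative_compose[OF bounded_linear_imp_has_derivative[OF bounded_linear_snd] this]
    show ?thesis .
  qed
  ultimately have "((\<lambda>z. \<phi> (fst z) * \<psi> (snd z)) has_derivative
      (\<lambda>h. \<phi> (fst x) * (iter_partial [1] \<psi> (snd x) * snd h) + iter_partial [1] \<phi> (fst x) * fst h * \<psi> (snd x))) (at x)"
    by (rule has_derivative_mult)
  then show ?thesis by (simp add: case_prod_unfold add.commute)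
qed

lemma tensor_iter_partial:
  fixes \<phi> \<psi> :: "real \<Rightarrow> real"
  assumes "smooth \<phi>" "smooth \<psi>"
  shows "iter_partial [(1, 0)] (\<lambda>(y, s). \<phi> y * \<psi> s) = (\<lambda>(y, s). iter_partial [1] \<phi> y * \<psi> s)"
    and "iter_partial [(0, 1)] (\<lambda>(y, s). \<phi> y * \<psi> s) = (\<lambda>(y, s). \<phi> y * iter_partial [1] \<psi> s)"
proof -
  have "frechet_derivative (\<lambda>(y, s). \<phi> y * \<psi> s) (at x) =
    (\<lambda>(u, v). iter_partial [1] \<phi> (fst x) * u * \<psi> (snd x) + \<phi> (fst x) * (iter_partial [1] \<psi> (snd x) * v))" for x
    by (rule frechet_derivative_at[symmetric]) (rule tensor_has_derivative[OF assms])
  then show "iter_partial [(1, 0)] (\<lambda>(y, s). \<phi> y * \<psi> s) = (\<lambda>(y, s). iter_partial [1] \<phi> y * \<psi> s)"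
    "iter_partial [(0, 1)] (\<lambda>(y, s). \<phi> y * \<psi> s) = (\<lambda>(y, s). \<phi> y * iter_partial [1] \<psi> s)"
    by (simp_all add: iter_partial_def[of "[(1, 0)]"] iter_partial_def[of "[(0, 1)]"] fun_eq_iff)
qed

lemma tensor_smooth:
  fixes \<phi> \<psi> :: "real \<Rightarrow> real"
  assumes "smooth \<phi>" "smooth \<psi>"
  shows "smooth (\<lambda>(y, s). \<phi> y * \<psi> s)"
proof -
  have ex: "\<exists>\<phi>' \<psi>'. smooth \<phi>' \<and> smooth \<psi>' \<and> iter_partial bs (\<lambda>(y, s). \<phi> y * \<psi> s) = (\<lambda>(y, s). \<phi>' y * \<psi>' s)"
    if "set bs \<subseteq> Basis" for bs
    using that
  proof (induction bs)
    case Nil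
    then show ?case using assms by (auto simp: iter_partial_def)
  next
    case (Cons b bs)
    then obtain \<phi>' \<psi>' where s: "smooth \<phi>'" "smooth \<psi>'"
      and i: "iter_partial bs (\<lambda>(y, s). \<phi> y * \<psi> s) = (\<lambda>(y, s). \<phi>' y * \<psi>' s)"
      by auto
    have e: "iter_partial (b # bs) (\<lambda>(y, s). \<phi> y * \<psi> s) = iter_partial [b] (\<lambda>(y, s). \<phi>' y * \<psi>' s)"
      using iter_partial_append[of "[b]" bs] by (simp add: i)
    have "b = (1, 0) \<or> b = (0, 1)" using Cons.prems by (auto simp: Basis_prod_def)
    then show ?case
    proof
      assume "b = (1, 0)"
      then have f: "iter_partial (b # bs) (\<lambda>(y, s). \<phi> y * \<psi> s) = (\<lambda>(y, s). iter_partial [1] \<phi>' y * \<psi>' s)"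
        unfolding e using tensor_iter_partial(1)[OF s] by simp
      show ?case
        by (rule exI, rule exI, rule conjI[OF smooth_derivative(1)[OF s(1)] conjI[OF s(2) f]])
    next
      assume "b = (0, 1)"
      then have f: "iter_partial (b # bs) (\<lambda>(y, s). \<phi> y * \<psi> s) = (\<lambda>(y, s). \<phi>' y * iter_partial [1] \<psi>' s)"
        unfolding e using tensor_iter_partial(2)[OF s] by simp
      show ?case
        by (rule exI, rule exI, rule conjI[OF s(1) conjI[OF smooth_derivative(1)[OF s(2)] f]])
    qed
  qed
  show ?thesis
    unfolding smooth_def
  proof (intro allI impI)
    fix bs and x :: "real \<times> real"
    assume "set bs \<subseteq> (Basis :: (real \<times> real) set)"
    from ex[OF this] obtain \<phi>' \<psi>' where s: "smooth \<phi>'" "smooth \<psi>'"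
      and e: "iter_partial bs (\<lambda>(y, s). \<phi> y * \<psi> s) = (\<lambda>(y, s). \<phi>' y * \<psi>' s)"
      by (elim exE conjE)
    show "iter_partial bs (\<lambda>(y, s). \<phi> y * \<psi> s) differentiable (at x)"
      unfolding e by (rule differentiableI[OF tensor_has_derivative[OF s]])
  qed
qed

lemma tensor_test_function:
  assumes \<phi>: "\<phi> \<in> test_functions {0<..<A::real}" and \<psi>: "\<psi> \<in> test_functions {0<..<t::real}" and "A > 0" "t > 0"
  shows "(\<lambda>(y, s). \<phi> y * \<psi> s) \<in> test_functions ({0<..<A} \<times> {0<..<t})"
proof -
  obtain a b where ab: "0 < a" "a < b" "b < A" "\<And>x. x \<notin> {a<..<b} \<Longrightarrow> \<phi> x = 0"
    using test_functionE[OF \<phi> \<open>A > 0\<close>] by blast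
  obtain c d where cd: "0 < c" "c < d" "d < t" "\<And>x. x \<notin> {c<..<d} \<Longrightarrow> \<psi> x = 0"
    using test_functionE[OF \<psi> \<open>t > 0\<close>] by blast
  let ?f = "\<lambda>(y, s). \<phi> y * \<psi> s"
  have "{x. ?f x \<noteq> 0} \<subseteq> {a..b} \<times> {c..d}"
    using ab(4) cd(4) by fastforce
  then have c: "closure {x. ?f x \<noteq> 0} \<subseteq> {a..b} \<times> {c..d}"
    by (rule closure_minimal) (intro closed_Times closed_atLeastAtMost)
  moreover have "bounded ({a..b} \<times> {c..d})" by (intro bounded_Times bounded_closed_interval)
  ultimately have "compact (closure {x. ?f x \<noteq> 0})"
    by (simp only: compact_eq_bounded_closed) (meson bounded_subset closed_closure)
  moreover have "smooth ?f"
    using \<phi> \<psi> by (intro tensor_smooth) (simp_all add: test_functions_iff)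
  moreover have "{a..b} \<times> {c..d} \<subseteq> {0<..<A} \<times> {0<..<t}" using ab cd by auto
  ultimately show ?thesis using c unfolding test_functions_iff by blast
qed

lemma L2_pairing_continuous:
  fixes l :: "real \<Rightarrow> real \<Rightarrow> real"
  assumes "A > 0" and l: "\<And>s. 0 \<le> s \<Longrightarrow> l s \<in> L2 {0<..<A}"
    and cont: "\<And>s. 0 \<le> s \<Longrightarrow> ((\<lambda>r. L2_norm {0<..<A} (\<lambda>y. l r y - l s y)) \<longlongrightarrow> 0) (at s within {0..})"
    and f: "continuous_on {0..A} f"
  shows "continuous_on {0..t} (\<lambda>s. integral {0..A} (\<lambda>y. l s y * f y))"
  unfolding continuous_on_def
proof
  fix s assume s: "s \<in> {0..t}"
  let ?P = "\<lambda>s. integral {0..A} (\<lambda>y. l s y * f y)"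
  have "bounded (f ` {0..A})" using f by (intro compact_imp_bounded compact_continuous_image) auto
  then obtain M where M: "\<And>y. y \<in> {0..A} \<Longrightarrow> \<bar>f y\<bar> \<le> M"
    unfolding bounded_iff real_norm_def by blast
  have M0: "0 \<le> M" using M[of 0] \<open>A > 0\<close> by fastforce
  have fL: "f \<in> L2 {0<..<A}"
    unfolding L2_Ioo_iff by (intro conjI continuous_absolutely_integrable continuous_intros f)
  have est: "\<bar>?P r - ?P s\<bar> \<le> M * sqrt A * L2_norm {0<..<A} (\<lambda>y. l r y - l s y)" if r: "0 \<le> r" for r
  proof -
    let ?d = "\<lambda>y. l r y - l s y"
    have ls: "l r \<in> L2 {0<..<A}" "l s \<in> L2 {0<..<A}" using l r s by auto
    have "(\<lambda>y. l r y * l r y) absolutely_integrable_on {0..A}" "(\<lambda>y. l r y * l s y) absolutely_integrable_on {0..A}"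
      "(\<lambda>y. l s y * l s y) absolutely_integrable_on {0..A}"
      by (intro L2_mult_absolutely_integrable ls)+
    then have "(\<lambda>y. l r y * l r y - 2 * (l r y * l s y) + l s y * l s y) absolutely_integrable_on {0..A}"
      by (intro set_integral_add(1) set_integral_diff(1) set_integrable_mult_right) auto
    then have d2: "(\<lambda>y. (?d y)\<^sup>2) absolutely_integrable_on {0..A}"
      by (simp add: power2_eq_square algebra_simps)
    have d1: "?d absolutely_integrable_on {0..A}"
      using ls by (auto simp: L2_Ioo_iff)
    have dL: "?d \<in> L2 {0<..<A}" using d1 d2 by (simp add: L2_Ioo_iff)
    have i: "(\<lambda>y. l r y * f y) integrable_on {0..A}" "(\<lambda>y. l s y * f y) integrable_on {0..A}"
      "(\<lambda>y. ?d y * f y) integrable_on {0..A}"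
      using L2_mult_absolutely_integrable[OF ls(1) fL] L2_mult_absolutely_integrable[OF ls(2) fL]
        L2_mult_absolutely_integrable[OF dL fL] by (auto simp: absolutely_integrable_on_def)
    have "?P r - ?P s = integral {0..A} (\<lambda>y. l r y * f y - l s y * f y)"
      by (rule integral_diff[OF i(1,2), symmetric])
    also have "\<dots> = integral {0..A} (\<lambda>y. ?d y * f y)" by (simp add: left_diff_distrib)
    finally have "\<bar>?P r - ?P s\<bar> = norm (integral {0..A} (\<lambda>y. ?d y * f y))" by simp
    also have "\<dots> \<le> integral {0..A} (\<lambda>y. M * \<bar>?d y\<bar>)"
    proof (rule integral_norm_bound_integral[OF i(3)])
      show "(\<lambda>y. M * \<bar>?d y\<bar>) integrable_on {0..A}"
        using d1 by (intro integrable_on_mult_right) (simp add: absolutely_integrable_on_def)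
      show "norm (?d y * f y) \<le> M * \<bar>?d y\<bar>" if "y \<in> {0..A}" for y
        using mult_left_mono[OF M[OF that], of "\<bar>?d y\<bar>"] by (simp add: abs_mult mult.commute)
    qed
    also have "\<dots> = M * integral {0..A} (\<lambda>y. \<bar>?d y\<bar>)" by simp
    also have "\<dots> \<le> M * (sqrt A * L2_norm {0<..<A} ?d)"
    proof (rule mult_left_mono[OF _ M0])
      have "(integral {0..A} (\<lambda>y. \<bar>?d y\<bar>))\<^sup>2 \<le> A * integral {0..A} (\<lambda>y. (?d y)\<^sup>2)"
        using abs_integral_square[OF dL, of 0 A] \<open>A > 0\<close> by simp
      then have "sqrt ((integral {0..A} (\<lambda>y. \<bar>?d y\<bar>))\<^sup>2) \<le> sqrt (A * integral {0..A} (\<lambda>y. (?d y)\<^sup>2))"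
        by (rule real_sqrt_le_mono)
      then show "integral {0..A} (\<lambda>y. \<bar>?d y\<bar>) \<le> sqrt A * L2_norm {0<..<A} ?d"
        unfolding L2_norm_eq[OF dL] by (simp add: real_sqrt_mult)
    qed
    finally show ?thesis by (simp add: mult.assoc)
  qed
  have "((\<lambda>r. ?P r - ?P s) \<longlongrightarrow> 0) (at s within {0..})"
  proof (rule Lim_null_comparison)
    show "eventually (\<lambda>r. norm (?P r - ?P s) \<le> M * sqrt A * L2_norm {0<..<A} (\<lambda>y. l r y - l s y)) (at s within {0..})"
      unfolding eventually_at_filter using est by (auto intro!: always_eventually)
    show "((\<lambda>r. M * sqrt A * L2_norm {0<..<A} (\<lambda>y. l r y - l s y)) \<longlongrightarrow> 0) (at s within {0..})"
      using tendsto_mult_right_zero[OF cont, of s "M * sqrt A"] s by simp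
  qed
  then have "(?P \<longlongrightarrow> ?P s) (at s within {0..})" by (simp add: LIM_zero_iff)
  then show "(?P \<longlongrightarrow> ?P s) (at s within {0..t})"
    by (rule tendsto_within_subset) auto
qed

section \<open>The mixed derivative\<close>

lemma integrable_lborel_imp_absolutely_integrable:
  fixes u :: "'b::euclidean_space \<Rightarrow> real"
  assumes "integrable lborel u"
  shows "u absolutely_integrable_on UNIV"
  using assms by (simp add: set_integrable_def integrable_completion)

lemma Fubini_swap:
  fixes f :: "real \<times> real \<Rightarrow> real"
  assumes "integrable lborel f"
  shows "(\<lambda>y. integral UNIV (\<lambda>s. f (y, s))) absolutely_integrable_on UNIV"
    and "integral UNIV (\<lambda>y. integral UNIV (\<lambda>s. f (y, s))) = integral UNIV (\<lambda>s. integral UNIV (\<lambda>y. f (y, s)))"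
    and "negligible {y. \<not> (\<lambda>s. f (y, s)) absolutely_integrable_on UNIV}"
proof -
  have fp: "integrable (lborel \<Otimes>\<^sub>M lborel) f" using assms by (subst lborel_prod)
  define f' where "f' = (\<lambda>(s, y). f (y, s))"
  have "integrable (lborel \<Otimes>\<^sub>M lborel) f'"
    unfolding f'_def by (rule lborel_pair.integrable_product_swap[OF fp])
  then have f': "integrable lborel f'" by (subst (asm) lborel_prod)
  have m: "f \<in> borel_measurable (lborel \<Otimes>\<^sub>M lborel)" using fp by (rule borel_measurable_integrable)
  have eq: "(LBINT x. f' x) = (LBINT x. f x)"
    using lborel_pair.integral_product_swap[OF m] by (simp only: f'_def lborel_prod)
  note F = Fubini_lebesgue[OF integrable_lborel_imp_absolutely_integrable[OF f']]
  show "(\<lambda>y. integral UNIV (\<lambda>s. f (y, s))) absolutely_integrable_on UNIV"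
    using F(1) by (simp add: f'_def)
  show "negligible {y. \<not> (\<lambda>s. f (y, s)) absolutely_integrable_on UNIV}"
    using F(3) by (simp add: f'_def)
  have "integral UNIV (\<lambda>y. integral UNIV (\<lambda>s. f (y, s))) = integral UNIV f'"
    using F(2) by (simp add: f'_def)
  also have "\<dots> = integral UNIV f"
    unfolding integral_lborel[OF f'] integral_lborel[OF assms] by (rule eq)
  also have "\<dots> = integral UNIV (\<lambda>s. integral UNIV (\<lambda>y. f (y, s)))"
    by (rule Fubini_lebesgue(2)[OF integrable_lborel_imp_absolutely_integrable[OF assms]])
  finally show "integral UNIV (\<lambda>y. integral UNIV (\<lambda>s. f (y, s))) = integral UNIV (\<lambda>s. integral UNIV (\<lambda>y. f (y, s)))" .
qed

lemma integral_indicator_Icc: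
  fixes f :: "real \<Rightarrow> real"
  shows "integral UNIV (\<lambda>s. indicator S s * f s) = integral S f"
proof -
  have "(\<lambda>s. indicator S s * f s) = (\<lambda>s. if s \<in> S then f s else 0)" by (auto simp: indicator_def)
  then show ?thesis by (simp add: integral_restrict_UNIV)
qed

lemma integrable_lborel_mult_bounded:
  fixes f b :: "'a::euclidean_space \<Rightarrow> real"
  assumes "integrable lborel f" "b \<in> borel_measurable borel" "\<And>x. \<bar>b x\<bar> \<le> M"
  shows "integrable lborel (\<lambda>x. b x * f x)"
proof (rule Bochner_Integration.integrable_bound)
  show "integrable lborel (\<lambda>x. M * f x)" using assms(1) by simp
  show "(\<lambda>x. b x * f x) \<in> borel_measurable lborel"
    using assms(1,2) by (intro borel_measurable_times) (auto dest: borel_measurable_integrable)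
  have "norm (b x * f x) \<le> norm (M * f x)" for x
    using assms(3)[of x] by (simp add: abs_mult mult_right_mono)
  then show "AE x in lborel. norm (b x * f x) \<le> norm (M * f x)" by simp
qed

lemma test_function_bounded:
  assumes "\<phi> \<in> test_functions {0<..<A::real}" "A > 0"
  obtains M where "\<And>x. \<bar>\<phi> x\<bar> \<le> M"
proof -
  obtain a b where ab: "0 < a" "a < b" "b < A" "\<And>x. x \<notin> {a<..<b} \<Longrightarrow> \<phi> x = 0"
    using test_functionE[OF assms] by blast
  have "smooth \<phi>" using assms by (simp add: test_functions_iff)
  then have "bounded (\<phi> ` {a..b})"
    by (intro compact_imp_bounded compact_continuous_image smooth_continuous) auto
  then obtain M where M: "\<And>y. y \<in> {a..b} \<Longrightarrow> \<bar>\<phi> y\<bar> \<le> M"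
    unfolding bounded_iff real_norm_def by blast
  show thesis
  proof (rule that[of "\<bar>M\<bar>"])
    fix x
    show "\<bar>\<phi> x\<bar> \<le> \<bar>M\<bar>"
      using M[of x] ab(4)[of x] by (cases "x \<in> {a..b}") force+
  qed
qed

text \<open>Cauchy-Schwarz in time for almost every \<open>y\<close>, followed by an integration over \<open>y\<close>.\<close>

lemma slice_increment:
  fixes G :: "real \<times> real \<Rightarrow> real"
  assumes G: "integrable lborel G" and G2: "integrable lborel (\<lambda>x. (G x)\<^sup>2)" and ab: "a \<le> b"
  defines "H \<equiv> \<lambda>y. integral {a..b} (\<lambda>s. G (y, s))"
  shows "H absolutely_integrable_on UNIV" "(\<lambda>y. (H y)\<^sup>2) absolutely_integrable_on UNIV"
    "integral UNIV (\<lambda>y. (H y)\<^sup>2) \<le> (b - a) * integral {a..b} (\<lambda>s. integral UNIV (\<lambda>y. (G (y, s))\<^sup>2))"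
proof -
  define \<kappa> :: "real \<times> real \<Rightarrow> real" where "\<kappa> x = indicator {a..b} (snd x)" for x
  have "\<kappa> \<in> borel_measurable (borel \<Otimes>\<^sub>M borel)"
    unfolding \<kappa>_def[abs_def] by measurable
  then have \<kappa>m: "\<kappa> \<in> borel_measurable borel" by (simp add: borel_prod)
  have \<kappa>1: "\<bar>\<kappa> x\<bar> \<le> 1" for x by (simp add: \<kappa>_def indicator_def)
  have i1: "integrable lborel (\<lambda>x. \<kappa> x * G x)" and i2: "integrable lborel (\<lambda>x. \<kappa> x * (G x)\<^sup>2)"
    by (rule integrable_lborel_mult_bounded[OF G \<kappa>m \<kappa>1] integrable_lborel_mult_bounded[OF G2 \<kappa>m \<kappa>1])+
  define S where "S y = integral {a..b} (\<lambda>s. (G (y, s))\<^sup>2)" for y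
  have H: "H y = integral UNIV (\<lambda>s. \<kappa> (y, s) * G (y, s))" for y
    by (simp add: H_def \<kappa>_def integral_indicator_Icc)
  have S: "S y = integral UNIV (\<lambda>s. \<kappa> (y, s) * (G (y, s))\<^sup>2)" for y
    by (simp add: S_def \<kappa>_def integral_indicator_Icc)
  show Ha: "H absolutely_integrable_on UNIV"
    using Fubini_swap(1)[OF i1] by (simp add: H[abs_def])
  have Sa: "S absolutely_integrable_on UNIV"
    using Fubini_swap(1)[OF i2] by (simp add: S[abs_def])
  have "integral UNIV S = integral UNIV (\<lambda>s. integral UNIV (\<lambda>y. \<kappa> (y, s) * (G (y, s))\<^sup>2))"
    using Fubini_swap(2)[OF i2] by (simp add: S[abs_def])
  also have "\<dots> = integral UNIV (\<lambda>s. indicator {a..b} s * integral UNIV (\<lambda>y. (G (y, s))\<^sup>2))"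
    by (simp add: \<kappa>_def)
  finally have Si: "integral UNIV S = integral {a..b} (\<lambda>s. integral UNIV (\<lambda>y. (G (y, s))\<^sup>2))"
    by (simp add: integral_indicator_Icc)
  have n: "negligible ({y. \<not> (\<lambda>s. G (y, s)) absolutely_integrable_on UNIV} \<union>
      {y. \<not> (\<lambda>s. (G (y, s))\<^sup>2) absolutely_integrable_on UNIV})"
    by (intro negligible_Un Fubini_swap(3)[OF G] Fubini_swap(3)[OF G2])
  have cs: "(H y)\<^sup>2 \<le> (b - a) * S y"
    if "(\<lambda>s. G (y, s)) absolutely_integrable_on UNIV" "(\<lambda>s. (G (y, s))\<^sup>2) absolutely_integrable_on UNIV" for y
    unfolding H_def S_def
  proof (rule integrable_cauchy_schwarz)
    show "(\<lambda>s. G (y, s)) integrable_on {a..b}" "(\<lambda>s. (G (y, s))\<^sup>2) integrable_on {a..b}"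
      using that integrable_on_subinterval[of _ UNIV a b] by (auto simp: absolutely_integrable_on_def)
  qed (rule ab)
  \<comment> \<open>Agrees almost everywhere with \<open>(b - a) S\<close>, but bounds \<open>H\<^sup>2\<close> everywhere.\<close>
  define T where "T y = (if (H y)\<^sup>2 \<le> (b - a) * S y then (b - a) * S y else (H y)\<^sup>2)" for y
  have "(\<lambda>y. (b - a) * S y) absolutely_integrable_on UNIV"
    using Sa by (rule set_integrable_mult_right) 
  then have Ta: "T absolutely_integrable_on UNIV"
    by (rule absolutely_integrable_spike[OF _ n]) (use cs in \<open>auto simp: T_def\<close>)
  have Ti: "integral UNIV T = (b - a) * integral UNIV S"
  proof -
    have "integral UNIV T = integral UNIV (\<lambda>y. (b - a) * S y)"
      by (rule integral_spike[OF n]) (use cs in \<open>auto simp: T_def\<close>)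
    then show ?thesis by simp
  qed
  have HT: "(H y)\<^sup>2 \<le> T y" for y by (simp add: T_def)
  show H2: "(\<lambda>y. (H y)\<^sup>2) absolutely_integrable_on UNIV"
  proof (rule measurable_bounded_by_integrable_imp_absolutely_integrable)
    have "H \<in> borel_measurable lebesgue"
      using Ha by (simp add: set_integrable_def borel_measurable_integrable)
    then show "(\<lambda>x. (H x)\<^sup>2) \<in> borel_measurable (lebesgue_on UNIV)"
      unfolding lebesgue_on_UNIV_eq by (rule borel_measurable_power)
    show "T integrable_on UNIV" using Ta by (simp add: absolutely_integrable_on_def)
  qed (use HT in auto)
  have "integral UNIV (\<lambda>y. (H y)\<^sup>2) \<le> integral UNIV T"
    by (rule integral_le) (use H2 Ta HT in \<open>auto simp: absolutely_integrable_on_def\<close>)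
  then show "integral UNIV (\<lambda>y. (H y)\<^sup>2) \<le> (b - a) * integral {a..b} (\<lambda>s. integral UNIV (\<lambda>y. (G (y, s))\<^sup>2))"
    by (simp add: Ti Si)
qed

lemma tensor_integrable:
  fixes u :: "real \<times> real \<Rightarrow> real"
  assumes u: "locally_integrable ({0<..<A} \<times> {0<..<t}) u" and "A > 0" "t > 0"
    and \<phi>: "\<phi> \<in> test_functions {0<..<A}" and \<psi>: "\<psi> \<in> test_functions {0<..<t}"
  shows "(\<lambda>(y, s). u (y, s) * (\<phi> y * \<psi> s)) absolutely_integrable_on ({0<..<A} \<times> {0<..<t})"
proof -
  obtain a b where ab: "0 < a" "a < b" "b < A" "\<And>x. x \<notin> {a<..<b} \<Longrightarrow> \<phi> x = 0"
    using test_functionE[OF \<phi> \<open>A > 0\<close>] by blast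
  obtain c d where cd: "0 < c" "c < d" "d < t" "\<And>x. x \<notin> {c<..<d} \<Longrightarrow> \<psi> x = 0"
    using test_functionE[OF \<psi> \<open>t > 0\<close>] by blast
  let ?K = "{a..b} \<times> {c..d}"
  have K: "compact ?K" "?K \<subseteq> {0<..<A} \<times> {0<..<t}" using ab cd by (auto intro: compact_Times)
  have Kl: "?K \<in> sets lebesgue" using K lmeasurable_compact by blast
  have "integrable (lebesgue_on ?K) u"
    using u K unfolding locally_integrable_def by blast
  then have uK: "u absolutely_integrable_on ?K" by (simp only: integrable_lebesgue_on_iff[OF Kl])
  have sm: "smooth \<phi>" "smooth \<psi>" using \<phi> \<psi> by (simp_all add: test_functions_iff)
  let ?\<Phi> = "\<lambda>(y, s). \<phi> y * \<psi> s"
  have "continuous_on ?K (\<lambda>x. \<phi> (fst x) * \<psi> (snd x))"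
    by (intro continuous_on_mult continuous_on_compose2[OF smooth_continuous[OF sm(1), of UNIV]]
       continuous_on_compose2[OF smooth_continuous[OF sm(2), of UNIV]] continuous_intros) auto
  then have c\<Phi>: "continuous_on ?K ?\<Phi>" by (simp add: case_prod_unfold)
  have "(\<lambda>x. ?\<Phi> x * u x) absolutely_integrable_on ?K"
    by (rule absolutely_integrable_bounded_measurable_product
        [OF bilinear_times continuous_imp_measurable_on_sets_lebesgue[OF c\<Phi> Kl] Kl
          compact_imp_bounded[OF compact_continuous_image[OF c\<Phi> K(1)]] uK])
  then have "(\<lambda>x. ?\<Phi> x * u x) absolutely_integrable_on ({0<..<A} \<times> {0<..<t})"
  proof (rule absolutely_integrable_spike_set)
    have "{x \<in> ?K - {0<..<A} \<times> {0<..<t}. ?\<Phi> x * u x \<noteq> 0} \<subseteq> {}" using K by blast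
    then show "negligible {x \<in> ?K - {0<..<A} \<times> {0<..<t}. ?\<Phi> x * u x \<noteq> 0}"
      by (rule negligible_subset[OF negligible_empty])
    have "{x \<in> {0<..<A} \<times> {0<..<t} - ?K. ?\<Phi> x * u x \<noteq> 0} \<subseteq> {}"
      using ab(4) cd(4) by fastforce
    then show "negligible {x \<in> {0<..<A} \<times> {0<..<t} - ?K. ?\<Phi> x * u x \<noteq> 0}"
      by (rule negligible_subset[OF negligible_empty])
  qed
  moreover have "(\<lambda>x. ?\<Phi> x * u x) = (\<lambda>(y, s). u (y, s) * (\<phi> y * \<psi> s))"
    by (auto simp: fun_eq_iff mult.commute)
  ultimately show ?thesis by simp
qed

lemma Fubini_rectangle:
  fixes f :: "real \<times> real \<Rightarrow> real"
  assumes "f absolutely_integrable_on (I \<times> J)"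
  shows "integral (I \<times> J) f = integral J (\<lambda>s. integral I (\<lambda>y. f (y, s)))"
    and "(\<lambda>s. integral I (\<lambda>y. f (y, s))) absolutely_integrable_on J"
    and "negligible {s \<in> J. \<not> (\<lambda>y. f (y, s)) absolutely_integrable_on I}"
proof -
  define F where "F x = (if x \<in> I \<times> J then f x else 0)" for x
  have F: "F absolutely_integrable_on UNIV"
  proof -
    have "(\<lambda>x. indicator (I \<times> J) x *\<^sub>R f x) = (\<lambda>x. indicator UNIV x *\<^sub>R F x)"
      by (auto simp: F_def indicator_def)
    then show ?thesis using assms unfolding set_integrable_def by metis
  qed
  have in_J: "integral UNIV (\<lambda>y. F (y, s)) = (if s \<in> J then integral I (\<lambda>y. f (y, s)) else 0)" for s
  proof (cases "s \<in> J")
    case True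
    then have "(\<lambda>y. F (y, s)) = (\<lambda>y. if y \<in> I then f (y, s) else 0)" by (auto simp: F_def)
    then show ?thesis using True by (simp add: integral_restrict_UNIV)
  next
    case False
    then show ?thesis by (simp add: F_def)
  qed
  have "integral (I \<times> J) f = integral UNIV F"
    unfolding F_def[abs_def] by (rule integral_restrict_UNIV[symmetric])
  also have "\<dots> = integral UNIV (\<lambda>s. if s \<in> J then integral I (\<lambda>y. f (y, s)) else 0)"
    using Fubini_lebesgue(2)[OF F] by (simp only: in_J)
  also have "\<dots> = integral J (\<lambda>s. integral I (\<lambda>y. f (y, s)))"
    by (rule integral_restrict_UNIV)
  finally show "integral (I \<times> J) f = integral J (\<lambda>s. integral I (\<lambda>y. f (y, s)))" .
  have "(\<lambda>s. if s \<in> J then integral I (\<lambda>y. f (y, s)) else 0) absolutely_integrable_on UNIV"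
    using Fubini_lebesgue(1)[OF F] by (simp only: in_J)
  moreover have "(\<lambda>s. indicator UNIV s *\<^sub>R (if s \<in> J then integral I (\<lambda>y. f (y, s)) else 0))
      = (\<lambda>s. indicator J s *\<^sub>R integral I (\<lambda>y. f (y, s)))"
    by (auto simp: indicator_def)
  ultimately show "(\<lambda>s. integral I (\<lambda>y. f (y, s))) absolutely_integrable_on J"
    unfolding set_integrable_def by metis
  show "negligible {s \<in> J. \<not> (\<lambda>y. f (y, s)) absolutely_integrable_on I}"
  proof (rule negligible_subset[OF Fubini_lebesgue(3)[OF F]], rule subsetI, rule CollectI, rule notI)
    fix s
    assume a: "s \<in> {s \<in> J. \<not> (\<lambda>y. f (y, s)) absolutely_integrable_on I}"
      and s2: "(\<lambda>y. F (y, s)) absolutely_integrable_on UNIV"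
    have "(\<lambda>y. indicator UNIV y *\<^sub>R F (y, s)) = (\<lambda>y. indicator I y *\<^sub>R f (y, s))"
      using a by (auto simp: F_def indicator_def)
    then have "(\<lambda>y. f (y, s)) absolutely_integrable_on I"
      using s2 unfolding set_integrable_def by metis
    then show False using a by simp
  qed
qed

lemma iter_partial_tensor_mixed:
  fixes \<phi> \<psi> :: "real \<Rightarrow> real"
  assumes "smooth \<phi>" "smooth \<psi>"
  shows "iter_partial [(1, 0), (0, 1)] (\<lambda>(y, s). \<phi> y * \<psi> s)
    = (\<lambda>(y, s). iter_partial [1] \<phi> y * iter_partial [1] \<psi> s)"
  using iter_partial_append[of "[(1, 0)]" "[(0, 1)]" "\<lambda>(y, s). \<phi> y * \<psi> s"]
    tensor_iter_partial(2)[OF assms] tensor_iter_partial(1)[OF assms(1) smooth_derivative(1)[OF assms(2)]]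
  by simp

text \<open>Read with \<open>\<psi>\<close> as the test function, this says that \<open>s \<mapsto> \<integral>l(s) \<phi>'\<close> has the weak derivative
  \<open>- \<integral>g(\<cdot>,s) \<phi>\<close>.\<close>

lemma mixed_deriv_slices:
  fixes l :: "real \<Rightarrow> real \<Rightarrow> real" and g :: "real \<times> real \<Rightarrow> real"
  assumes A: "A > 0" and t: "t > 0"
    and w: "weak_deriv ({0<..<A} \<times> {0<..<t}) [(1, 0), (0, 1)] (\<lambda>(y, s). l s y) g"
    and g: "g absolutely_integrable_on {0<..<A} \<times> {0<..<t}"
    and \<phi>: "\<phi> \<in> test_functions {0<..<A}" and \<psi>: "\<psi> \<in> test_functions {0<..<t}"
  shows "integral {0<..<t} (\<lambda>s. integral {0<..<A} (\<lambda>y. l s y * iter_partial [1] \<phi> y) * iter_partial [1] \<psi> s)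
    = integral {0<..<t} (\<lambda>s. integral {0<..<A} (\<lambda>y. g (y, s) * \<phi> y) * \<psi> s)"
proof -
  let ?Q = "{0<..<A} \<times> {0<..<t}"
  have Q: "?Q \<in> sets lebesgue" by (simp add: open_Times borel_open)
  have sm: "smooth \<phi>" "smooth \<psi>" using \<phi> \<psi> by (simp_all add: test_functions_iff)
  let ?\<phi>' = "iter_partial [1] \<phi>" and ?\<psi>' = "iter_partial [1] \<psi>"
  have loc: "locally_integrable ?Q (\<lambda>(y, s). l s y)" "locally_integrable ?Q g"
    using w by (simp_all only: weak_deriv_def)
  have a1: "(\<lambda>(y, s). l s y * (?\<phi>' y * ?\<psi>' s)) absolutely_integrable_on ?Q"
    using tensor_integrable[OF loc(1) A t test_function_deriv[OF \<phi> A] test_function_deriv[OF \<psi> t]]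
    by simp
  have a2: "(\<lambda>(y, s). g (y, s) * (\<phi> y * \<psi> s)) absolutely_integrable_on ?Q"
    by (rule tensor_integrable[OF loc(2) A t \<phi> \<psi>])
  have "(LINT x|lebesgue_on ?Q. (\<lambda>(y, s). l s y) x * iter_partial [(1, 0), (0, 1)] (\<lambda>(y, s). \<phi> y * \<psi> s) x)
      = (- 1) ^ length [(1::real, 0::real), (0, 1)] * (LINT x|lebesgue_on ?Q. g x * (\<lambda>(y, s). \<phi> y * \<psi> s) x)"
    using w tensor_test_function[OF \<phi> \<psi> A t] unfolding weak_deriv_def by blast
  then have "(LINT x|lebesgue_on ?Q. (\<lambda>(y, s). l s y * (?\<phi>' y * ?\<psi>' s)) x)
      = (LINT x|lebesgue_on ?Q. (\<lambda>(y, s). g (y, s) * (\<phi> y * \<psi> s)) x)"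
    unfolding iter_partial_tensor_mixed[OF sm] by (simp add: case_prod_unfold)
  then have "integral ?Q (\<lambda>(y, s). l s y * (?\<phi>' y * ?\<psi>' s)) = integral ?Q (\<lambda>(y, s). g (y, s) * (\<phi> y * \<psi> s))"
    unfolding LINT_lebesgue_on[OF Q a1] LINT_lebesgue_on[OF Q a2] .
  then show ?thesis
    unfolding Fubini_rectangle(1)[OF a1] Fubini_rectangle(1)[OF a2]
    by (simp add: mult.assoc[symmetric])
qed

lemma square_norm_slices:
  fixes g :: "real \<times> real \<Rightarrow> real"
  assumes g2: "(\<lambda>x. (g x)\<^sup>2) absolutely_integrable_on ({0<..<A} \<times> {0<..<t})"
  shows "(LINT s|lebesgue_on {0<..<t}. (L2_norm {0<..<A} (\<lambda>y. g (y, s)))\<^sup>2)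
    = integral {0<..<t} (\<lambda>s. integral {0<..<A} (\<lambda>y. (g (y, s))\<^sup>2))"
proof -
  note F = Fubini_rectangle[OF g2]
  have "(L2_norm {0<..<A} (\<lambda>y. g (y, s)))\<^sup>2 = integral {0<..<A} (\<lambda>y. (g (y, s))\<^sup>2)"
    if "(\<lambda>y. (g (y, s))\<^sup>2) absolutely_integrable_on {0<..<A}" for s
  proof -
    have "0 \<le> (LINT y|lebesgue_on {0<..<A}. (g (y, s))\<^sup>2)" by simp
    then have "(L2_norm {0<..<A} (\<lambda>y. g (y, s)))\<^sup>2 = (LINT y|lebesgue_on {0<..<A}. (g (y, s))\<^sup>2)"
      unfolding L2_norm_def by simp
    also have "\<dots> = integral {0<..<A} (\<lambda>y. (g (y, s))\<^sup>2)"
      by (rule LINT_lebesgue_on[OF _ that]) simp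
    finally show ?thesis .
  qed
  then have "{s \<in> {0<..<t}. (L2_norm {0<..<A} (\<lambda>y. g (y, s)))\<^sup>2 \<noteq> integral {0<..<A} (\<lambda>y. (g (y, s))\<^sup>2)}
      \<subseteq> {s \<in> {0<..<t}. \<not> (\<lambda>y. (g (y, s))\<^sup>2) absolutely_integrable_on {0<..<A}}" by blast
  then have "negligible {s \<in> {0<..<t}. (L2_norm {0<..<A} (\<lambda>y. g (y, s)))\<^sup>2 \<noteq> integral {0<..<A} (\<lambda>y. (g (y, s))\<^sup>2)}"
    by (rule negligible_subset[OF F(3)])
  then have "(LINT s|lebesgue_on {0<..<t}. (L2_norm {0<..<A} (\<lambda>y. g (y, s)))\<^sup>2)
    = (LINT s|lebesgue_on {0<..<t}. integral {0<..<A} (\<lambda>y. (g (y, s))\<^sup>2))"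
    by (intro LINT_AE_cong(2)) simp_all
  also have "\<dots> = integral {0<..<t} (\<lambda>s. integral {0<..<A} (\<lambda>y. (g (y, s))\<^sup>2))"
    by (rule LINT_lebesgue_on[OF _ F(2)]) simp
  finally show ?thesis .
qed

text \<open>Continuity of \<open>l\<close> with values in \<open>L\<^sup>2\<close> allows to integrate \<open>mixed_deriv_slices\<close> in time between any
  two times, the end points \<open>0\<close> and \<open>t\<close> included. After an exchange of the order of integration it states that the
  increment of \<open>l\<close> from \<open>a\<close> to \<open>b\<close> has the weak derivative \<open>H a b = \<integral>\<^sub>a\<^sup>b g(\<cdot>,s) ds\<close>. The function \<open>\<Gamma>\<close> is
  the integral of \<open>\<parallel>g(\<cdot>,s)\<parallel>\<^sup>2\<close> from \<open>0\<close>.\<close>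

lemma mixed_derivative_increment:
  fixes l :: "real \<Rightarrow> real \<Rightarrow> real" and g :: "real \<times> real \<Rightarrow> real"
  assumes A: "A > 0" and t: "t > 0"
    and l: "\<And>s. 0 \<le> s \<Longrightarrow> l s \<in> L2 {0<..<A}"
    and cont: "\<And>s. 0 \<le> s \<Longrightarrow> ((\<lambda>r. L2_norm {0<..<A} (\<lambda>y. l r y - l s y)) \<longlongrightarrow> 0) (at s within {0..})"
    and w: "weak_deriv ({0<..<A} \<times> {0<..<t}) [(1, 0), (0, 1)] (\<lambda>(y, s). l s y) g"
    and g: "g \<in> L2 ({0<..<A} \<times> {0<..<t})"
  obtains \<Gamma> :: "real \<Rightarrow> real" and H :: "real \<Rightarrow> real \<Rightarrow> real \<Rightarrow> real" where
    "\<Gamma> 0 = 0"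
    "\<Gamma> t = (LINT s|lebesgue_on {0<..<t}. (L2_norm {0<..<A} (\<lambda>y. g (y, s)))\<^sup>2)"
    "\<And>a b. 0 \<le> a \<Longrightarrow> a \<le> b \<Longrightarrow> b \<le> t \<Longrightarrow> \<Gamma> a \<le> \<Gamma> b"
    "\<And>a b. 0 \<le> a \<Longrightarrow> a \<le> b \<Longrightarrow> b \<le> t \<Longrightarrow> H a b \<in> L2 {0<..<A}"
    "\<And>a b. 0 \<le> a \<Longrightarrow> a \<le> b \<Longrightarrow> b \<le> t \<Longrightarrow> integral {0..A} (\<lambda>y. (H a b y)\<^sup>2) \<le> (b - a) * (\<Gamma> b - \<Gamma> a)"
    "\<And>a b. 0 \<le> a \<Longrightarrow> a \<le> b \<Longrightarrow> b \<le> t \<Longrightarrow> weak_deriv {0<..<A} [1] (\<lambda>y. l b y - l a y) (H a b)"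
proof -
  let ?I = "{0<..<A}" and ?J = "{0<..<t}"
  let ?Q = "?I \<times> ?J"
  have Qm: "?Q \<in> lmeasurable"
    by (rule lmeasurable_open) (auto intro: bounded_Times open_Times)
  have Q: "?Q \<in> sets lebesgue" using Qm by auto
  have ga: "g absolutely_integrable_on ?Q" and g2a: "(\<lambda>x. (g x)\<^sup>2) absolutely_integrable_on ?Q"
    using g by (simp_all add: L2_iff[OF Qm])
  have Qb: "?Q \<in> sets borel" by (intro borel_open open_Times open_greaterThanLessThan)
  obtain G0 where G0: "G0 \<in> borel_measurable borel" "integrable lborel G0" "AE x in lborel. indicator ?Q x * g x = G0 x"
    using ex_borel_version[OF ga] by blast
  \<comment> \<open>A Borel version of \<open>g\<close> that vanishes outside the rectangle, so that slices can be integrated over the whole line.\<close>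
  define G where "G x = indicator ?Q x * G0 x" for x
  have Gm: "G \<in> borel_measurable borel"
    unfolding G_def[abs_def] using G0(1) Qb by (intro borel_measurable_times borel_measurable_indicator)
  have G: "integrable lborel G"
    using integrable_mult_indicator[of ?Q lborel G0] G0(2) Qb by (simp add: G_def[abs_def])
  have Gae: "AE x in lborel. indicator ?Q x * g x = G x"
    using G0(3)
  proof eventually_elim
    case (elim x)
    then show ?case by (cases "x \<in> ?Q") (simp_all add: G_def)
  qed
  have G2: "integrable lborel (\<lambda>x. (G x)\<^sup>2)"
  proof -
    obtain G' where G': "G' \<in> borel_measurable borel" "integrable lborel G'" "AE x in lborel. indicator ?Q x * (g x)\<^sup>2 = G' x"
      using ex_borel_version[OF g2a] by blast
    have "AE x in lborel. G' x = (G x)\<^sup>2"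
      using G'(3) Gae
    proof eventually_elim
      case (elim x)
      then show ?case by (cases "x \<in> ?Q") simp_all
    qed
    moreover have "(\<lambda>x. (G x)\<^sup>2) \<in> borel_measurable lborel"
      using Gm by (intro borel_measurable_power) simp
    ultimately show ?thesis
      using G'(1,2) integrable_cong_AE[of G' lborel "\<lambda>x. (G x)\<^sup>2"] by simp
  qed
  have neg: "negligible {x. indicator ?Q x * g x \<noteq> G x}"
    by (rule AE_lborel_imp_negligible[OF Gae])
  have negQ: "negligible {x \<in> ?Q. g x \<noteq> G x}"
    by (rule negligible_subset[OF neg]) auto
  have wG: "weak_deriv ?Q [(1, 0), (0, 1)] (\<lambda>(y, s). l s y) G"
    by (rule weak_deriv_AE_cong[OF Q _ negQ w]) simp
  have Gabs: "G absolutely_integrable_on UNIV" and G2abs: "(\<lambda>x. (G x)\<^sup>2) absolutely_integrable_on UNIV"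
    by (intro integrable_lborel_imp_absolutely_integrable G G2)+
  have G0out: "G (y, s) = 0" if "y \<notin> ?I \<or> s \<notin> ?J" for y s
    using that by (auto simp: G_def)
  define K where "K s = integral UNIV (\<lambda>y. (G (y, s))\<^sup>2)" for s
  have K: "K absolutely_integrable_on UNIV"
    unfolding K_def[abs_def] using Fubini_lebesgue(1)[OF G2abs] by simp
  have Ki: "K integrable_on {a..b}" for a b
    using K integrable_on_subinterval[of K UNIV a b] by (simp add: absolutely_integrable_on_def)
  have K0: "0 \<le> K s" for s
    unfolding K_def by (cases "(\<lambda>y. (G (y, s))\<^sup>2) integrable_on UNIV")
      (auto intro: integral_nonneg simp: not_integrable_integral)
  define \<Gamma> where "\<Gamma> s = integral {0..s} K" for s
  define H where "H a b y = integral {a..b} (\<lambda>s. G (y, s))" for a b y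
  have \<Gamma>diff: "\<Gamma> b - \<Gamma> a = integral {a..b} K" if "0 \<le> a" "a \<le> b" for a b
    using Henstock_Kurzweil_Integration.integral_combine[OF that Ki] by (simp add: \<Gamma>_def)
  note sl = slice_increment[OF G G2]
  show thesis
  proof (rule that[of \<Gamma> H])
    show "\<Gamma> 0 = 0" by (simp add: \<Gamma>_def)
    have "integral ?J (\<lambda>s. integral ?I (\<lambda>y. (g (y, s))\<^sup>2)) = integral ?Q (\<lambda>x. (g x)\<^sup>2)"
      by (rule Fubini_rectangle(1)[OF g2a, symmetric])
    also have "\<dots> = integral ?Q (\<lambda>x. (G x)\<^sup>2)"
      by (rule integral_spike[OF negQ]) auto
    also have "\<dots> = integral ?J (\<lambda>s. integral ?I (\<lambda>y. (G (y, s))\<^sup>2))"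
      by (rule Fubini_rectangle(1)) (rule set_integrable_subset[OF G2abs Q], simp)
    also have "\<dots> = integral ?J K"
    proof (rule integral_cong)
      fix s
      have "integral ?I (\<lambda>y. (G (y, s))\<^sup>2) = integral UNIV (\<lambda>y. if y \<in> ?I then (G (y, s))\<^sup>2 else 0)"
        by (rule integral_restrict_UNIV[symmetric])
      also have "(\<lambda>y. if y \<in> ?I then (G (y, s))\<^sup>2 else 0) = (\<lambda>y. (G (y, s))\<^sup>2)"
        using G0out[of _ s] by (auto simp: fun_eq_iff)
      finally show "integral ?I (\<lambda>y. (G (y, s))\<^sup>2) = K s" by (simp add: K_def)
    qed
    also have "\<dots> = \<Gamma> t" unfolding \<Gamma>_def by (rule integral_open_interval_real[symmetric])
    finally show "\<Gamma> t = (LINT s|lebesgue_on ?J. (L2_norm ?I (\<lambda>y. g (y, s)))\<^sup>2)"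
      using square_norm_slices[OF g2a] by simp
  next
    fix a b :: real assume ab: "0 \<le> a" "a \<le> b" "b \<le> t"
    have "0 \<le> integral {a..b} K" using Ki K0 by (intro integral_nonneg) auto
    then show "\<Gamma> a \<le> \<Gamma> b" using \<Gamma>diff[OF ab(1,2)] by simp
    have Ha: "H a b absolutely_integrable_on UNIV" and H2: "(\<lambda>y. (H a b y)\<^sup>2) absolutely_integrable_on UNIV"
      using sl(1,2)[OF ab(2)] by (simp_all add: H_def[abs_def])
    show HL: "H a b \<in> L2 ?I"
      unfolding L2_Ioo_iff by (intro conjI set_integrable_subset[OF Ha] set_integrable_subset[OF H2]) auto
    have "integral {0..A} (\<lambda>y. (H a b y)\<^sup>2) \<le> integral UNIV (\<lambda>y. (H a b y)\<^sup>2)"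
      using H2 HL by (intro integral_subset_le) (auto simp: absolutely_integrable_on_def L2_Ioo_iff)
    also have "\<dots> \<le> (b - a) * integral {a..b} K"
      using sl(3)[OF ab(2)] by (simp add: H_def K_def[abs_def])
    finally show "integral {0..A} (\<lambda>y. (H a b y)\<^sup>2) \<le> (b - a) * (\<Gamma> b - \<Gamma> a)"
      unfolding \<Gamma>diff[OF ab(1,2)] .
    have la: "l a \<in> L2 ?I" "l b \<in> L2 ?I" using l ab by auto
    have lab: "(\<lambda>y. l b y - l a y) absolutely_integrable_on {0..A}"
      using la by (intro set_integral_diff(1)) (auto simp: L2_Ioo_iff)
    show "weak_deriv ?I [1] (\<lambda>y. l b y - l a y) (H a b)"
      unfolding weak_deriv_real_iff[OF A]
    proof (intro conjI ballI)
      show "locally_integrable ?I (\<lambda>y. l b y - l a y)" by (rule locally_integrable_of_integrable[OF lab])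
      show "locally_integrable ?I (H a b)"
        using HL by (intro locally_integrable_of_integrable) (simp add: L2_Ioo_iff)
      fix \<phi> :: "real \<Rightarrow> real" assume \<phi>: "\<phi> \<in> test_functions ?I"
      let ?\<phi>' = "iter_partial [1] \<phi>"
      have sm: "smooth \<phi>" using \<phi> by (simp add: test_functions_iff)
      have c': "continuous_on X ?\<phi>'" for X by (rule smooth_continuous[OF smooth_derivative(1)[OF sm]])
      define p where "p s = integral {0..A} (\<lambda>y. l s y * ?\<phi>' y)" for s
      have cp: "continuous_on {0..t} p"
        unfolding p_def by (rule L2_pairing_continuous[OF A l cont c'])
      define q where "q s = integral ?I (\<lambda>y. G (y, s) * \<phi> y)" for s
      obtain M where M: "\<And>x. \<bar>\<phi> x\<bar> \<le> M" using test_function_bounded[OF \<phi> A] by blast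
      have "\<phi> \<in> borel_measurable borel"
        using smooth_continuous[OF sm, of UNIV] by (rule borel_measurable_continuous_onI)
      then have "(\<lambda>x. \<phi> (fst x)) \<in> borel_measurable (borel \<Otimes>\<^sub>M (borel :: real measure))" by measurable
      then have "(\<lambda>x. \<phi> (fst x)) \<in> borel_measurable (borel :: (real \<times> real) measure)" by (simp add: borel_prod)
      then have G\<phi>: "integrable lborel (\<lambda>x :: real \<times> real. \<phi> (fst x) * G x)"
        by (rule integrable_lborel_mult_bounded[OF G _ M])
      have q_eq: "q s = integral UNIV (\<lambda>y. \<phi> y * G (y, s))" for s
      proof -
        have "q s = integral UNIV (\<lambda>y. if y \<in> ?I then G (y, s) * \<phi> y else 0)"
          unfolding q_def by (rule integral_restrict_UNIV[symmetric])
        also have "(\<lambda>y. if y \<in> ?I then G (y, s) * \<phi> y else 0) = (\<lambda>y. \<phi> y * G (y, s))"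
          using G0out[of _ s] by (auto simp: fun_eq_iff)
        finally show ?thesis .
      qed
      have qU: "q absolutely_integrable_on UNIV"
        using Fubini_lebesgue(1)[OF integrable_lborel_imp_absolutely_integrable[OF G\<phi>]]
        by (simp add: q_eq[abs_def])
      then have nq: "(\<lambda>s. - q s) absolutely_integrable_on UNIV"
        using set_integrable_mult_right[of "-1" lebesgue UNIV q] by simp
      then have nqt: "(\<lambda>s. - q s) absolutely_integrable_on {0..t}"
        by (rule set_integrable_subset) auto
      have "weak_deriv ?J [1] p (\<lambda>s. - q s)"
        unfolding weak_deriv_real_iff[OF t]
      proof (intro conjI ballI)
        show "locally_integrable ?J p"
          by (intro locally_integrable_of_integrable continuous_absolutely_integrable cp)
        show "locally_integrable ?J (\<lambda>s. - q s)" by (rule locally_integrable_of_integrable[OF nqt])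
        fix \<psi> :: "real \<Rightarrow> real" assume \<psi>: "\<psi> \<in> test_functions ?J"
        have GQ: "G absolutely_integrable_on ?Q" by (rule set_integrable_subset[OF Gabs Q]) simp
        have "integral ?J (\<lambda>s. p s * iter_partial [1] \<psi> s)
          = integral ?J (\<lambda>s. integral ?I (\<lambda>y. l s y * ?\<phi>' y) * iter_partial [1] \<psi> s)"
          by (simp only: p_def integral_open_interval_real)
        also have "\<dots> = integral ?J (\<lambda>s. q s * \<psi> s)"
          unfolding q_def by (rule mixed_deriv_slices[OF A t wG GQ \<phi> \<psi>])
        finally show "integral ?J (\<lambda>s. p s * iter_partial [1] \<psi> s) = - integral ?J (\<lambda>s. - q s * \<psi> s)"
          by simp
      qed
      then have "p b - p a = integral {a..b} (\<lambda>s. - q s)"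
        by (rule weak_deriv_continuous_increment[OF cp _ nqt t ab])
      also have "\<dots> = - integral {a..b} q" by simp
      also have "integral {a..b} q = integral ?I (\<lambda>y. H a b y * \<phi> y)"
      proof -
        define \<kappa> :: "real \<times> real \<Rightarrow> real" where "\<kappa> x = indicator {a..b} (snd x)" for x
        have "\<kappa> \<in> borel_measurable (borel \<Otimes>\<^sub>M borel)"
          unfolding \<kappa>_def[abs_def] by measurable
        then have \<kappa>m: "\<kappa> \<in> borel_measurable borel" by (simp add: borel_prod)
        have \<kappa>1: "\<bar>\<kappa> x\<bar> \<le> 1" for x by (simp add: \<kappa>_def indicator_def)
        have i: "integrable lborel (\<lambda>x. \<kappa> x * (\<phi> (fst x) * G x))"
          by (rule integrable_lborel_mult_bounded[OF G\<phi> \<kappa>m \<kappa>1])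
        have "integral {a..b} q = integral UNIV (\<lambda>s. integral UNIV (\<lambda>y. \<kappa> (y, s) * (\<phi> (fst (y, s)) * G (y, s))))"
          unfolding integral_indicator_Icc[symmetric, of "{a..b}" q] by (simp add: \<kappa>_def q_eq)
        also have "\<dots> = integral UNIV (\<lambda>y. integral UNIV (\<lambda>s. \<kappa> (y, s) * (\<phi> (fst (y, s)) * G (y, s))))"
          by (rule Fubini_swap(2)[OF i, symmetric])
        also have "\<dots> = integral UNIV (\<lambda>y. H a b y * \<phi> y)"
        proof (rule integral_cong)
          fix y
          have "integral UNIV (\<lambda>s. \<kappa> (y, s) * (\<phi> (fst (y, s)) * G (y, s)))
            = integral UNIV (\<lambda>s. indicator {a..b} s * G (y, s) * \<phi> y)"
            by (simp add: \<kappa>_def mult_ac)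
          also have "\<dots> = integral UNIV (\<lambda>s. indicator {a..b} s * G (y, s)) * \<phi> y"
            by (rule integral_mult_left)
          finally show "integral UNIV (\<lambda>s. \<kappa> (y, s) * (\<phi> (fst (y, s)) * G (y, s))) = H a b y * \<phi> y"
            by (simp add: H_def integral_indicator_Icc)
        qed
        also have "\<dots> = integral UNIV (\<lambda>y. if y \<in> ?I then H a b y * \<phi> y else 0)"
        proof (rule integral_cong)
          fix y
          show "H a b y * \<phi> y = (if y \<in> ?I then H a b y * \<phi> y else 0)"
            using G0out[of y] by (auto simp: H_def)
        qed
        also have "\<dots> = integral ?I (\<lambda>y. H a b y * \<phi> y)" by (rule integral_restrict_UNIV)
        finally show ?thesis .
      qed
      finally have main: "p b - p a = - integral ?I (\<lambda>y. H a b y * \<phi> y)" .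
      have \<phi>L: "?\<phi>' \<in> L2 ?I"
        unfolding L2_Ioo_iff by (intro conjI continuous_absolutely_integrable continuous_intros c')
      have "p b - p a = integral {0..A} (\<lambda>y. l b y * ?\<phi>' y - l a y * ?\<phi>' y)"
        unfolding p_def
        using L2_mult_absolutely_integrable[OF la(1) \<phi>L] L2_mult_absolutely_integrable[OF la(2) \<phi>L]
        by (intro integral_diff[symmetric]) (auto simp: absolutely_integrable_on_def)
      then show "integral ?I (\<lambda>y. (l b y - l a y) * ?\<phi>' y) = - integral ?I (\<lambda>y. H a b y * \<phi> y)"
        using main by (simp add: left_diff_distrib integral_open_interval_real)
    qed
  qed
qed

section \<open>Regularity of the weak solution\<close>

lemma has_repr_zero: "has_repr A (\<lambda>_. 0) 0 (\<lambda>_. 0)"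
  by (simp add: has_repr_def L2_Ioo_iff)

lemma has_repr_add:
  assumes "has_repr A u c D" "has_repr A u' c' D'"
  shows "has_repr A (\<lambda>y. u y + u' y) (c + c') (\<lambda>y. D y + D' y)"
  using has_repr_diff[OF assms(1) has_repr_diff[OF has_repr_zero assms(2)]] by simp

lemma has_repr_value_unique:
  assumes "has_repr A u c D" "has_repr A u c' D'" "A > 0" "y \<in> {0..A}"
  shows "c + integral {0..y} D = c' + integral {0..y} D'"
  using has_repr_bdry_value[OF assms(1,3,4)] has_repr_bdry_value[OF assms(2,3,4)] by simp

text \<open>The value at \<open>A\<close> differs from the value at any other point by at most \<open>\<integral>\<bar>D\<bar>\<close>; averaging over all points
  gives the bound.\<close>

lemma trace_bound:
  assumes u: "has_repr A u c D" and A: "A > 0"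
  shows "\<bar>c + integral {0..A} D\<bar> \<le> L2_norm {0<..<A} u / sqrt A + sqrt A * sqrt (integral {0..A} (\<lambda>y. (D y)\<^sup>2))"
proof -
  let ?w = "\<lambda>y. c + integral {0..y} D"
  have uL: "u \<in> L2 {0<..<A}" by (rule has_repr_L2[OF u A])
  have DL: "D \<in> L2 {0<..<A}" using u by (simp add: has_repr_def)
  have Da: "D absolutely_integrable_on {0..A}" by (rule has_repr_abs[OF u])
  define d where "d = integral {0..A} (\<lambda>y. \<bar>D y\<bar>)"
  have cw: "continuous_on {0..A} ?w" by (rule has_repr_continuous[OF u])
  then have wi: "(\<lambda>y. \<bar>?w y\<bar>) integrable_on {0..A}"
    by (intro integrable_continuous_interval continuous_on_rabs)
  have "integral {0..A} (\<lambda>y. \<bar>?w A\<bar>) \<le> integral {0..A} (\<lambda>y. \<bar>?w y\<bar> + d)"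
  proof (rule integral_le)
    show "(\<lambda>y. \<bar>?w y\<bar> + d) integrable_on {0..A}" by (intro integrable_add wi integrable_const_ivl)
    show "\<bar>?w A\<bar> \<le> \<bar>?w y\<bar> + d" if "y \<in> {0..A}" for y
      using primitive_increment_bound[OF Da, of 0 y A A] that by (simp add: d_def)
  qed (rule integrable_const_ivl)
  also have "\<dots> = integral {0..A} (\<lambda>y. \<bar>?w y\<bar>) + integral {0..A} (\<lambda>y. d)"
    by (intro integral_add wi integrable_const_ivl)
  finally have "A * \<bar>?w A\<bar> \<le> integral {0..A} (\<lambda>y. \<bar>?w y\<bar>) + A * d" using A by simp
  moreover have "integral {0..A} (\<lambda>y. \<bar>?w y\<bar>) = integral {0..A} (\<lambda>y. \<bar>u y\<bar>)"
  proof (rule integral_spike)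
    show "negligible ({x \<in> {0<..<A}. u x \<noteq> ?w x} \<union> {0, A})"
      using u by (intro negligible_Un) (auto simp: has_repr_def)
  qed auto
  moreover have "integral {0..A} (\<lambda>y. \<bar>u y\<bar>) \<le> sqrt A * L2_norm {0<..<A} u"
  proof -
    have "sqrt ((integral {0..A} (\<lambda>y. \<bar>u y\<bar>))\<^sup>2) \<le> sqrt (A * integral {0..A} (\<lambda>y. (u y)\<^sup>2))"
      using abs_integral_square[OF uL, of 0 A] A by (intro real_sqrt_le_mono) simp
    then show ?thesis unfolding L2_norm_eq[OF uL] by (simp add: real_sqrt_mult)
  qed
  moreover have "d \<le> sqrt A * sqrt (integral {0..A} (\<lambda>y. (D y)\<^sup>2))"
  proof -
    have "sqrt (d\<^sup>2) \<le> sqrt (A * integral {0..A} (\<lambda>y. (D y)\<^sup>2))"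
      using abs_integral_square[OF DL, of 0 A] A unfolding d_def by (intro real_sqrt_le_mono) simp
    then show ?thesis by (simp add: real_sqrt_mult)
  qed
  then have "A * d \<le> A * (sqrt A * sqrt (integral {0..A} (\<lambda>y. (D y)\<^sup>2)))"
    using A by (intro mult_left_mono) auto
  ultimately have "A * \<bar>?w A\<bar> \<le> sqrt A * L2_norm {0<..<A} u + A * (sqrt A * sqrt (integral {0..A} (\<lambda>y. (D y)\<^sup>2)))"
    by linarith
  also have "\<dots> = A * (L2_norm {0<..<A} u / sqrt A + sqrt A * sqrt (integral {0..A} (\<lambda>y. (D y)\<^sup>2)))"
  proof -
    have "sqrt A = A / sqrt A" using A by (simp add: real_div_sqrt)
    then have "sqrt A * L2_norm {0<..<A} u = A * (L2_norm {0<..<A} u / sqrt A)"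
      by (metis times_divide_eq_left times_divide_eq_right)
    then show ?thesis by (simp add: distrib_left)
  qed
  finally show ?thesis using A by simp
qed

lemma good_times_dense:
  fixes P :: "real \<Rightarrow> bool"
  assumes "negligible {s \<in> {0<..<t}. \<not> P s}" "s \<in> {0..t}" "t > 0" "\<delta> > 0"
  obtains r where "0 < r" "r < t" "r \<noteq> s" "\<bar>r - s\<bar> < \<delta>" "P r"
proof -
  define a where "a = max 0 (s - \<delta>)"
  define b where "b = min t (s + \<delta>)"
  have "a < b" using assms by (auto simp: a_def b_def)
  have "\<not> negligible {a<..<b}" using \<open>a < b\<close> negligible_interval(2)[of a b] by simp
  moreover have "negligible ({s \<in> {0<..<t}. \<not> P s} \<union> {s})" using assms(1) by (intro negligible_Un) auto
  ultimately obtain r where "r \<in> {a<..<b}" "r \<notin> {s \<in> {0<..<t}. \<not> P s} \<union> {s}"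
    by (meson negligible_subset subsetI)
  then show thesis by (intro that[of r]) (auto simp: a_def b_def)
qed

text \<open>The regularity that a square integrable mixed derivative gives to the solution: \<open>u s\<close> is the continuous
  representative of \<open>l s\<close>, for every \<open>s \<in> [0,t]\<close>, and \<open>D s\<close> its derivative; \<open>H a b\<close> is the derivative of the
  increment of \<open>u\<close> from \<open>a\<close> to \<open>b\<close>, and the increments of \<open>\<Gamma>\<close> bound its norm.\<close>

definition trajectory where
  "trajectory A t l \<Gamma> H u D \<longleftrightarrow> \<Gamma> 0 = (0::real) \<and>
    (\<forall>a b. 0 \<le> a \<and> a \<le> b \<and> b \<le> t \<longrightarrow> \<Gamma> a \<le> \<Gamma> b \<and> H a b \<in> L2 {0<..<A} \<and>
       integral {0..A} (\<lambda>y. (H a b y)\<^sup>2) \<le> (b - a) * (\<Gamma> b - \<Gamma> a) \<and>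
       (\<forall>y\<in>{0..A}. u b y - u a y = (u b 0 - u a 0) + integral {0..y} (H a b))) \<and>
    (\<forall>s\<in>{0..t}. has_repr A (l s) (u s 0) (D s) \<and> u s A = 0 \<and>
       (\<forall>y\<in>{0..A}. u s y = u s 0 + integral {0..y} (D s)))"

lemma trajectoryD:
  assumes "trajectory A t l \<Gamma> H u D"
  shows "\<Gamma> 0 = 0"
    "\<And>a b. 0 \<le> a \<Longrightarrow> a \<le> b \<Longrightarrow> b \<le> t \<Longrightarrow> \<Gamma> a \<le> \<Gamma> b"
    "\<And>a b. 0 \<le> a \<Longrightarrow> a \<le> b \<Longrightarrow> b \<le> t \<Longrightarrow> H a b \<in> L2 {0<..<A}"
    "\<And>a b. 0 \<le> a \<Longrightarrow> a \<le> b \<Longrightarrow> b \<le> t \<Longrightarrow> integral {0..A} (\<lambda>y. (H a b y)\<^sup>2) \<le> (b - a) * (\<Gamma> b - \<Gamma> a)"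
    "\<And>a b y. 0 \<le> a \<Longrightarrow> a \<le> b \<Longrightarrow> b \<le> t \<Longrightarrow> y \<in> {0..A} \<Longrightarrow>
       u b y - u a y = (u b 0 - u a 0) + integral {0..y} (H a b)"
    "\<And>s. s \<in> {0..t} \<Longrightarrow> has_repr A (l s) (u s 0) (D s)"
    "\<And>s y. s \<in> {0..t} \<Longrightarrow> y \<in> {0..A} \<Longrightarrow> u s y = u s 0 + integral {0..y} (D s)"
    "\<And>s. s \<in> {0..t} \<Longrightarrow> u s A = 0"
  using assms unfolding trajectory_def by blast+

text \<open>The solution belongs to \<open>\<V>\<close> at almost every time only. From one such time, \<open>mixed_derivative_increment\<close>
  carries the \<open>H\<^sup>1\<close> regularity to all of \<open>[0,t]\<close>. The same lemma and \<open>trace_bound\<close> make the boundary value at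
  \<open>A\<close> continuous in time, so that it vanishes throughout.\<close>

lemma weak_solution_trajectory:
  assumes A: "A > 0" and t: "t > 0"
    and sol: "weak_solution A K ta a1 L \<omega> \<epsilon> l0 l"
    and w: "weak_deriv ({0<..<A} \<times> {0<..<t}) [(1, 0), (0, 1)] (\<lambda>(y, s). l s y) g"
    and g: "g \<in> L2 ({0<..<A} \<times> {0<..<t})"
  obtains \<Gamma> :: "real \<Rightarrow> real" and H :: "real \<Rightarrow> real \<Rightarrow> real \<Rightarrow> real" and u D :: "real \<Rightarrow> real \<Rightarrow> real" where
    "trajectory A t l \<Gamma> H u D"
    "\<Gamma> t = (LINT s|lebesgue_on {0<..<t}. (L2_norm {0<..<A} (\<lambda>y. g (y, s)))\<^sup>2)"
proof -
  let ?I = "{0<..<A}"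
  have l: "l s \<in> L2 ?I" if "0 \<le> s" for s using sol that by (simp add: weak_solution_def)
  have cont: "((\<lambda>r. L2_norm ?I (\<lambda>y. l r y - l s y)) \<longlongrightarrow> 0) (at s within {0..})" if "0 \<le> s" for s
    using sol that by (simp add: weak_solution_def)
  have "l \<in> L2_V A t" using sol t by (simp add: weak_solution_def)
  then have "AE s in lebesgue_on {0<..<t}. l s \<in> V A"
    unfolding L2_V_def by (auto elim!: eventually_mono)
  then have good: "negligible {s \<in> {0<..<t}. l s \<notin> V A}" by (simp add: AE_lebesgue_on_iff)
  obtain \<Gamma> H where \<Gamma>: "\<Gamma> 0 = 0"
    "\<Gamma> t = (LINT s|lebesgue_on {0<..<t}. (L2_norm ?I (\<lambda>y. g (y, s)))\<^sup>2)"
    "\<And>a b. 0 \<le> a \<Longrightarrow> a \<le> b \<Longrightarrow> b \<le> t \<Longrightarrow> \<Gamma> a \<le> \<Gamma> b"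
    and H: "\<And>a b. 0 \<le> a \<Longrightarrow> a \<le> b \<Longrightarrow> b \<le> t \<Longrightarrow> H a b \<in> L2 ?I"
    "\<And>a b. 0 \<le> a \<Longrightarrow> a \<le> b \<Longrightarrow> b \<le> t \<Longrightarrow> integral {0..A} (\<lambda>y. (H a b y)\<^sup>2) \<le> (b - a) * (\<Gamma> b - \<Gamma> a)"
    "\<And>a b. 0 \<le> a \<Longrightarrow> a \<le> b \<Longrightarrow> b \<le> t \<Longrightarrow> weak_deriv ?I [1] (\<lambda>y. l b y - l a y) (H a b)"
    using mixed_derivative_increment[OF A t l cont w g] by blast
  have Hrepr: "\<exists>e. has_repr A (\<lambda>y. l b y - l a y) e (H a b)" if "0 \<le> a" "a \<le> b" "b \<le> t" for a b
    using has_reprE[OF H(3)[OF that] H(1)[OF that] A] by blast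
  \<comment> \<open>The increments of \<open>l\<close> are small in \<open>H\<^sup>1\<close>, in both directions of time.\<close>
  have diff_repr: "\<exists>e E. has_repr A (\<lambda>y. l r y - l s y) e E \<and> integral {0..A} (\<lambda>y. (E y)\<^sup>2) \<le> \<bar>r - s\<bar> * \<Gamma> t"
    if rs: "r \<in> {0..t}" "s \<in> {0..t}" for r s
  proof -
    have ord: "\<exists>e E. has_repr A (\<lambda>y. l b y - l a y) e E \<and> integral {0..A} (\<lambda>y. (E y)\<^sup>2) \<le> (b - a) * \<Gamma> t"
      if ab: "0 \<le> a" "a \<le> b" "b \<le> t" for a b
    proof -
      have "\<Gamma> b - \<Gamma> a \<le> \<Gamma> t" using \<Gamma>(3)[of 0 a] \<Gamma>(3)[of b t] \<Gamma>(1) ab by simp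
      then have "(b - a) * (\<Gamma> b - \<Gamma> a) \<le> (b - a) * \<Gamma> t" using ab by (intro mult_left_mono) auto
      then show ?thesis using Hrepr[OF ab] H(2)[OF ab] by (meson order_trans)
    qed
    show ?thesis
    proof (cases "s \<le> r")
      case True
      then show ?thesis using ord[of s r] rs by simp
    next
      case False
      then obtain e E where E: "has_repr A (\<lambda>y. l s y - l r y) e E"
        "integral {0..A} (\<lambda>y. (E y)\<^sup>2) \<le> (s - r) * \<Gamma> t"
        using ord[of r s] rs by auto
      have "has_repr A (\<lambda>y. 0 - (l s y - l r y)) (0 - e) (\<lambda>y. 0 - E y)"
        by (rule has_repr_diff[OF has_repr_zero E(1)])
      then have "has_repr A (\<lambda>y. l r y - l s y) (- e) (\<lambda>y. - E y)" by simp
      then show ?thesis using E(2) False by (intro exI[of _ "- e"] exI[of _ "\<lambda>y. - E y"]) simp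
    qed
  qed
  have V_repr: "\<exists>c D. has_repr A (l s) c D \<and> c + integral {0..A} D = 0" if sV: "l s \<in> V A" for s
  proof -
    from sV obtain D where D: "D \<in> L2 ?I" "weak_deriv ?I [1] (l s) D" and b: "bdry_value A (l s) A = 0"
      by (auto simp: V_def H1_def)
    from has_reprE[OF D(2,1) A] obtain c where c: "has_repr A (l s) c D" by blast
    then show ?thesis using has_repr_bdry_value[OF c A, of A] b A by auto
  qed
  have repr: "\<exists>c D. has_repr A (l s) c D" if s: "s \<in> {0..t}" for s
  proof -
    obtain r where r: "0 < r" "r < t" "l r \<in> V A"
      using good_times_dense[OF good s t zero_less_one] by metis
    obtain c D where c: "has_repr A (l r) c D" using V_repr[OF r(3)] by blast
    obtain e E where e: "has_repr A (\<lambda>y. l s y - l r y) e E" using diff_repr[OF s, of r] r by auto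
    show ?thesis using has_repr_add[OF e c] by auto
  qed
  have bdry: "c + integral {0..A} D = 0" if s: "s \<in> {0..t}" and c: "has_repr A (l s) c D" for s c D
  proof (rule ccontr)
    define z where "z = \<bar>c + integral {0..A} D\<bar>"
    assume "c + integral {0..A} D \<noteq> 0"
    then have z: "z > 0" by (simp add: z_def)
    \<comment> \<open>Bounds the difference of the boundary values of \<open>l s\<close> and \<open>l r\<close>, by \<open>trace_bound\<close>.\<close>
    define F where "F r = L2_norm ?I (\<lambda>y. l r y - l s y) / sqrt A + sqrt A * sqrt (\<bar>r - s\<bar> * \<Gamma> t)" for r
    have s0: "0 \<le> s" using s by simp
    have "((\<lambda>r. \<bar>r - s\<bar> * \<Gamma> t) \<longlongrightarrow> \<bar>s - s\<bar> * \<Gamma> t) (at s within {0..})"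
      by (intro tendsto_intros)
    then have "((\<lambda>r. sqrt A * sqrt (\<bar>r - s\<bar> * \<Gamma> t)) \<longlongrightarrow> sqrt A * sqrt (\<bar>s - s\<bar> * \<Gamma> t)) (at s within {0..})"
      by (intro tendsto_intros)
    moreover have "((\<lambda>r. L2_norm ?I (\<lambda>y. l r y - l s y) / sqrt A) \<longlongrightarrow> 0 / sqrt A) (at s within {0..})"
      using A by (intro tendsto_divide cont[OF s0] tendsto_const) simp
    ultimately have "(F \<longlongrightarrow> 0 / sqrt A + sqrt A * sqrt (\<bar>s - s\<bar> * \<Gamma> t)) (at s within {0..})"
      unfolding F_def by (intro tendsto_add)
    then have "eventually (\<lambda>r. F r < z) (at s within {0..})"
      by (rule order_tendstoD(2)) (use z in simp)
    then obtain \<delta> where \<delta>: "\<delta> > 0" "\<And>r. r \<in> {0..} \<Longrightarrow> r \<noteq> s \<Longrightarrow> dist r s < \<delta> \<Longrightarrow> F r < z"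
      unfolding eventually_at by auto
    obtain r where r: "0 < r" "r < t" "r \<noteq> s" "\<bar>r - s\<bar> < \<delta>" "l r \<in> V A"
      using good_times_dense[OF good s t \<delta>(1)] by metis
    have Fr: "F r < z" using \<delta>(2)[of r] r by (simp add: dist_real_def)
    obtain c' D' where c': "has_repr A (l r) c' D'" "c' + integral {0..A} D' = 0" using V_repr[OF r(5)] by blast
    have rI: "r \<in> {0..t}" using r by simp
    obtain e E where e: "has_repr A (\<lambda>y. l r y - l s y) e E" "integral {0..A} (\<lambda>y. (E y)\<^sup>2) \<le> \<bar>r - s\<bar> * \<Gamma> t"
      using diff_repr[OF rI s] by blast
    have AA: "A \<in> {0..A}" using A by simp
    have "(c' - c) + integral {0..A} (\<lambda>y. D' y - D y) = e + integral {0..A} E"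
      by (rule has_repr_value_unique[OF has_repr_diff[OF c'(1) c] e(1) A AA])
    moreover have "integral {0..A} (\<lambda>y. D' y - D y) = integral {0..A} D' - integral {0..A} D"
      using has_repr_abs[OF c'(1)] has_repr_abs[OF c]
      by (intro integral_diff) (auto simp: absolutely_integrable_on_def)
    ultimately have "z = \<bar>e + integral {0..A} E\<bar>" using c'(2) by (simp add: z_def)
    also have "\<dots> \<le> L2_norm ?I (\<lambda>y. l r y - l s y) / sqrt A + sqrt A * sqrt (integral {0..A} (\<lambda>y. (E y)\<^sup>2))"
      by (rule trace_bound[OF e(1) A])
    also have "\<dots> \<le> F r"
      unfolding F_def using e(2) A by (intro add_left_mono mult_left_mono) auto
    finally show False using Fr by simp
  qed
  obtain c D where cD: "\<And>s. s \<in> {0..t} \<Longrightarrow> has_repr A (l s) (c s) (D s)"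
    using repr by metis
  define u where "u s y = c s + integral {0..y} (D s)" for s y
  have inc: "u b y - u a y = (u b 0 - u a 0) + integral {0..y} (H a b)"
    if ab: "0 \<le> a" "a \<le> b" "b \<le> t" and y: "y \<in> {0..A}" for a b y
  proof -
    have abI: "a \<in> {0..t}" "b \<in> {0..t}" using ab by auto
    obtain e where e: "has_repr A (\<lambda>y. l b y - l a y) e (H a b)" using Hrepr[OF ab] by blast
    have val: "u b y - u a y = e + integral {0..y} (H a b)" if y: "y \<in> {0..A}" for y
    proof -
      have "(c b - c a) + integral {0..y} (\<lambda>y. D b y - D a y) = e + integral {0..y} (H a b)"
        by (rule has_repr_value_unique[OF has_repr_diff[OF cD[OF abI(2)] cD[OF abI(1)]] e A y])
      moreover have "integral {0..y} (\<lambda>y. D b y - D a y) = integral {0..y} (D b) - integral {0..y} (D a)"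
        using has_repr_abs[OF cD[OF abI(2)]] has_repr_abs[OF cD[OF abI(1)]] y
        by (intro integral_diff) (auto simp: absolutely_integrable_on_def intro: integrable_on_subinterval)
      ultimately show ?thesis by (simp add: u_def)
    qed
    show ?thesis using val[OF y] val[of 0] A by simp
  qed
  have "has_repr A (l s) (u s 0) (D s) \<and> u s A = 0" if "s \<in> {0..t}" for s
    using cD[OF that] bdry[OF that cD[OF that]] by (simp add: u_def)
  then have "trajectory A t l \<Gamma> H u D"
    unfolding trajectory_def using \<Gamma>(1,3) H(1,2) inc by (auto simp: u_def)
  then show thesis using \<Gamma>(2) by (rule that)
qed

section \<open>The continuous and the discrete equation integrated in time\<close>

text \<open>Increments bounded by the square root of the length of the interval are what the Cauchy-Schwarz inequality
  in time yields for the nodal values.\<close>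

lemma sqrt_modulus_continuous:
  fixes f :: "real \<Rightarrow> real"
  assumes "\<And>a b. 0 \<le> a \<Longrightarrow> a \<le> b \<Longrightarrow> b \<le> t \<Longrightarrow> (f b - f a)\<^sup>2 \<le> M * (b - a)"
  shows "continuous_on {0..t} f"
  unfolding continuous_on_def
proof
  fix s assume s: "s \<in> {0..t}"
  have est: "norm (f r - f s) \<le> sqrt (M * \<bar>r - s\<bar>)" if r: "r \<in> {0..t}" for r
  proof -
    have "(f r - f s)\<^sup>2 \<le> M * \<bar>r - s\<bar>"
      using assms[of s r] assms[of r s] r s by (cases "s \<le> r") (auto simp: power2_commute)
    then have "sqrt ((f r - f s)\<^sup>2) \<le> sqrt (M * \<bar>r - s\<bar>)" by (rule real_sqrt_le_mono)
    then show ?thesis by simp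
  qed
  have "((\<lambda>r. sqrt (M * \<bar>r - s\<bar>)) \<longlongrightarrow> sqrt (M * \<bar>s - s\<bar>)) (at s within {0..t})"
    by (intro tendsto_intros)
  then have z: "((\<lambda>r. sqrt (M * \<bar>r - s\<bar>)) \<longlongrightarrow> 0) (at s within {0..t})" by simp
  have "eventually (\<lambda>r. norm (f r - f s) \<le> sqrt (M * \<bar>r - s\<bar>)) (at s within {0..t})"
    unfolding eventually_at_filter using est by (auto intro!: always_eventually)
  from Lim_null_comparison[OF this z] show "(f \<longlongrightarrow> f s) (at s within {0..t})"
    by (simp add: LIM_zero_iff)
qed

text \<open>A function that vanishes at \<open>A\<close> is bounded by the integral of its derivative.\<close>

lemma vanishing_at_end_bound:
  assumes A: "A > 0" and H: "H \<in> L2 {0<..<A}"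
    and v: "\<And>y. y \<in> {0..A} \<Longrightarrow> v y = c + integral {0..y} H" and vA: "v A = 0" and y: "y \<in> {0..A}"
  shows "(v y)\<^sup>2 \<le> A * integral {0..A} (\<lambda>y. (H y)\<^sup>2)"
proof -
  have Ha: "H absolutely_integrable_on {0..A}" using H by (simp add: L2_Ioo_iff)
  have "v y = - (integral {0..A} H - integral {0..y} H)" using v[of y] v[of A] vA y A by simp
  then have "\<bar>v y\<bar> \<le> integral {0..A} (\<lambda>s. \<bar>H s\<bar>)"
    using primitive_increment_bound[OF Ha, of 0 y A A] y by simp
  from power_mono[OF this, of 2] have "(v y)\<^sup>2 \<le> (integral {0..A} (\<lambda>s. \<bar>H s\<bar>))\<^sup>2" by simp
  also have "\<dots> \<le> A * integral {0..A} (\<lambda>y. (H y)\<^sup>2)"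
    using abs_integral_square[OF H, of 0 A] A by simp
  finally show ?thesis .
qed

text \<open>Against discrete functions, \<open>\<kappa>\<close> depends on the nodal values of its first argument only. In
  particular \<open>\<kappa>(u,v)\<close> does not change if \<open>u\<close> is replaced with its nodal interpolant.\<close>

lemma kappa_Vh:
  assumes A: "A > 0" and h: "h = A / real N" and N: "N \<ge> 1"
    and u: "has_repr A u (U 0) D" and U: "\<And>y. y \<in> {0..A} \<Longrightarrow> U y = U 0 + integral {0..y} D"
    and v: "v \<in> Vh A N"
  shows "kappa A K ta a1 u v = stiffness N (A\<^sup>2 * K / h) (A * K * ta / (2 * a1)) (\<lambda>j. U (grid h j)) (\<lambda>j. v (grid h j))"
proof -
  note h0 = grid_facts(1)[OF A h N] and AN = grid_facts(2)[OF A h N]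
  have Da: "D absolutely_integrable_on {0..A}" by (rule has_repr_abs[OF u])
  have el: "integral {grid h j..grid h (Suc j)} D = U (grid h (Suc j)) - U (grid h j)" if "j < N" for j
  proof -
    have n: "0 \<le> grid h j" "grid h j \<le> grid h (Suc j)" "grid h (Suc j) \<le> A"
      using grid_nonneg[of h j] grid_mono[of h "Suc j" N] grid_mono[of h j "Suc j"] that AN h0 by auto
    have "D integrable_on {0..A}" using Da by (simp add: absolutely_integrable_on_def)
    then have "D integrable_on {0..grid h (Suc j)}" by (rule integrable_on_subinterval) (use n in auto)
    then have "integral {0..grid h (Suc j)} D = integral {0..grid h j} D + integral {grid h j..grid h (Suc j)} D"
      using Henstock_Kurzweil_Integration.integral_combine[OF n(1,2), of D] by simp
    then show ?thesis using U[of "grid h j"] U[of "grid h (Suc j)"] n by simp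
  qed
  have "integral {0..A} (\<lambda>y. D y * slope h N (\<lambda>j. v (grid h j)) y)
      = (\<Sum>j<N. (v (grid h (Suc j)) - v (grid h j)) / h * integral {grid h j..grid h (Suc j)} D)"
    using slope_mult_integral[OF h0, where D = D and N = N and z = "\<lambda>j. v (grid h j)"] Da AN by simp
  also have "\<dots> = (\<Sum>j<N. (U (grid h (Suc j)) - U (grid h j)) * (v (grid h (Suc j)) - v (grid h j))) / h"
    unfolding sum_divide_distrib by (rule sum.cong) (simp_all add: el)
  finally show ?thesis
    unfolding kappa_repr[OF u Vh_repr[OF v h A N] A] stiffness_def by simp
qed

lemma stiffness_continuous:
  assumes "\<And>j. j \<le> N \<Longrightarrow> continuous_on S (\<lambda>s. x s j)"
  shows "continuous_on S (\<lambda>s. stiffness N p q (x s) z)"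
  unfolding stiffness_def by (intro continuous_intros assms) auto

lemma deriv_L0: "deriv (L0 L \<omega> \<epsilon>) s = - (L * \<epsilon> * \<omega> * sin (\<omega> * s))"
proof -
  have "(L0 L \<omega> \<epsilon> has_real_derivative - (L * \<epsilon> * \<omega> * sin (\<omega> * s))) (at s)"
    unfolding L0_def[abs_def] by (auto intro!: derivative_eq_intros)
  then show ?thesis by (rule DERIV_imp_deriv)
qed

text \<open>For a discrete test function the right-hand side of the weak equation is a continuous function of
  time by \<open>kappa_Vh\<close>, so that the equation can be integrated between any two times.\<close>

lemma continuous_equation:
  assumes A: "A > 0" and h: "h = A / real N" and N: "N \<ge> 1" and t: "t > 0"
    and sol: "weak_solution A K ta a1 L \<omega> \<epsilon> l0 l"
    and repr: "\<And>s. s \<in> {0..t} \<Longrightarrow> has_repr A (l s) (u s 0) (D s)"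
    and u: "\<And>s y. s \<in> {0..t} \<Longrightarrow> y \<in> {0..A} \<Longrightarrow> u s y = u s 0 + integral {0..y} (D s)"
    and cu: "\<And>y. y \<in> {0..A} \<Longrightarrow> continuous_on {0..t} (\<lambda>s. u s y)"
    and v: "v \<in> Vh A N" and ab: "0 \<le> a" "a \<le> b" "b \<le> t"
  shows "integral {0..A} (\<lambda>y. (u b y - u a y) * v y) = integral {a..b} (\<lambda>s.
    - (A / 2) * deriv (L0 L \<omega> \<epsilon>) s * v 0
    - stiffness N (A\<^sup>2 * K / h) (A * K * ta / (2 * a1)) (\<lambda>j. u s (grid h j)) (\<lambda>j. v (grid h j)))"
proof -
  let ?I = "{0<..<A}"
  note h0 = grid_facts(1)[OF A h N] and AN = grid_facts(2)[OF A h N] and node = grid_facts(3)[OF A h N]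
  have cv: "continuous_on {0..A} v" and vA: "v A = 0" using v by (simp_all add: Vh_def)
  have vr: "has_repr A v (v 0) (slope h N (\<lambda>j. v (grid h j)))" by (rule Vh_repr[OF v h A N])
  have vV: "v \<in> V A"
    by (rule has_repr_V[OF vr A]) (use Vh_primitive[OF v h A N, of A] A vA in simp)
  have v0: "bdry_value A v 0 = v 0" using has_repr_bdry_value[OF vr A, of 0] A by simp
  define F where "F s = - (A / 2) * deriv (L0 L \<omega> \<epsilon>) s * v 0
    - stiffness N (A\<^sup>2 * K / h) (A * K * ta / (2 * a1)) (\<lambda>j. u s (grid h j)) (\<lambda>j. v (grid h j))" for s
  have l: "l s \<in> L2 ?I" if "0 \<le> s" for s using sol that by (simp add: weak_solution_def)
  have cont: "((\<lambda>r. L2_norm ?I (\<lambda>y. l r y - l s y)) \<longlongrightarrow> 0) (at s within {0..})" if "0 \<le> s" for s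
    using sol that by (simp add: weak_solution_def)
  have vL: "v \<in> L2 ?I" by (rule has_repr_L2[OF vr A])
  define P where "P s = integral {0..A} (\<lambda>y. l s y * v y)" for s
  have cP: "continuous_on {0..t} P" unfolding P_def by (rule L2_pairing_continuous[OF A l cont cv])
  have cusA: "continuous_on {0..A} (u s)" if "s \<in> {0..t}" for s
  proof (rule continuous_on_eq[OF has_repr_continuous[OF repr[OF that]]])
    show "u s 0 + integral {0..y} (D s) = u s y" if "y \<in> {0..A}" for y
      using u[OF \<open>s \<in> {0..t}\<close> that] by simp
  qed
  have Pu: "P s = integral {0..A} (\<lambda>y. u s y * v y)" if s: "s \<in> {0..t}" for s
    unfolding P_def
  proof (rule integral_spike)
    show "negligible ({x \<in> ?I. l s x \<noteq> u s 0 + integral {0..x} (D s)} \<union> {0, A})"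
      using repr[OF s] by (intro negligible_Un) (auto simp: has_repr_def)
    fix y assume "y \<in> {0..A} - ({x \<in> ?I. l s x \<noteq> u s 0 + integral {0..x} (D s)} \<union> {0, A})"
    then have y: "y \<in> ?I" "l s y = u s 0 + integral {0..y} (D s)" by auto
    then show "u s y * v y = l s y * v y" using u[OF s, of y] by simp
  qed
  have "continuous_on {0..t} F"
    unfolding F_def deriv_L0
    by (intro continuous_intros stiffness_continuous cu node) auto
  then have Fa: "F absolutely_integrable_on {0..t}" by (rule continuous_absolutely_integrable)
  have "weak_deriv {0<..<t} [1] (\<lambda>s. LINT y|lebesgue_on ?I. l s y * v y)
        (\<lambda>s. - (A / 2) * deriv (L0 L \<omega> \<epsilon>) s * bdry_value A v 0 - kappa A K ta a1 (l s) v)"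
    using sol t vV by (simp add: weak_solution_def)
  then have "weak_deriv {0<..<t} [1] P F"
  proof (rule weak_deriv_AE_cong[rotated 3])
    have "{s \<in> {0<..<t}. (LINT y|lebesgue_on ?I. l s y * v y) \<noteq> P s} \<subseteq> {}"
    proof (rule subsetI)
      fix s assume s: "s \<in> {s \<in> {0<..<t}. (LINT y|lebesgue_on ?I. l s y * v y) \<noteq> P s}"
      have "(\<lambda>y. l s y * v y) absolutely_integrable_on ?I"
        using L2_mult_absolutely_integrable[OF l vL, of s] s by (simp add: absolutely_integrable_interior_real)
      then have "(LINT y|lebesgue_on ?I. l s y * v y) = P s"
        by (subst LINT_lebesgue_on) (simp_all add: P_def integral_open_interval_real)
      then show "s \<in> {}" using s by simp
    qed
    then show "negligible {s \<in> {0<..<t}. (LINT y|lebesgue_on ?I. l s y * v y) \<noteq> P s}"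
      by (rule negligible_subset[OF negligible_empty])
    have "{s \<in> {0<..<t}. - (A / 2) * deriv (L0 L \<omega> \<epsilon>) s * bdry_value A v 0 - kappa A K ta a1 (l s) v \<noteq> F s} \<subseteq> {}"
    proof (rule subsetI)
      fix s assume s: "s \<in> {s \<in> {0<..<t}. - (A / 2) * deriv (L0 L \<omega> \<epsilon>) s * bdry_value A v 0 - kappa A K ta a1 (l s) v \<noteq> F s}"
      then have sI: "s \<in> {0..t}" by simp
      have "kappa A K ta a1 (l s) v = stiffness N (A\<^sup>2 * K / h) (A * K * ta / (2 * a1)) (\<lambda>j. u s (grid h j)) (\<lambda>j. v (grid h j))"
        by (rule kappa_Vh[OF A h N repr[OF sI] u[OF sI] v])
      then show "s \<in> {}" using s by (simp add: F_def v0)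
    qed
    then show "negligible {s \<in> {0<..<t}. - (A / 2) * deriv (L0 L \<omega> \<epsilon>) s * bdry_value A v 0 - kappa A K ta a1 (l s) v \<noteq> F s}"
      by (rule negligible_subset[OF negligible_empty])
  qed simp
  then have "P b - P a = integral {a..b} F"
    by (rule weak_deriv_continuous_increment[OF cP _ Fa t ab])
  moreover have "P b - P a = integral {0..A} (\<lambda>y. (u b y - u a y) * v y)"
    using Pu[of a] Pu[of b] ab cusA[of a] cusA[of b]
    by (subst left_diff_distrib, subst integral_diff)
      (auto intro!: integrable_continuous_interval continuous_on_mult cv)
  ultimately show ?thesis by (simp add: F_def[abs_def])
qed

lemma lumped_product_nodes:
  assumes "h = A / real N"
  shows "lumped_product A N u v = h * (\<Sum>j<N. u (grid h j) * v (grid h j))"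
proof -
  have "node A N (Suc i) = grid h i" for i by (simp add: node_def grid_def assms)
  then show ?thesis
    unfolding lumped_product_def assms[symmetric] by (simp add: sum.atLeast1_atMost_eq)
qed

lemma discrete_equation:
  assumes A: "A > 0" and h: "h = A / real N" and N: "N \<ge> 1"
    and sol: "discrete_solution A K ta a1 L \<omega> \<epsilon> N l0h lh"
    and v: "v \<in> Vh A N" and ab: "0 \<le> a" "a \<le> b"
  shows "((\<lambda>s. - (A / 2) * deriv (L0 L \<omega> \<epsilon>) s * v 0
    - stiffness N (A\<^sup>2 * K / h) (A * K * ta / (2 * a1)) (\<lambda>j. lh s (grid h j)) (\<lambda>j. v (grid h j)))
    has_integral h * (\<Sum>j<N. (lh b (grid h j) - lh a (grid h j)) * v (grid h j))) {a..b}"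
proof -
  note h0 = grid_facts(1)[OF A h N] and AN = grid_facts(2)[OF A h N] and node = grid_facts(3)[OF A h N]
  obtain dl where dl: "\<And>s. s \<ge> 0 \<Longrightarrow> dl s \<in> Vh A N"
    "\<And>y s. y \<in> {0..A} \<Longrightarrow> s \<ge> 0 \<Longrightarrow> ((\<lambda>s. lh s y) has_real_derivative dl s y) (at s within {0..})"
    "\<And>s. s \<ge> 0 \<Longrightarrow> lumped_product A N (dl s) v + kappa A K ta a1 (lh s) v = - (A / 2) * deriv (L0 L \<omega> \<epsilon>) s * v 0"
    using sol v unfolding discrete_solution_def by metis
  have lhV: "lh s \<in> Vh A N" if "s \<ge> 0" for s using sol that by (simp add: discrete_solution_def)
  have "((\<lambda>s. h * (\<Sum>j<N. dl s (grid h j) * v (grid h j))) has_integral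
      h * (\<Sum>j<N. lh b (grid h j) * v (grid h j)) - h * (\<Sum>j<N. lh a (grid h j) * v (grid h j))) {a..b}"
  proof (rule fundamental_theorem_of_calculus[OF ab(2)])
    fix s assume s: "s \<in> {a..b}"
    have d: "((\<lambda>s. lh s (grid h j)) has_real_derivative dl s (grid h j)) (at s within {a..b})" if "j < N" for j
      by (rule DERIV_subset[OF dl(2)[OF node]]) (use that s ab in auto)
    have "((\<lambda>s. h * (\<Sum>j<N. lh s (grid h j) * v (grid h j))) has_real_derivative
        h * (\<Sum>j<N. dl s (grid h j) * v (grid h j))) (at s within {a..b})"
      by (intro DERIV_cmult DERIV_sum DERIV_cmult_right d) auto
    then show "((\<lambda>s. h * (\<Sum>j<N. lh s (grid h j) * v (grid h j))) has_vector_derivative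
        h * (\<Sum>j<N. dl s (grid h j) * v (grid h j))) (at s within {a..b})"
      by (simp add: has_real_derivative_iff_has_vector_derivative)
  qed
  moreover have "h * (\<Sum>j<N. dl s (grid h j) * v (grid h j)) = - (A / 2) * deriv (L0 L \<omega> \<epsilon>) s * v 0
    - stiffness N (A\<^sup>2 * K / h) (A * K * ta / (2 * a1)) (\<lambda>j. lh s (grid h j)) (\<lambda>j. v (grid h j))"
    if s: "s \<in> {a..b}" for s
  proof -
    have s0: "s \<ge> 0" using s ab by simp
    have "kappa A K ta a1 (lh s) v = stiffness N (A\<^sup>2 * K / h) (A * K * ta / (2 * a1)) (\<lambda>j. lh s (grid h j)) (\<lambda>j. v (grid h j))"
      by (rule kappa_Vh[OF A h N Vh_repr[OF lhV[OF s0] h A N] Vh_primitive[OF lhV[OF s0] h A N] v])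
    then show ?thesis using dl(3)[OF s0] unfolding lumped_product_nodes[OF h] by simp
  qed
  moreover have "h * (\<Sum>j<N. lh b (grid h j) * v (grid h j)) - h * (\<Sum>j<N. lh a (grid h j) * v (grid h j))
      = h * (\<Sum>j<N. (lh b (grid h j) - lh a (grid h j)) * v (grid h j))"
    by (simp only: left_diff_distrib sum_subtractf right_diff_distrib)
  ultimately show ?thesis
    using has_integral_eq[of "{a..b}"] by (metis (no_types, lifting))
qed

lemma discrete_solution_lipschitz:
  assumes sol: "discrete_solution A K ta a1 L \<omega> \<epsilon> N l0h lh" and y: "y \<in> {0..A}" and t: "0 \<le> t"
  shows "\<exists>M\<ge>0. \<forall>a b. 0 \<le> a \<longrightarrow> a \<le> b \<longrightarrow> b \<le> t \<longrightarrow> \<bar>lh b y - lh a y\<bar> \<le> M * (b - a)"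
proof -
  obtain dl where dl: 
    "\<And>y s. y \<in> {0..A} \<Longrightarrow> s \<ge> 0 \<Longrightarrow> ((\<lambda>s. lh s y) has_real_derivative dl s y) (at s within {0..})"
    "\<And>y. y \<in> {0..A} \<Longrightarrow> continuous_on {0..} (\<lambda>s. dl s y)"
    using sol unfolding discrete_solution_def by metis
  have c: "continuous_on {0..t} (\<lambda>s. dl s y)"
    by (rule continuous_on_subset[OF dl(2)[OF y]]) auto
  then have "bounded ((\<lambda>s. dl s y) ` {0..t})"
    by (intro compact_imp_bounded compact_continuous_image) auto
  then obtain M where M: "\<And>s. s \<in> {0..t} \<Longrightarrow> \<bar>dl s y\<bar> \<le> M"
    unfolding bounded_iff real_norm_def by blast
  have "\<bar>dl 0 y\<bar> \<le> M" by (rule M) (use t in simp)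
  then have "0 \<le> M" by (rule order_trans[OF abs_ge_zero])
  moreover have "\<bar>lh b y - lh a y\<bar> \<le> M * (b - a)" if ab: "0 \<le> a" "a \<le> b" "b \<le> t" for a b
  proof -
    have "((\<lambda>s. dl s y) has_integral lh b y - lh a y) {a..b}"
    proof (rule fundamental_theorem_of_calculus[OF ab(2)])
      fix s assume s: "s \<in> {a..b}"
      have "((\<lambda>s. lh s y) has_real_derivative dl s y) (at s within {a..b})"
        by (rule DERIV_subset[OF dl(1)[OF y]]) (use s ab in auto)
      then show "((\<lambda>s. lh s y) has_vector_derivative dl s y) (at s within {a..b})"
        by (simp add: has_real_derivative_iff_has_vector_derivative)
    qed
    moreover have "norm (integral {a..b} (\<lambda>s. dl s y)) \<le> M * (b - a)"
    proof (rule integral_bound[OF ab(2)])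
      show "continuous_on {a..b} (\<lambda>s. dl s y)"
        by (rule continuous_on_subset[OF c]) (use ab in auto)
      show "norm (dl s y) \<le> M" if "s \<in> {a..b}" for s
        using M[of s] that ab by simp
    qed
    ultimately show ?thesis by (simp add: has_integral_iff)
  qed
  ultimately show ?thesis by blast
qed

section \<open>The error estimate\<close>

lemma square_add_le:
  fixes c d :: real
  shows "(c + d)\<^sup>2 \<le> 2 * c\<^sup>2 + 2 * d\<^sup>2"
proof -
  have "(c + d)\<^sup>2 + (c - d)\<^sup>2 = 2 * c\<^sup>2 + 2 * d\<^sup>2" by (simp add: power2_sum power2_diff)
  moreover have "0 \<le> (c - d)\<^sup>2" by simp
  ultimately show ?thesis by linarith
qed

text \<open>The difference \<open>x\<close> of the discrete solution and the nodal interpolant of the solution satisfies the discrete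
  equation up to the lumping error of the increment of the solution, which has the derivative \<open>H a b\<close>. This is the
  assumption of \<open>energy_estimate\<close> with \<open>c = 9 A h\<close>, the constant of \<open>lumping_error\<close>.\<close>

lemma nodal_energy_bound:
  assumes A: "A > 0" and K: "K > 0" and ta: "ta > 0" and a1: "a1 > 0"
    and h: "h = A / real N" and N: "N \<ge> 1" and t: "t > 0"
    and sol: "weak_solution A K ta a1 L \<omega> \<epsilon> l0 l"
    and disc: "discrete_solution A K ta a1 L \<omega> \<epsilon> N l0h lh"
    and tr: "trajectory A t l \<Gamma> H u D"
  defines "x \<equiv> \<lambda>s j. lh s (grid h j) - u s (grid h j)"
    and "E \<equiv> stiffness N (A\<^sup>2 * K / h) (A * K * ta / (2 * a1))"
  shows "E (x t) (x t) \<le> E (x 0) (x 0) + 9 * A * h / 2 * \<Gamma> t"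
proof -
  note \<Gamma> = trajectoryD(1,2)[OF tr] and H = trajectoryD(3-5)[OF tr] and repr = trajectoryD(6)[OF tr]
    and u = trajectoryD(7)[OF tr] and uA = trajectoryD(8)[OF tr]
  note h0 = grid_facts(1)[OF A h N] and AN = grid_facts(2)[OF A h N] and node = grid_facts(3)[OF A h N]
  define p where "p = A\<^sup>2 * K / h"
  define q where "q = A * K * ta / (2 * a1)"
  have pq: "0 \<le> p" "0 \<le> q" using A K ta a1 h0 by (simp_all add: p_def q_def)
  have lhV: "lh s \<in> Vh A N" if "s \<ge> 0" for s using disc that by (simp add: discrete_solution_def)
  have mod: "(u b y - u a y)\<^sup>2 \<le> A * ((b - a) * (\<Gamma> b - \<Gamma> a))"
    if ab: "0 \<le> a" "a \<le> b" "b \<le> t" and y: "y \<in> {0..A}" for a b y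
  proof -
    have "(u b y - u a y)\<^sup>2 \<le> A * integral {0..A} (\<lambda>y. (H a b y)\<^sup>2)"
      by (rule vanishing_at_end_bound[OF A H(1)[OF ab], of "\<lambda>y. u b y - u a y", OF H(3)[OF ab]])
        (use uA ab y in auto)
    also have "\<dots> \<le> A * ((b - a) * (\<Gamma> b - \<Gamma> a))"
      using H(2)[OF ab] A by (intro mult_left_mono) auto
    finally show ?thesis .
  qed
  have cu: "continuous_on {0..t} (\<lambda>s. u s y)" if y: "y \<in> {0..A}" for y
  proof (rule sqrt_modulus_continuous[where M = "A * \<Gamma> t"])
    fix a b :: real assume ab: "0 \<le> a" "a \<le> b" "b \<le> t"
    have "\<Gamma> b - \<Gamma> a \<le> \<Gamma> t" using \<Gamma>(2)[of 0 a] \<Gamma>(2)[of b t] \<Gamma>(1) ab by simp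
    then have "A * ((b - a) * (\<Gamma> b - \<Gamma> a)) \<le> A * ((b - a) * \<Gamma> t)"
      using A ab by (intro mult_left_mono) auto
    with mod[OF ab y] show "(u b y - u a y)\<^sup>2 \<le> A * \<Gamma> t * (b - a)" by (simp add: mult_ac)
  qed
  obtain m where m: "\<And>j. j \<le> N \<Longrightarrow> 0 \<le> m j"
    "\<And>j a b. j \<le> N \<Longrightarrow> 0 \<le> a \<Longrightarrow> a \<le> b \<Longrightarrow> b \<le> t \<Longrightarrow> \<bar>lh b (grid h j) - lh a (grid h j)\<bar> \<le> m j * (b - a)"
  proof -
    have "\<forall>j\<in>{..N}. \<exists>M\<ge>0. \<forall>a b. 0 \<le> a \<longrightarrow> a \<le> b \<longrightarrow> b \<le> t \<longrightarrow> \<bar>lh b (grid h j) - lh a (grid h j)\<bar> \<le> M * (b - a)"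
      using discrete_solution_lipschitz[OF disc node] t by auto
    from bchoice[OF this] show ?thesis using that by (auto simp: Ball_def)
  qed
  define M where "M = (\<Sum>j\<le>N. m j)"
  have mM: "m j \<le> M" if "j \<le> N" for j
    unfolding M_def by (rule member_le_sum) (use that m(1) in auto)
  have M0: "0 \<le> M" unfolding M_def by (rule sum_nonneg) (use m(1) in auto)
  have lip: "\<bar>lh b (grid h j) - lh a (grid h j)\<bar> \<le> M * (b - a)"
    if "j \<le> N" "0 \<le> a" "a \<le> b" "b \<le> t" for j a b
  proof -
    have "m j * (b - a) \<le> M * (b - a)" using mM[OF that(1)] that by (intro mult_right_mono) auto
    then show ?thesis using m(2)[OF that] by simp
  qed
  have cl: "continuous_on {0..t} (\<lambda>s. lh s (grid h j))" if j: "j \<le> N" for j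
  proof (rule sqrt_modulus_continuous[where M = "M\<^sup>2 * t"])
    fix a b :: real assume ab: "0 \<le> a" "a \<le> b" "b \<le> t"
    have "(lh b (grid h j) - lh a (grid h j))\<^sup>2 \<le> (M * (b - a))\<^sup>2"
      using power_mono[OF lip[OF j ab], of 2] by simp
    also have "\<dots> = M\<^sup>2 * (b - a) * (b - a)" by (simp add: power2_eq_square)
    also have "\<dots> \<le> M\<^sup>2 * t * (b - a)" using ab by (intro mult_right_mono mult_left_mono) auto
    finally show "(lh b (grid h j) - lh a (grid h j))\<^sup>2 \<le> M\<^sup>2 * t * (b - a)" .
  qed
  have cx: "continuous_on {0..t} (\<lambda>s. x s j)" if "j \<le> N" for j
    unfolding x_def using that by (intro continuous_on_diff cl cu node)
  \<comment> \<open>The first summand accounts for the discrete solution, which is Lipschitz in time, the second for the solution.\<close>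
  define n where "n s = 2 * M\<^sup>2 * s + 2 * A * \<Gamma> s" for s
  have "stiffness N p q (x t) (x t) \<le> stiffness N p q (x 0) (x 0) + (9 * A * h) / 2 * (\<Gamma> t - \<Gamma> 0)"
  proof (rule energy_estimate[where n = n and h = h])
    fix a b :: real and j assume ab: "0 \<le> a" "a \<le> b" "b \<le> t" and j: "j \<le> N"
    have "(x b j - x a j)\<^sup>2 = ((lh b (grid h j) - lh a (grid h j)) - (u b (grid h j) - u a (grid h j)))\<^sup>2"
      by (simp add: x_def algebra_simps)
    also have "\<dots> \<le> 2 * (lh b (grid h j) - lh a (grid h j))\<^sup>2 + 2 * (u b (grid h j) - u a (grid h j))\<^sup>2"
      using square_add_le[of "lh b (grid h j) - lh a (grid h j)" "- (u b (grid h j) - u a (grid h j))"]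
      by (simp only: power2_minus diff_conv_add_uminus)
    also have "\<dots> \<le> 2 * (M * (b - a))\<^sup>2 + 2 * (A * ((b - a) * (\<Gamma> b - \<Gamma> a)))"
    proof -
      have "(lh b (grid h j) - lh a (grid h j))\<^sup>2 \<le> (M * (b - a))\<^sup>2"
        using power_mono[OF lip[OF j ab], of 2] by simp
      then show ?thesis using mod[OF ab node[OF j]] by linarith
    qed
    also have "\<dots> = (b - a) * (n b - n a)"
      by (simp add: n_def power2_eq_square algebra_simps)
    finally show "(x b j - x a j)\<^sup>2 \<le> (b - a) * (n b - n a)" .
  next
    fix a b :: real assume ab: "0 \<le> a" "a \<le> b" "b \<le> t"
    show "\<Gamma> a \<le> \<Gamma> b" by (rule \<Gamma>(2)[OF ab])
    show "n a \<le> n b"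
      unfolding n_def using ab A \<Gamma>(2)[OF ab] by (intro add_mono mult_left_mono) auto
    \<comment> \<open>The test function has the increment of \<open>x\<close> as its nodal vector.\<close>
    define z where "z j = x b j - x a j" for j
    have "z N = 0" using AN lhV[of a] lhV[of b] uA[of a] uA[of b] ab by (simp add: z_def x_def Vh_def)
    then obtain v where v: "v \<in> Vh A N" and vz: "\<And>j. j \<le> N \<Longrightarrow> v (grid h j) = z j"
      using Vh_interpolant[OF h A N] by blast
    have stz: "stiffness N p q y (\<lambda>j. v (grid h j)) = stiffness N p q y z" for y
      unfolding stiffness_def using vz vz[of 0] by simp
    have sz: "(\<Sum>j<N. f j * v (grid h j)) = (\<Sum>j<N. f j * z j)" for f
      by (rule sum.cong) (use vz in auto)
    define S1 where "S1 s = - (A / 2) * deriv (L0 L \<omega> \<epsilon>) s * v 0 - stiffness N p q (\<lambda>j. lh s (grid h j)) z" for s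
    define S2 where "S2 s = - (A / 2) * deriv (L0 L \<omega> \<epsilon>) s * v 0 - stiffness N p q (\<lambda>j. u s (grid h j)) z" for s
    have c2: "continuous_on {0..t} S2"
      unfolding S2_def deriv_L0 by (intro continuous_intros stiffness_continuous cu node) auto
    have "continuous_on {a..b} S2" by (rule continuous_on_subset[OF c2]) (use ab in auto)
    then have i2: "(S2 has_integral integral {a..b} S2) {a..b}"
      by (intro integrable_integral integrable_continuous_interval)
    have i1: "(S1 has_integral h * (\<Sum>j<N. (lh b (grid h j) - lh a (grid h j)) * z j)) {a..b}"
      using discrete_equation[OF A h N disc v ab(1,2)]
      by (simp add: S1_def[abs_def] p_def[symmetric] q_def[symmetric] stz sz)
    have e2: "integral {0..A} (\<lambda>y. (u b y - u a y) * v y) = integral {a..b} S2"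
      using continuous_equation[OF A h N t sol repr u cu v ab]
      by (simp add: S2_def[abs_def] p_def[symmetric] q_def[symmetric] stz)
    have "((\<lambda>s. S2 s - S1 s) has_integral
        (integral {a..b} S2 - h * (\<Sum>j<N. (lh b (grid h j) - lh a (grid h j)) * z j))) {a..b}"
      by (rule has_integral_diff[OF i2 i1])
    moreover have "S2 s - S1 s = stiffness N p q (x s) z" for s
      unfolding x_def stiffness_diff_left by (simp add: S1_def S2_def)
    ultimately have I: "integral {a..b} (\<lambda>s. stiffness N p q (x s) z)
        = integral {a..b} S2 - h * (\<Sum>j<N. (lh b (grid h j) - lh a (grid h j)) * z j)"
      by (simp add: has_integral_iff)
    \<comment> \<open>The difference of the two equations leaves the lumping error of the increment of \<open>u\<close>.\<close>
    have "h * (\<Sum>j<N. (z j)\<^sup>2) = h * (\<Sum>j<N. (lh b (grid h j) - lh a (grid h j)) * z j)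
        - h * (\<Sum>j<N. (u b (grid h j) - u a (grid h j)) * z j)"
      unfolding right_diff_distrib[symmetric] sum_subtractf[symmetric] left_diff_distrib[symmetric]
      by (simp add: z_def x_def power2_eq_square algebra_simps)
    then have "h * (\<Sum>j<N. (z j)\<^sup>2) + integral {a..b} (\<lambda>s. stiffness N p q (x s) z)
      = integral {0..A} (\<lambda>y. (u b y - u a y) * v y) - h * (\<Sum>j<N. (u b (grid h j) - u a (grid h j)) * v (grid h j))"
      unfolding I e2 sz by simp
    then have "(h * (\<Sum>j<N. (z j)\<^sup>2) + integral {a..b} (\<lambda>s. stiffness N p q (x s) z))\<^sup>2
      \<le> 9 * A * h * integral {0..A} (\<lambda>y. (H a b y)\<^sup>2) * (h * (\<Sum>j<N. (v (grid h j))\<^sup>2))"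
      using lumping_error[OF v h A N H(1)[OF ab], of "\<lambda>y. u b y - u a y", OF H(3)[OF ab]] uA[of a] uA[of b] ab
      by simp
    also have "(\<Sum>j<N. (v (grid h j))\<^sup>2) = (\<Sum>j<N. (z j)\<^sup>2)" by (rule sum.cong) (use vz in auto)
    also have "9 * A * h * integral {0..A} (\<lambda>y. (H a b y)\<^sup>2) * (h * (\<Sum>j<N. (z j)\<^sup>2))
      \<le> 9 * A * h * ((b - a) * (\<Gamma> b - \<Gamma> a)) * (h * (\<Sum>j<N. (z j)\<^sup>2))"
      using H(2)[OF ab] A h0 by (intro mult_right_mono mult_left_mono mult_nonneg_nonneg sum_nonneg) auto
    finally show "(h * (\<Sum>j<N. (x b j - x a j)\<^sup>2) + integral {a..b} (\<lambda>s. stiffness N p q (x s) (\<lambda>j. x b j - x a j)))\<^sup>2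
        \<le> 9 * A * h * (b - a) * (\<Gamma> b - \<Gamma> a) * (h * (\<Sum>j<N. (x b j - x a j)\<^sup>2))"
      by (simp add: z_def[abs_def] mult.assoc)
  qed (use t pq h0 A cx in auto)
  then show ?thesis by (simp add: E_def p_def q_def \<Gamma>(1))
qed

text \<open>The derivative of the error is the sum of \<open>slope h N (x t)\<close> and of the interpolation error of \<open>D t\<close>. The first
  is bounded by the energy; the energy at time \<open>0\<close> is bounded by the initial error, since the means over the
  elements of \<open>d0\<close> are the slopes of \<open>x 0\<close>.\<close>

lemma error_estimate:
  fixes A K ta a1 :: real
  defines "C \<equiv> 2 + 2 * (1 + ta / (2 * a1)) + 2 * (9 / (2 * A * K))"
  assumes A: "A > 0" and K: "K > 0" and ta: "ta > 0" and a1: "a1 > 0"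
    and h: "h = A / real N" and N: "N \<ge> 1" and t: "t > 0"
    and sol: "weak_solution A K ta a1 L \<omega> \<epsilon> l0 l"
    and disc: "discrete_solution A K ta a1 L \<omega> \<epsilon> N l0h lh"
    and g: "g \<in> L2 ({0<..<A} \<times> {0<..<t})"
      "weak_deriv ({0<..<A} \<times> {0<..<t}) [(1, 0), (0, 1)] (\<lambda>(y, s). l s y) g"
    and d0: "d0 \<in> L2 {0<..<A}" "weak_deriv {0<..<A} [1] (\<lambda>y. l0h y - l0 y) d0"
    and d2: "d2 \<in> L2 {0<..<A}" "weak_deriv {0<..<A} [1, 1] (l t) d2"
  obtains e where "e \<in> L2 {0<..<A}" "weak_deriv {0<..<A} [1] (\<lambda>y. lh t y - l t y) e"
    "L2_norm {0<..<A} e \<le> C * (h * L2_norm {0<..<A} d2 + L2_norm {0<..<A} d0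
       + sqrt h * sqrt (LINT s|lebesgue_on {0<..<t}. (L2_norm {0<..<A} (\<lambda>y. g (y, s)))\<^sup>2))"
proof -
  let ?I = "{0<..<A}"
  note h0 = grid_facts(1)[OF A h N] and AN = grid_facts(2)[OF A h N] and node = grid_facts(3)[OF A h N]
  obtain \<Gamma> H u D where tr: "trajectory A t l \<Gamma> H u D"
    and \<Gamma>g: "\<Gamma> t = (LINT s|lebesgue_on {0<..<t}. (L2_norm {0<..<A} (\<lambda>y. g (y, s)))\<^sup>2)"
    by (rule weak_solution_trajectory[OF A t sol g(2,1)])
  note \<Gamma> = trajectoryD(1,2)[OF tr] and H = trajectoryD(3-5)[OF tr] and repr = trajectoryD(6)[OF tr]
    and u = trajectoryD(7)[OF tr] and uA = trajectoryD(8)[OF tr]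
  define x where "x s j = lh s (grid h j) - u s (grid h j)" for s j
  define p where "p = A\<^sup>2 * K / h"
  define q where "q = A * K * ta / (2 * a1)"
  have q0: "0 \<le> q" using A K ta a1 by (simp add: q_def)
  define S where "S s = (\<Sum>j<N. (x s (Suc j) - x s j)\<^sup>2) / h" for s
  have stiff: "stiffness N p q (x s) (x s) = A\<^sup>2 * K * S s + q * (x s 0)\<^sup>2" for s
    by (simp add: stiffness_def p_def S_def power2_eq_square)
  have energy: "stiffness N p q (x t) (x t) \<le> stiffness N p q (x 0) (x 0) + 9 * A * h / 2 * \<Gamma> t"
    using nodal_energy_bound[OF A K ta a1 h N t sol disc tr]
    by (simp add: x_def[abs_def] p_def q_def)
  define E0 where "E0 = integral {0..A} (\<lambda>y. (d0 y)\<^sup>2)"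
  define E2 where "E2 = integral {0..A} (\<lambda>y. (d2 y)\<^sup>2)"
  have d0i: "(\<lambda>y. (d0 y)\<^sup>2) integrable_on {0..A}" and d2i: "(\<lambda>y. (d2 y)\<^sup>2) integrable_on {0..A}"
    using d0(1) d2(1) by (simp_all add: L2_Ioo_iff absolutely_integrable_on_def)
  have E0: "0 \<le> E0" and E2: "0 \<le> E2"
    unfolding E0_def E2_def using d0i d2i by (auto intro: integral_nonneg)
  have \<Gamma>t: "0 \<le> \<Gamma> t" using \<Gamma>(2)[of 0 t] \<Gamma>(1) t by simp
  have lhV: "lh s \<in> Vh A N" if "s \<ge> 0" for s using disc that by (simp add: discrete_solution_def)

  have init: "S 0 \<le> E0 \<and> (x 0 0)\<^sup>2 \<le> A * E0"
  proof -
    have zI: "0 \<in> {0..t}" using t by simp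
    define w where "w y = lh 0 y - u 0 y" for y
    have "{y \<in> ?I. l0h y - l0 y \<noteq> lh 0 y - l 0 y} \<subseteq> {y \<in> ?I. l 0 y \<noteq> l0 y}"
      using disc by (auto simp: discrete_solution_def)
    moreover have "negligible {y \<in> ?I. l 0 y \<noteq> l0 y}"
      using sol by (simp add: weak_solution_def AE_lebesgue_on_iff)
    ultimately have "negligible {y \<in> ?I. l0h y - l0 y \<noteq> lh 0 y - l 0 y}" by (rule negligible_subset[rotated])
    then have "weak_deriv ?I [1] (\<lambda>y. lh 0 y - l 0 y) d0"
      by (rule weak_deriv_AE_cong[rotated, OF _ _ d0(2)]) simp_all
    from has_reprE[OF this d0(1) A] obtain c where c: "has_repr A (\<lambda>y. lh 0 y - l 0 y) c d0" by blast
    have lr: "has_repr A (lh 0) (lh 0 0) (slope h N (\<lambda>j. lh 0 (grid h j)))"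
      by (rule Vh_repr[OF lhV[OF order_refl] h A N])
    have w: "w y = c + integral {0..y} d0" if y: "y \<in> {0..A}" for y
    proof -
      have "lh 0 0 - u 0 0 + integral {0..y} (\<lambda>y. slope h N (\<lambda>j. lh 0 (grid h j)) y - D 0 y) = c + integral {0..y} d0"
        by (rule has_repr_value_unique[OF has_repr_diff[OF lr repr[OF zI]] c A y])
      moreover have "integral {0..y} (\<lambda>y. slope h N (\<lambda>j. lh 0 (grid h j)) y - D 0 y)
          = integral {0..y} (slope h N (\<lambda>j. lh 0 (grid h j))) - integral {0..y} (D 0)"
        using has_repr_abs[OF lr] has_repr_abs[OF repr[OF zI]] y
        by (intro integral_diff) (auto simp: absolutely_integrable_on_def intro: integrable_on_subinterval)
      ultimately show ?thesis
        using Vh_primitive[OF lhV[OF order_refl] h A N y] u[OF zI y] by (simp add: w_def)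
    qed
    have wA: "w A = 0" using uA[OF zI] lhV[of 0] by (simp add: w_def Vh_def)
    have xw: "x 0 j = w (grid h j)" for j by (simp add: x_def w_def)
    have "(x 0 0)\<^sup>2 \<le> A * E0"
      using vanishing_at_end_bound[OF A d0(1) w wA, of 0] A by (simp add: xw E0_def)
    moreover have "S 0 \<le> E0"
    proof -
      have d0a: "d0 absolutely_integrable_on {0..A}" using d0(1) by (simp add: L2_Ioo_iff)
      have "(x 0 (Suc j) - x 0 j)\<^sup>2 \<le> h * integral {grid h j..grid h (Suc j)} (\<lambda>y. (d0 y)\<^sup>2)" if j: "j < N" for j
      proof -
        have nn: "0 \<le> grid h j" "grid h j \<le> grid h (Suc j)" "grid h (Suc j) \<le> A"
          using node[of j] node[of "Suc j"] j h0 by (auto simp: grid_Suc)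
        have "\<bar>w (grid h (Suc j)) - w (grid h j)\<bar> \<le> integral {grid h j..grid h (Suc j)} (\<lambda>y. \<bar>d0 y\<bar>)"
          using primitive_increment_bound[OF d0a nn(1) order_refl nn(2) order_refl nn(3)]
            w[of "grid h j"] w[of "grid h (Suc j)"] nn by simp
        from power_mono[OF this, of 2]
        have "(x 0 (Suc j) - x 0 j)\<^sup>2 \<le> (integral {grid h j..grid h (Suc j)} (\<lambda>y. \<bar>d0 y\<bar>))\<^sup>2" by (simp add: xw)
        also have "\<dots> \<le> h * integral {grid h j..grid h (Suc j)} (\<lambda>y. (d0 y)\<^sup>2)"
          using abs_integral_square[OF d0(1) nn] by (simp add: grid_Suc)
        finally show ?thesis .
      qed
      then have "(\<Sum>j<N. (x 0 (Suc j) - x 0 j)\<^sup>2) \<le> (\<Sum>j<N. h * integral {grid h j..grid h (Suc j)} (\<lambda>y. (d0 y)\<^sup>2))"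
        by (intro sum_mono) auto
      also have "\<dots> = h * E0"
        using integral_elements[of h "\<lambda>y. (d0 y)\<^sup>2" N] h0 AN d0i by (simp add: sum_distrib_left E0_def)
      finally show ?thesis using h0 by (simp add: S_def divide_simps mult.commute)
    qed
    ultimately show ?thesis by simp
  qed
  \<comment> \<open>The coefficients that result from dividing the energy inequality by \<open>A\<^sup>2 K\<close>, as \<open>q A / (A\<^sup>2 K) = ta / (2 a1)\<close>.\<close>
  define \<alpha> where "\<alpha> = 1 + ta / (2 * a1)"
  define \<beta> where "\<beta> = 9 / (2 * A * K)"
  have C: "C = 2 + 2 * \<alpha> + 2 * \<beta>" by (simp only: C_def \<alpha>_def \<beta>_def)
  have ab0: "0 \<le> \<alpha>" "0 \<le> \<beta>" using A K ta a1 by (simp_all add: \<alpha>_def \<beta>_def)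
  have St: "S t \<le> \<alpha> * E0 + \<beta> * (h * \<Gamma> t)"
  proof -
    have "A\<^sup>2 * K * S t \<le> stiffness N p q (x t) (x t)" unfolding stiff using q0 by simp
    also have "\<dots> \<le> A\<^sup>2 * K * S 0 + q * (x 0 0)\<^sup>2 + 9 * A * h / 2 * \<Gamma> t" using energy unfolding stiff .
    also have "\<dots> \<le> A\<^sup>2 * K * E0 + q * (A * E0) + 9 * A * h / 2 * \<Gamma> t"
      using init A K q0 by (intro add_right_mono add_mono mult_left_mono) auto
    also have "\<dots> = A\<^sup>2 * K * (\<alpha> * E0 + \<beta> * (h * \<Gamma> t))"
      using A K a1 by (simp add: \<alpha>_def \<beta>_def q_def field_simps power2_eq_square)
    finally show ?thesis using A K by simp
  qed

  have tI: "t \<in> {0..t}" using t by simp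
  have lt: "weak_deriv ?I [1] (l t) (D t)" by (rule has_repr_weak_deriv[OF repr[OF tI] A])
  have DL: "D t \<in> L2 ?I" using repr[OF tI] by (simp add: has_repr_def)
  have "weak_deriv ?I [1] (D t) d2"
    unfolding weak_deriv_real_iff[OF A]
  proof (intro conjI ballI)
    show "locally_integrable ?I (D t)" using lt by (simp add: weak_deriv_def)
    show l2: "locally_integrable ?I d2" using d2(2) by (simp only: weak_deriv_def)
    fix \<phi> :: "real \<Rightarrow> real" assume \<phi>: "\<phi> \<in> test_functions ?I"
    let ?d = "iter_partial [1] \<phi>"
    have dd: "iter_partial [1, 1] \<phi> = iter_partial [1] ?d"
      using iter_partial_append[of "[1]" "[1]" \<phi>] by simp
    have "integral ?I (\<lambda>y. l t y * iter_partial [1] ?d y) = - integral ?I (\<lambda>y. D t y * ?d y)"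
      by (rule weak_derivD[OF lt A test_function_deriv[OF \<phi> A]])
    moreover have "(LINT y|lebesgue_on ?I. l t y * iter_partial [1, 1] \<phi> y)
        = (- 1) ^ length [1::real, 1] * (LINT y|lebesgue_on ?I. d2 y * \<phi> y)"
      using d2(2) \<phi> unfolding weak_deriv_def by blast
    moreover have "(LINT y|lebesgue_on ?I. l t y * iter_partial [1, 1] \<phi> y) = integral ?I (\<lambda>y. l t y * iter_partial [1] ?d y)"
      unfolding dd using lt test_function_deriv[OF test_function_deriv[OF \<phi> A] A]
      by (intro LINT_lebesgue_on locally_integrable_test[OF _ _ A]) (simp_all only: weak_deriv_def, simp)
    moreover have "(LINT y|lebesgue_on ?I. d2 y * \<phi> y) = integral ?I (\<lambda>y. d2 y * \<phi> y)"
      by (intro LINT_lebesgue_on locally_integrable_test[OF l2 \<phi> A]) simp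
    ultimately show "integral ?I (\<lambda>y. D t y * ?d y) = - integral ?I (\<lambda>y. d2 y * \<phi> y)"
      by simp
  qed
  from has_reprE[OF this d2(1) A] obtain c2 where c2: "has_repr A (D t) c2 d2" by blast
  \<comment> \<open>The nodal vector of the interpolant of \<open>l t\<close>.\<close>
  define w where "w j = u t (grid h j)" for j
  have wD: "w (Suc j) - w j = integral {grid h j..grid h (Suc j)} (D t)" if j: "j < N" for j
  proof -
    have nn: "0 \<le> grid h j" "grid h j \<le> grid h (Suc j)" "grid h (Suc j) \<le> A"
      using node[of j] node[of "Suc j"] j h0 by (auto simp: grid_Suc)
    have "D t integrable_on {0..A}" using DL by (simp add: L2_Ioo_iff absolutely_integrable_on_def)
    then have "D t integrable_on {0..grid h (Suc j)}" by (rule integrable_on_subinterval) (use nn in auto)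
    from Henstock_Kurzweil_Integration.integral_combine[OF nn(1,2) this]
    show ?thesis using u[OF tI, of "grid h j"] u[OF tI, of "grid h (Suc j)"] nn by (simp add: w_def)
  qed
  have interp: "integral {0..A} (\<lambda>y. (slope h N w y - D t y)\<^sup>2) \<le> h\<^sup>2 * E2"
    unfolding E2_def by (rule interpolation_error[OF DL c2 h A N wD])

  define e where "e y = slope h N (\<lambda>j. lh t (grid h j)) y - D t y" for y
  have t0: "0 \<le> t" using t by simp
  have er: "has_repr A (\<lambda>y. lh t y - l t y) (lh t 0 - u t 0) e"
    unfolding e_def by (rule has_repr_diff[OF Vh_repr[OF lhV[OF t0] h A N] repr[OF tI]])
  have eL: "e \<in> L2 ?I" using er by (simp add: has_repr_def)
  have split: "e y = slope h N (x t) y + (slope h N w y - D t y)" for y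
    using slope_diff[of h N "\<lambda>j. lh t (grid h j)" w y] by (simp add: e_def x_def[abs_def] w_def)
  have i1: "(\<lambda>y. (slope h N (x t) y)\<^sup>2) integrable_on {0..A}"
    using slope_L2[of h N "x t" A] by (simp add: L2_Ioo_iff absolutely_integrable_on_def)
  have wu: "has_repr A (\<lambda>y. integral {0..y} (slope h N w) - l t y) (0 - u t 0) (\<lambda>y. slope h N w y - D t y)"
    by (rule has_repr_diff[OF _ repr[OF tI]]) (simp add: has_repr_def slope_L2)
  have i2: "(\<lambda>y. (slope h N w y - D t y)\<^sup>2) integrable_on {0..A}"
    using wu by (simp add: has_repr_def L2_Ioo_iff absolutely_integrable_on_def)
  have "integral {0..A} (\<lambda>y. (e y)\<^sup>2)
      \<le> integral {0..A} (\<lambda>y. 2 * (slope h N (x t) y)\<^sup>2 + 2 * (slope h N w y - D t y)\<^sup>2)"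
  proof (rule integral_le)
    show "(\<lambda>y. (e y)\<^sup>2) integrable_on {0..A}" using eL by (simp add: L2_Ioo_iff absolutely_integrable_on_def)
    show "(\<lambda>y. 2 * (slope h N (x t) y)\<^sup>2 + 2 * (slope h N w y - D t y)\<^sup>2) integrable_on {0..A}"
      by (intro integrable_add integrable_on_mult_right i1 i2)
    show "(e y)\<^sup>2 \<le> 2 * (slope h N (x t) y)\<^sup>2 + 2 * (slope h N w y - D t y)\<^sup>2" for y
      unfolding split by (rule square_add_le)
  qed
  also have "\<dots> = 2 * integral {0..A} (\<lambda>y. (slope h N (x t) y)\<^sup>2) + 2 * integral {0..A} (\<lambda>y. (slope h N w y - D t y)\<^sup>2)"
    by (subst integral_add) (intro integrable_on_mult_right i1 i2 | simp)+
  also have "integral {0..A} (\<lambda>y. (slope h N (x t) y)\<^sup>2) = S t"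
    using slope_product_integral[OF h0, of N "x t" "x t"] AN by (simp add: S_def power2_eq_square)
  also have "2 * S t + 2 * integral {0..A} (\<lambda>y. (slope h N w y - D t y)\<^sup>2)
      \<le> 2 * (\<alpha> * E0 + \<beta> * (h * \<Gamma> t)) + 2 * (h\<^sup>2 * E2)"
    by (intro add_mono mult_left_mono St interp) simp_all
  also have "\<dots> \<le> C * (E0 + h * \<Gamma> t + h\<^sup>2 * E2)"
  proof -
    have "2 * \<alpha> \<le> C" "2 * \<beta> \<le> C" "2 \<le> C" using ab0 C by linarith+
    then have "2 * \<alpha> * E0 \<le> C * E0" "2 * \<beta> * (h * \<Gamma> t) \<le> C * (h * \<Gamma> t)" "2 * (h\<^sup>2 * E2) \<le> C * (h\<^sup>2 * E2)"
      using E0 E2 \<Gamma>t h0 by (intro mult_right_mono; simp)+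
    then show ?thesis by (simp add: distrib_left)
  qed
  also have "\<dots> \<le> C\<^sup>2 * (h * sqrt E2 + sqrt E0 + sqrt h * sqrt (\<Gamma> t))\<^sup>2"
  proof (rule mult_mono)
    have "1 \<le> C" using ab0 C by linarith
    then show "C \<le> C\<^sup>2" by (simp add: power2_eq_square)
    have "0 \<le> a * b" "0 \<le> a * c" "0 \<le> b * c" if "0 \<le> a" "0 \<le> b" "0 \<le> c" for a b c :: real using that by simp_all
    then have "a\<^sup>2 + b\<^sup>2 + c\<^sup>2 \<le> (a + b + c)\<^sup>2" if "0 \<le> a" "0 \<le> b" "0 \<le> c" for a b c :: real
      using that by (simp add: power2_eq_square algebra_simps)
    from this[of "h * sqrt E2" "sqrt E0" "sqrt h * sqrt (\<Gamma> t)"]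
    show "E0 + h * \<Gamma> t + h\<^sup>2 * E2 \<le> (h * sqrt E2 + sqrt E0 + sqrt h * sqrt (\<Gamma> t))\<^sup>2"
      using E0 E2 \<Gamma>t h0 by (simp add: power_mult_distrib)
  qed (use E0 E2 \<Gamma>t h0 in auto)
  also have "\<dots> = (C * (h * sqrt E2 + sqrt E0 + sqrt h * sqrt (\<Gamma> t)))\<^sup>2" by (simp add: power_mult_distrib)
  finally have fin: "integral {0..A} (\<lambda>y. (e y)\<^sup>2) \<le> (C * (h * sqrt E2 + sqrt E0 + sqrt h * sqrt (\<Gamma> t)))\<^sup>2" .
  have C0: "0 \<le> C" using ab0 C by linarith
  have "0 \<le> C * (h * sqrt E2 + sqrt E0 + sqrt h * sqrt (\<Gamma> t))"
    using C0 E0 E2 \<Gamma>t h0 by simp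
  then have "sqrt (integral {0..A} (\<lambda>y. (e y)\<^sup>2)) \<le> C * (h * sqrt E2 + sqrt E0 + sqrt h * sqrt (\<Gamma> t))"
    using real_sqrt_le_mono[OF fin] by simp
  then have "L2_norm ?I e \<le> C * (h * L2_norm ?I d2 + L2_norm ?I d0
       + sqrt h * sqrt (LINT s|lebesgue_on {0<..<t}. (L2_norm ?I (\<lambda>y. g (y, s)))\<^sup>2))"
    unfolding L2_norm_eq[OF eL] L2_norm_eq[OF d2(1)] L2_norm_eq[OF d0(1)] \<Gamma>g[symmetric]
    by (simp add: E0_def E2_def)
  with eL has_repr_weak_deriv[OF er A] show thesis by (rule that)
qed

text \<open>Allows to choose the weak derivatives that enter the right-hand side of the estimate one at a time. If there is none,
  the infimum is \<open>\<infinity>\<close>, and so is its product with the positive number \<open>r\<close>.\<close>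

lemma ennreal_le_mult_INF:
  fixes X R :: ennreal
  assumes r: "r > 0" and le: "\<And>i. i \<in> S \<Longrightarrow> X \<le> R + ennreal r * F i"
  shows "X \<le> R + ennreal r * (INF i\<in>S. F i)"
proof (cases "R = top")
  case False
  have inv: "ennreal (1 / r) * (ennreal r * y) = y" "ennreal r * (ennreal (1 / r) * y) = y" for y
    using r by (simp_all add: mult.assoc[symmetric] ennreal_mult[symmetric])
  have "ennreal (1 / r) * (X - R) \<le> (INF i\<in>S. F i)"
  proof (rule INF_greatest)
    fix i assume "i \<in> S"
    then have "X - R \<le> ennreal r * F i"
      using le False by (simp add: ennreal_minus_le_iff)
    from mult_left_mono[OF this, of "ennreal (1 / r)"] show "ennreal (1 / r) * (X - R) \<le> F i"
      by (simp only: inv) simp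
  qed
  from mult_left_mono[OF this, of "ennreal r"]
  have "X - R \<le> ennreal r * (INF i\<in>S. F i)" by (simp only: inv) simp
  then show ?thesis by (simp add: ennreal_minus_le_iff)
qed simp

lemma deriv_norm_le:
  "g \<in> L2 \<Omega> \<Longrightarrow> weak_deriv \<Omega> bs u g \<Longrightarrow> deriv_norm \<Omega> bs u \<le> ennreal (L2_norm \<Omega> g)"
  unfolding deriv_norm_def by (rule INF_lower) simp

lemma deriv_norm_AE_mono:
  assumes "\<Omega> \<in> sets lebesgue" "negligible {x \<in> \<Omega>. u x \<noteq> v x}"
  shows "deriv_norm \<Omega> bs v \<le> deriv_norm \<Omega> bs u"
  unfolding deriv_norm_def
proof (rule INF_superset_mono[OF _ order_refl])
  show "{g \<in> L2 \<Omega>. weak_deriv \<Omega> bs u g} \<subseteq> {g \<in> L2 \<Omega>. weak_deriv \<Omega> bs v g}"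
  proof safe
    fix g assume "weak_deriv \<Omega> bs u g"
    then show "weak_deriv \<Omega> bs v g"
      by (rule weak_deriv_AE_cong[OF assms, rotated]) simp
  qed
qed

theorem theorem3p2:
  fixes \<Lambda> K ta a1 :: real
  assumes "\<Lambda> > 0" "K > 0" "ta > 0" "a1 > 0"
  shows "\<exists>C::real. C > 0 \<and>
    (\<forall>(L::real) (\<omega>::real) (\<epsilon>::real) (l0::real \<Rightarrow> real) (l::real \<Rightarrow> real \<Rightarrow> real)
       (N::nat) (l0h::real \<Rightarrow> real) (lh::real \<Rightarrow> real \<Rightarrow> real).
       L > 0 \<and> \<omega> > 0 \<and> \<epsilon> \<in> {0..<1} \<and>
       l0 \<in> L2 {0<..<\<Lambda>} \<and> weak_solution \<Lambda> K ta a1 L \<omega> \<epsilon> l0 l \<and>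
       N \<ge> 1 \<and> l0h \<in> Vh \<Lambda> N \<and> discrete_solution \<Lambda> K ta a1 L \<omega> \<epsilon> N l0h lh \<longrightarrow>
       (let h = \<Lambda> / real N in
         \<forall>t\<ge>0.
           deriv_norm {0<..<\<Lambda>} [1] (\<lambda>y. lh t y - l t y)
             \<le> ennreal (C * h) * (deriv_norm {0<..<\<Lambda>} [1, 1] l0 + deriv_norm {0<..<\<Lambda>} [1, 1] (l t))
               + ennreal C * deriv_norm {0<..<\<Lambda>} [1] (\<lambda>y. l0h y - l0 y)
               + ennreal (C * sqrt h) * mixed_deriv_norm \<Lambda> t l))"
proof -
  define C where "C = 2 + 2 * (1 + ta / (2 * a1)) + 2 * (9 / (2 * \<Lambda> * K))"
  have "0 < ta / (2 * a1)" "0 < 9 / (2 * \<Lambda> * K)" using assms by simp_all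
  then have C: "1 \<le> C" unfolding C_def by argo
  show ?thesis
  proof (intro exI[of _ C] conjI allI impI)
    show "C > 0" using C by simp
    fix L \<omega> \<epsilon> :: real and l0 :: "real \<Rightarrow> real" and l :: "real \<Rightarrow> real \<Rightarrow> real"
      and N :: nat and l0h :: "real \<Rightarrow> real" and lh :: "real \<Rightarrow> real \<Rightarrow> real"
    assume asm: "L > 0 \<and> \<omega> > 0 \<and> \<epsilon> \<in> {0..<1} \<and>
       l0 \<in> L2 {0<..<\<Lambda>} \<and> weak_solution \<Lambda> K ta a1 L \<omega> \<epsilon> l0 l \<and>
       N \<ge> 1 \<and> l0h \<in> Vh \<Lambda> N \<and> discrete_solution \<Lambda> K ta a1 L \<omega> \<epsilon> N l0h lh"
    then have sol: "weak_solution \<Lambda> K ta a1 L \<omega> \<epsilon> l0 l" and N: "N \<ge> 1"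
      and disc: "discrete_solution \<Lambda> K ta a1 L \<omega> \<epsilon> N l0h lh" by auto
    let ?I = "{0<..<\<Lambda>}"
    define h where "h = \<Lambda> / real N"
    have h0: "h > 0" unfolding h_def using assms N by simp
    have "deriv_norm ?I [1] (\<lambda>y. lh t y - l t y)
             \<le> ennreal (C * h) * (deriv_norm ?I [1, 1] l0 + deriv_norm ?I [1, 1] (l t))
               + ennreal C * deriv_norm ?I [1] (\<lambda>y. l0h y - l0 y)
               + ennreal (C * sqrt h) * mixed_deriv_norm \<Lambda> t l" (is "?X \<le> ?R") if t: "t \<ge> 0" for t
    \<comment> \<open>At \<open>t = 0\<close> the error is the initial error. The mixed derivative, on an empty rectangle, carries no information.\<close>
    proof (cases "t = 0")
      case True
      have "{y \<in> ?I. l0h y - l0 y \<noteq> lh 0 y - l 0 y} \<subseteq> {y \<in> ?I. l 0 y \<noteq> l0 y}"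
        using disc by (auto simp: discrete_solution_def)
      moreover have "negligible {y \<in> ?I. l 0 y \<noteq> l0 y}"
        using sol by (simp add: weak_solution_def AE_lebesgue_on_iff)
      ultimately have "negligible {y \<in> ?I. l0h y - l0 y \<noteq> lh 0 y - l 0 y}" by (rule negligible_subset[rotated])
      then have "?X \<le> deriv_norm ?I [1] (\<lambda>y. l0h y - l0 y)"
        unfolding True by (intro deriv_norm_AE_mono) simp_all
      also have "\<dots> = 1 * deriv_norm ?I [1] (\<lambda>y. l0h y - l0 y)" by simp
      also have "\<dots> \<le> ennreal C * deriv_norm ?I [1] (\<lambda>y. l0h y - l0 y)"
        using C by (intro mult_right_mono) auto
      also have "\<dots> \<le> ?R" by (simp add: add_increasing add_increasing2)
      finally show ?thesis .
    next
      case False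
      with t have t: "t > 0" by simp
      have "?X \<le> ennreal (C * h) * deriv_norm ?I [1, 1] (l t)
               + ennreal C * deriv_norm ?I [1] (\<lambda>y. l0h y - l0 y)
               + ennreal (C * sqrt h) * mixed_deriv_norm \<Lambda> t l"
        unfolding mixed_deriv_norm_def
      proof (rule ennreal_le_mult_INF)
        show "0 < C * sqrt h" using C h0 by simp
        fix g assume g: "g \<in> {g \<in> L2 (?I \<times> {0<..<t}). weak_deriv (?I \<times> {0<..<t}) [(1, 0), (0, 1)] (\<lambda>(y, s). l s y) g}"
        define \<gamma> where "\<gamma> = sqrt (LINT s|lebesgue_on {0<..<t}. (L2_norm ?I (\<lambda>y. g (y, s)))\<^sup>2)"
        have "?X \<le> (ennreal (C * sqrt h) * ennreal \<gamma> + ennreal (C * h) * deriv_norm ?I [1, 1] (l t))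
               + ennreal C * deriv_norm ?I [1] (\<lambda>y. l0h y - l0 y)"
          unfolding deriv_norm_def[of ?I "[1]" "\<lambda>y. l0h y - l0 y"]
        proof (rule ennreal_le_mult_INF)
          show "0 < C" using C by simp
          fix d0 assume d0: "d0 \<in> {g \<in> L2 ?I. weak_deriv ?I [1] (\<lambda>y. l0h y - l0 y) g}"
          have "?X \<le> (ennreal (C * sqrt h) * ennreal \<gamma> + ennreal C * ennreal (L2_norm ?I d0))
              + ennreal (C * h) * deriv_norm ?I [1, 1] (l t)"
            unfolding deriv_norm_def[of ?I "[1, 1]"]
          proof (rule ennreal_le_mult_INF)
            show "0 < C * h" using C h0 by simp
            fix d2 assume d2: "d2 \<in> {g \<in> L2 ?I. weak_deriv ?I [1, 1] (l t) g}"
            obtain e where e: "e \<in> L2 ?I" "weak_deriv ?I [1] (\<lambda>y. lh t y - l t y) e"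
              "L2_norm ?I e \<le> C * (h * L2_norm ?I d2 + L2_norm ?I d0 + sqrt h * \<gamma>)"
              unfolding C_def \<gamma>_def
              by (rule error_estimate[OF assms h_def N t sol disc, of g d0 d2]) (use g d0 d2 in auto)
            have nn: "0 \<le> \<gamma>" "0 \<le> L2_norm ?I f" for f
              by (simp_all add: \<gamma>_def L2_norm_def)
            have "?X \<le> ennreal (L2_norm ?I e)" by (rule deriv_norm_le[OF e(1,2)])
            also have "\<dots> \<le> ennreal (C * sqrt h * \<gamma> + C * L2_norm ?I d0 + C * h * L2_norm ?I d2)"
              using e(3) by (intro ennreal_leI) (simp add: algebra_simps)
            also have "\<dots> = ennreal (C * sqrt h) * ennreal \<gamma> + ennreal C * ennreal (L2_norm ?I d0)
                + ennreal (C * h) * ennreal (L2_norm ?I d2)"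
              using C h0 nn by (simp add: ennreal_plus ennreal_mult)
            finally show "?X \<le> ennreal (C * sqrt h) * ennreal \<gamma> + ennreal C * ennreal (L2_norm ?I d0)
                + ennreal (C * h) * ennreal (L2_norm ?I d2)" .
          qed
          then show "?X \<le> ennreal (C * sqrt h) * ennreal \<gamma> + ennreal (C * h) * deriv_norm ?I [1, 1] (l t)
              + ennreal C * ennreal (L2_norm ?I d0)"
            by (simp add: add_ac)
        qed
        then show "?X \<le> ennreal (C * h) * deriv_norm ?I [1, 1] (l t)
            + ennreal C * deriv_norm ?I [1] (\<lambda>y. l0h y - l0 y)
            + ennreal (C * sqrt h) * ennreal (sqrt (LINT s|lebesgue_on {0<..<t}. (L2_norm ?I (\<lambda>y. g (y, s)))\<^sup>2))"
          by (simp add: add_ac \<gamma>_def)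
      qed
      also have "\<dots> \<le> ?R"
        by (intro add_right_mono mult_left_mono) (simp_all add: add_increasing)
      finally show ?thesis .
    qed
    then show "let h = \<Lambda> / real N in \<forall>t\<ge>0.
           deriv_norm ?I [1] (\<lambda>y. lh t y - l t y)
             \<le> ennreal (C * h) * (deriv_norm ?I [1, 1] l0 + deriv_norm ?I [1, 1] (l t))
               + ennreal C * deriv_norm ?I [1] (\<lambda>y. l0h y - l0 y)
               + ennreal (C * sqrt h) * mixed_deriv_norm \<Lambda> t l"
      unfolding Let_def h_def by blast
  qed
qed

end
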